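(* Let $G$ be a rich flow admissible graph with maximum degree $\Delta$. Then $G$ admits a rich $(264\Delta - 445)$-flow.
   Context: Graphs are finite, may have multiple (parallel) edges, and have no loops. Two distinct edges are adjacent if they share at least one endvertex. A $\mathbb{Z}$-flow $\phi$ on $G$ is an assignment of an orientation and a value $\phi(e)\in\mathbb{Z}$ to each edge $e$ of $G$ such that at every vertex the sum of the values on incoming edges equals the sum of the values on outgoing edges. A $k$-flow is a $\mathbb{Z}$-flow with $|\phi(e)|<k$ for all edges $e$; it is nowhere-zero if $\phi(e)\neq 0$ for all edges $e$. A rich $k$-flow is a nowhere-zero $k$-flow $\phi$ such that $|\phi(e)|\neq|\phi(f)|$ for every pair of (distinct) adjacent edges $e$ and $f$. A graph $G$ is rich flow admissible if it is bridgeless and no two edges forming a $2$-edge-cut of $G$ are incident with a common vertex. *)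

theory Defs
  imports "Graph_Theory.Digraph"
begin

text \<open>
  Finite undirected multigraphs without loops. Edges have their own identity, so distinct edges may
  have the same set of endvertices. The theory \<^theory>\<open>Graph_Theory.Digraph\<close> provides only
  directed multigraphs; these are used below for orientations.
\<close>

record ('v, 'e) multigraph =
  vertices :: "'v set"
  edges :: "'e set"
  ends :: "'e \<Rightarrow> 'v set"

definition is_multigraph :: "('v, 'e) multigraph \<Rightarrow> bool" where
  "is_multigraph G \<longleftrightarrow> finite (vertices G) \<and> finite (edges G) \<and>
     (\<forall>e \<in> edges G. ends G e \<subseteq> vertices G \<and> card (ends G e) = 2)"

definition degree :: "('v, 'e) multigraph \<Rightarrow> 'v \<Rightarrow> nat" where
  "degree G v = card {e \<in> edges G. v \<in> ends G e}"

text \<open>The inserted \<open>0\<close> only matters for the graph without vertices.\<close>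

definition max_degree :: "('v, 'e) multigraph \<Rightarrow> nat" where
  "max_degree G = Max (insert 0 (degree G ` vertices G))"

definition adjacent_edges :: "('v, 'e) multigraph \<Rightarrow> 'e \<Rightarrow> 'e \<Rightarrow> bool" where
  "adjacent_edges G e f \<longleftrightarrow> e \<in> edges G \<and> f \<in> edges G \<and> e \<noteq> f \<and> ends G e \<inter> ends G f \<noteq> {}"

definition joined :: "('v, 'e) multigraph \<Rightarrow> ('v \<times> 'v) set" where
  "joined G = {(u, v). u \<in> vertices G \<and> v \<in> vertices G \<and>
     (u, v) \<in> {(x, y). \<exists>e \<in> edges G. ends G e = {x, y}}\<^sup>*}"

definition components :: "('v, 'e) multigraph \<Rightarrow> 'v set set" where
  "components G = vertices G // joined G"

definition delete_edge :: "('v, 'e) multigraph \<Rightarrow> 'e \<Rightarrow> ('v, 'e) multigraph" where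
  "delete_edge G e = G\<lparr>edges := edges G - {e}\<rparr>"

definition bridge :: "('v, 'e) multigraph \<Rightarrow> 'e \<Rightarrow> bool" where
  "bridge G e \<longleftrightarrow> e \<in> edges G \<and> card (components G) < card (components (delete_edge G e))"

definition bridgeless :: "('v, 'e) multigraph \<Rightarrow> bool" where
  "bridgeless G \<longleftrightarrow> (\<nexists>e. bridge G e)"

definition boundary :: "('v, 'e) multigraph \<Rightarrow> 'v set \<Rightarrow> 'e set" where
  "boundary G X = {e \<in> edges G. ends G e \<inter> X \<noteq> {} \<and> ends G e \<inter> (vertices G - X) \<noteq> {}}"

definition edge_cut :: "('v, 'e) multigraph \<Rightarrow> 'e set \<Rightarrow> bool" where
  "edge_cut G F \<longleftrightarrow> F \<noteq> {} \<and> (\<exists>X \<subseteq> vertices G. F = boundary G X)"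

definition rich_flow_admissible :: "('v, 'e) multigraph \<Rightarrow> bool" where
  "rich_flow_admissible G \<longleftrightarrow> bridgeless G \<and>
     (\<forall>e f. e \<noteq> f \<and> edge_cut G {e, f} \<longrightarrow> \<not> adjacent_edges G e f)"

definition orientation :: "('v, 'e) multigraph \<Rightarrow> ('v, 'e) pre_digraph \<Rightarrow> bool" where
  "orientation G D \<longleftrightarrow> verts D = vertices G \<and> arcs D = edges G \<and>
     (\<forall>e \<in> edges G. ends G e = {tail D e, head D e})"

definition int_flow :: "('v, 'e) multigraph \<Rightarrow> ('v, 'e) pre_digraph \<Rightarrow> ('e \<Rightarrow> int) \<Rightarrow> bool" where
  "int_flow G D \<phi> \<longleftrightarrow> orientation G D \<and>
     (\<forall>v \<in> vertices G. (\<Sum>e \<in> in_arcs D v. \<phi> e) = (\<Sum>e \<in> out_arcs D v. \<phi> e))"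

definition k_flow :: "int \<Rightarrow> ('v, 'e) multigraph \<Rightarrow> ('v, 'e) pre_digraph \<Rightarrow> ('e \<Rightarrow> int) \<Rightarrow> bool" where
  "k_flow k G D \<phi> \<longleftrightarrow> int_flow G D \<phi> \<and> (\<forall>e \<in> edges G. \<bar>\<phi> e\<bar> < k)"

definition nowhere_zero :: "('v, 'e) multigraph \<Rightarrow> ('e \<Rightarrow> int) \<Rightarrow> bool" where
  "nowhere_zero G \<phi> \<longleftrightarrow> (\<forall>e \<in> edges G. \<phi> e \<noteq> 0)"

definition rich_flow :: "int \<Rightarrow> ('v, 'e) multigraph \<Rightarrow> ('v, 'e) pre_digraph \<Rightarrow> ('e \<Rightarrow> int) \<Rightarrow> bool" where
  "rich_flow k G D \<phi> \<longleftrightarrow> k_flow k G D \<phi> \<and> nowhere_zero G \<phi> \<and>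
     (\<forall>e f. adjacent_edges G e f \<longrightarrow> \<bar>\<phi> e\<bar> \<noteq> \<bar>\<phi> f\<bar>)"

definition admits_rich_flow :: "int \<Rightarrow> ('v, 'e) multigraph \<Rightarrow> bool" where
  "admits_rich_flow k G \<longleftrightarrow> (\<exists>D \<phi>. rich_flow k G D \<phi>)"

end

theory Submission imports Defs begin

text \<open>
  Two families of vertex-disjoint circuits (the families being edge-disjoint from each other)
  carry integer flows with values 1 and 2. They are chosen, following Seymour, such that the graph
  is built from one vertex by repeatedly adding a new piece, which is a vertex or a chain of
  circuits, with at least two edges to the region built so far. Outside the circuits a flow is
  then chosen from the last piece backwards: all but one of the edges from a piece to the region
  below are free, so a bounded number of values can be avoided for each edge and for the last two
  edges of a piece together. This would yield a rich flow, but for two obstacles: two consecutive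
  edges of a circuit, and the last two edges of a piece if they are adjacent, must not sum to zero
  at their common vertex. Both are removed by splitting each such pair off its vertex through a
  new edge. The expanded graph is still bridgeless, because no such pair is a 2-edge-cut, so it
  has a nowhere-zero 6-flow, whose value on the new edge is the sum that has to be nonzero. All
  this takes place modulo \<open>30 (8 \<Delta> - 13)\<close>: the circuits determine the residues
  modulo 5, the 6-flow those modulo 6, and the greedy choice uses the factor
  \<open>8 \<Delta> - 13\<close>. A flow modulo \<open>N\<close> lifts to an integer flow with values smaller than \<open>N\<close>.

  Edge cuts of size two are handled by induction: one side is solved with the cut replaced by a
  single edge, and its values are then extended to the other side.
\<close>

section \<open>Integral flows and cuts\<close>

text \<open>Richness concerns absolute values, so for adjacent edges both the difference and the sum
  of the values must be nonzero modulo the final modulus. A circuit edge is separated by its residue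
  modulo 5 from everything but the other edge of its circuit at a vertex. For two such consecutive
  edges exactly one of difference and sum vanishes modulo 5, and up to sign it is their signed sum
  at the common vertex. For the last two edges of a piece the signed sum is dictated by
  conservation, so no greedy choice can change it. Both obstacles thus have the same form, a pair of
  edges at a vertex, and one auxiliary flow settles them. That flow depends on the pairs, and the
  residues depend on that flow. So circuits and pairs have to be fixed before any residue is known,
  and the greedy argument is made for every residue flow \<open>\<Phi>\<close> compatible with them.
  The auxiliary 6-flow comes from the same argument without richness, where \<open>ok\<close> puts
  no condition on pairs; hence nothing is circular.\<close>

definition inc :: "('e \<Rightarrow> 'v) \<Rightarrow> ('e \<Rightarrow> 'v) \<Rightarrow> 'e \<Rightarrow> 'v \<Rightarrow> int" where
  "inc t h e v = of_bool (t e = v) - of_bool (h e = v)"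

text \<open>Outflow minus inflow. A loop contributes 0, since the two terms of \<open>inc\<close>
  cancel; loops can occur in the case without richness, where \<open>two_cut\<close> may turn an
  edge into one.\<close>

definition net :: "('e \<Rightarrow> 'v) \<Rightarrow> ('e \<Rightarrow> 'v) \<Rightarrow> 'e set \<Rightarrow> ('e \<Rightarrow> int) \<Rightarrow> 'v \<Rightarrow> int" where
  "net t h E x v = (\<Sum>e\<in>E. inc t h e v * x e)"

definition cross :: "('e \<Rightarrow> 'v) \<Rightarrow> ('e \<Rightarrow> 'v) \<Rightarrow> 'e \<Rightarrow> 'v set \<Rightarrow> int" where
  "cross t h e Z = of_bool (t e \<in> Z) - of_bool (h e \<in> Z)"

lemma sum_inc: "finite Z \<Longrightarrow> (\<Sum>v\<in>Z. inc t h e v) = cross t h e Z"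
  unfolding inc_def cross_def by (simp add: sum_subtractf of_bool_def sum.delta)

lemma sum_net:
  assumes "finite Z"
  shows "(\<Sum>v\<in>Z. net t h E x v) = (\<Sum>e\<in>E. cross t h e Z * x e)"
proof -
  have "(\<Sum>v\<in>Z. net t h E x v) = (\<Sum>e\<in>E. \<Sum>v\<in>Z. inc t h e v * x e)"
    unfolding net_def by (rule sum.swap)
  then show ?thesis by (simp add: sum_inc[OF assms, symmetric] sum_distrib_right)
qed

lemma net_add: "net t h E (\<lambda>e. x e + y e) v = net t h E x v + net t h E y v"
  unfolding net_def by (simp add: algebra_simps sum.distrib)

lemma net_diff: "net t h E (\<lambda>e. x e - y e) v = net t h E x v - net t h E y v"
  unfolding net_def by (simp add: algebra_simps sum_subtractf)

lemma net_scale: "net t h E (\<lambda>e. c * x e) v = c * net t h E x v"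
  unfolding net_def by (simp add: algebra_simps sum_distrib_left)

lemma net_sum: "net t h E (\<lambda>e. \<Sum>i\<in>I. x i e) v = (\<Sum>i\<in>I. net t h E (x i) v)"
  unfolding net_def by (simp add: sum_distrib_left sum.swap[of _ I])

lemma net_of_bool:
  assumes "finite E" "p \<subseteq> E"
  shows "net t h E (\<lambda>e. of_bool (e \<in> p)) v = (\<Sum>e\<in>p. inc t h e v)"
proof -
  have "(\<Sum>e\<in>p. inc t h e v) = (\<Sum>e\<in>E. if e \<in> p then inc t h e v else 0)"
    using assms by (simp add: sum.inter_restrict[symmetric] Int_absorb1)
  also have "\<dots> = net t h E (\<lambda>e. of_bool (e \<in> p)) v"
    unfolding net_def by (rule sum.cong) auto
  finally show ?thesis by simp
qed

definition arcrel :: "('e \<Rightarrow> 'v) \<Rightarrow> ('e \<Rightarrow> 'v) \<Rightarrow> 'e set \<Rightarrow> ('v \<times> 'v) set" where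
  "arcrel t h F = {(t e, h e) | e. e \<in> F}"

lemma arcrelI: "e \<in> F \<Longrightarrow> (t e, h e) \<in> arcrel t h F"
  unfolding arcrel_def by auto

text \<open>The path follows strictly decreasing distances to its target, so no arc is used twice.\<close>

lemma path_arcs:
  fixes t h :: "'e \<Rightarrow> 'v"
  assumes "(v, w) \<in> (arcrel t h F)\<^sup>*"
  shows "\<exists>p \<subseteq> F. finite p \<and> (\<forall>u. (\<Sum>e\<in>p. inc t h e u) = of_bool (u = v) - of_bool (u = w))
           \<and> (\<forall>e\<in>p. t e \<noteq> w)"
proof -
  define R where "R = arcrel t h F"
  define d where "d = (\<lambda>x. LEAST n. (x, w) \<in> R ^^ n)"
  have "\<forall>x. (x, w) \<in> R\<^sup>* \<and> d x = n \<longrightarrow>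
     (\<exists>p \<subseteq> F. finite p \<and> (\<forall>u. (\<Sum>e\<in>p. inc t h e u) = of_bool (u = x) - of_bool (u = w))
         \<and> (\<forall>e\<in>p. t e \<noteq> w \<and> d (t e) \<le> n))" for n
  proof (induction n)
    case 0
    show ?case
    proof (intro allI impI)
      fix x assume x: "(x, w) \<in> R\<^sup>* \<and> d x = 0"
      then obtain k where "(x, w) \<in> R ^^ k" using rtrancl_power by blast
      then have "(x, w) \<in> R ^^ d x" unfolding d_def by (rule LeastI)
      then have "x = w" using x by simp
      then show "\<exists>p\<subseteq>F. finite p \<and> (\<forall>u. (\<Sum>e\<in>p. inc t h e u) = of_bool (u = x) - of_bool (u = w))
         \<and> (\<forall>e\<in>p. t e \<noteq> w \<and> d (t e) \<le> 0)" by (intro exI[of _ "{}"]) auto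
    qed
  next
    case (Suc n)
    show ?case
    proof (intro allI impI)
      fix x assume x: "(x, w) \<in> R\<^sup>* \<and> d x = Suc n"
      then obtain k where "(x, w) \<in> R ^^ k" using rtrancl_power by blast
      then have "(x, w) \<in> R ^^ d x" unfolding d_def by (rule LeastI)
      then have "(x, w) \<in> R O R ^^ n" using x by (simp add: relpow_commute)
      then obtain y where y: "(x, y) \<in> R" "(y, w) \<in> R ^^ n" by blast
      have yw: "(y, w) \<in> R\<^sup>*" using y(2) by (rule relpow_imp_rtrancl)
      have le: "d y \<le> n" unfolding d_def by (rule Least_le) (rule y(2))
      have "(y, w) \<in> R ^^ d y" unfolding d_def using y(2) by (rule LeastI)
      then have "(x, w) \<in> R ^^ Suc (d y)" using y(1) by (metis relpow_Suc_I2)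
      then have "d x \<le> Suc (d y)" unfolding d_def by (rule Least_le)
      then have dy: "d y = n" using le x by simp
      have "\<exists>p\<subseteq>F. finite p \<and> (\<forall>u. (\<Sum>e\<in>p. inc t h e u) = of_bool (u = y) - of_bool (u = w))
         \<and> (\<forall>e\<in>p. t e \<noteq> w \<and> d (t e) \<le> n)" using spec[OF Suc.IH, of y] yw dy by simp
      then obtain p where p: "p \<subseteq> F" "finite p"
        "\<And>u. (\<Sum>e\<in>p. inc t h e u) = of_bool (u = y) - of_bool (u = w)"
        "\<And>e. e \<in> p \<Longrightarrow> t e \<noteq> w \<and> d (t e) \<le> n" by (elim exE conjE) simp
      obtain a where a: "a \<in> F" "t a = x" "h a = y" using y(1) unfolding R_def arcrel_def by auto
      have anp: "a \<notin> p" using p(4)[of a] a x by auto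
      have "d w = 0" unfolding d_def by (rule Least_eq_0) simp
      then have xw: "x \<noteq> w" using x by auto
      show "\<exists>p\<subseteq>F. finite p \<and> (\<forall>u. (\<Sum>e\<in>p. inc t h e u) = of_bool (u = x) - of_bool (u = w))
         \<and> (\<forall>e\<in>p. t e \<noteq> w \<and> d (t e) \<le> Suc n)"
      proof (intro exI[of _ "insert a p"] conjI allI ballI)
        fix u show "(\<Sum>e\<in>insert a p. inc t h e u) = of_bool (u = x) - of_bool (u = w)"
          using anp p(2) p(3)[of u] a by (auto simp: inc_def)
      qed (use p a xw x in \<open>auto simp: le_SucI\<close>)
    qed
  qed
  from spec[OF this[of "d v"], of v] obtain p where "p \<subseteq> F" "finite p"
      "\<forall>u. (\<Sum>e\<in>p. inc t h e u) = of_bool (u = v) - of_bool (u = w)" "\<forall>e\<in>p. t e \<noteq> w \<and> d (t e) \<le> d v"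
    using assms unfolding R_def by (elim impE) (simp, elim exE conjE, simp)
  then show ?thesis by (intro exI[of _ p]) simp
qed

text \<open>Gale's supply-demand theorem for unit capacities. A set \<open>S\<close> of least total
  deviation from \<open>b\<close> has no augmenting path from a vertex \<open>a\<close> with too
  little outflow to one with too much; if the deviation were not 0, the vertices reachable from
  \<open>a\<close> would violate the cut condition.\<close>

lemma gale:
  fixes t h :: "'e \<Rightarrow> 'v" and b :: "'v \<Rightarrow> int"
  assumes fin: "finite V" "finite E"
    and ends: "\<And>e. e \<in> E \<Longrightarrow> t e \<in> V \<and> h e \<in> V"
    and b0: "(\<Sum>v\<in>V. b v) = 0"
    and cut: "\<And>Z. Z \<subseteq> V \<Longrightarrow> (\<Sum>v\<in>Z. b v) \<le> int (card {e \<in> E. t e \<in> Z \<and> h e \<notin> Z})"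
  shows "\<exists>S \<subseteq> E. \<forall>v\<in>V. (\<Sum>e\<in>S. inc t h e v) = b v"
proof -
  define ns where "ns = (\<lambda>S v. \<Sum>e\<in>S. inc t h e v)"
  define dev where "dev = (\<lambda>S. nat (\<Sum>v\<in>V. \<bar>ns S v - b v\<bar>))"
  obtain S where S: "S \<subseteq> E" and Smin: "\<And>S'. S' \<subseteq> E \<Longrightarrow> dev S \<le> dev S'"
    using ex_has_least_nat[of "\<lambda>S. S \<subseteq> E" "{}" dev] by auto
  have finS: "finite S" using S fin(2) finite_subset by blast
  have sum0: "(\<Sum>v\<in>V. ns S v) = 0"
  proof -
    have "(\<Sum>v\<in>V. ns S v) = (\<Sum>e\<in>S. cross t h e V)" unfolding ns_def
      by (subst sum.swap) (simp add: sum_inc fin)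
    also have "\<dots> = 0" using S ends by (intro sum.neutral) (auto simp: cross_def)
    finally show ?thesis .
  qed
  have "\<forall>v\<in>V. ns S v = b v"
  proof (rule ccontr)
    assume "\<not> (\<forall>v\<in>V. ns S v = b v)"
    then obtain v0 where v0: "v0 \<in> V" "ns S v0 \<noteq> b v0" by blast
    have "\<exists>a\<in>V. ns S a < b a"
    proof (rule ccontr)
      assume "\<not> (\<exists>a\<in>V. ns S a < b a)"
      then have ge: "\<And>v. v \<in> V \<Longrightarrow> b v \<le> ns S v" by force
      have "(\<Sum>v\<in>V. b v) < (\<Sum>v\<in>V. ns S v)"
        by (rule sum_strict_mono_ex1[OF fin(1)]) (use ge v0 in \<open>auto intro!: bexI[of _ v0] simp: less_le\<close>)
      then show False using b0 sum0 by simp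
    qed
    then obtain a where a: "a \<in> V" "ns S a < b a" by blast
    define rt where "rt = (\<lambda>(e, d). if d then t e else h e)"
    define rh where "rh = (\<lambda>(e, d). if d then h e else t e)"
    \<comment> \<open>Residual graph of \<open>S\<close>: an edge outside \<open>S\<close> may be
      added and is traversed forwards (\<open>True\<close>), an edge of \<open>S\<close> may be
      removed and is traversed backwards (\<open>False\<close>).\<close>
    define F where "F = {(e, True) | e. e \<in> E - S} \<union> {(e, False) | e. e \<in> S}"
    define Z where "Z = {x. (a, x) \<in> (arcrel rt rh F)\<^sup>*}"
    have aZ: "a \<in> Z" unfolding Z_def by simp
    have ZV: "Z \<subseteq> V"
    proof
      fix x assume "x \<in> Z"
      then have "(a, x) \<in> (arcrel rt rh F)\<^sup>*" unfolding Z_def by simp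
      then show "x \<in> V"
        by (induction) (use a ends S in \<open>auto simp: arcrel_def F_def rh_def\<close>)
    qed
    have out: "e \<in> S" if "e \<in> E" "t e \<in> Z" "h e \<notin> Z" for e
    proof (rule ccontr)
      assume "e \<notin> S"
      then have "(e, True) \<in> F" using that unfolding F_def by auto
      then have "(t e, h e) \<in> arcrel rt rh F" using arcrelI[of "(e, True)" F rt rh] by (simp add: rt_def rh_def)
      then show False using that unfolding Z_def by (auto intro: rtrancl_into_rtrancl)
    qed
    have inn: "e \<notin> S" if "t e \<notin> Z" "h e \<in> Z" for e
    proof
      assume "e \<in> S"
      then have "(e, False) \<in> F" using that unfolding F_def by auto
      then have "(h e, t e) \<in> arcrel rt rh F" using arcrelI[of "(e, False)" F rt rh] by (simp add: rt_def rh_def)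
      then show False using that unfolding Z_def by (auto intro: rtrancl_into_rtrancl)
    qed
    show False
    proof (cases "\<exists>c\<in>Z. ns S c > b c")
      case True
      then obtain c where c: "c \<in> Z" "ns S c > b c" by blast
      then have "(a, c) \<in> (arcrel rt rh F)\<^sup>*" unfolding Z_def by simp
      from path_arcs[OF this] obtain p where p: "p \<subseteq> F" "finite p"
        "\<And>u. (\<Sum>e\<in>p. inc rt rh e u) = of_bool (u = a) - of_bool (u = c)" by blast
      define A where "A = {e. (e, True) \<in> p}"
      define B where "B = {e. (e, False) \<in> p}"
      have pAB: "p = (\<lambda>e. (e, True)) ` A \<union> (\<lambda>e. (e, False)) ` B"
      proof -
        have "x \<in> p \<longleftrightarrow> x \<in> (\<lambda>e. (e, True)) ` A \<union> (\<lambda>e. (e, False)) ` B" for x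
          by (cases x; cases "snd x") (auto simp: A_def B_def)
        then show ?thesis by blast
      qed
      have AE: "A \<subseteq> E - S" and BS: "B \<subseteq> S" using p(1) unfolding A_def B_def F_def by auto
      have finAB: "finite A" "finite B" using AE BS finS fin(2) by (auto intro: finite_subset)
      define S' where "S' = (S - B) \<union> A"
      have S'E: "S' \<subseteq> E" unfolding S'_def using S AE by auto
      have ns': "ns S' u = ns S u + of_bool (u = a) - of_bool (u = c)" for u
      proof -
        have "(\<Sum>e\<in>p. inc rt rh e u) = (\<Sum>e\<in>A. inc t h e u) - (\<Sum>e\<in>B. inc t h e u)"
        proof -
          have "(\<Sum>e\<in>p. inc rt rh e u) = (\<Sum>e\<in>(\<lambda>e. (e, True)) ` A. inc rt rh e u)
            + (\<Sum>e\<in>(\<lambda>e. (e, False)) ` B. inc rt rh e u)"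
            unfolding pAB by (rule sum.union_disjoint) (use finAB in auto)
          also have "\<dots> = (\<Sum>e\<in>A. inc rt rh (e, True) u) + (\<Sum>e\<in>B. inc rt rh (e, False) u)"
            by (simp add: sum.reindex inj_on_def)
          also have "\<dots> = (\<Sum>e\<in>A. inc t h e u) - (\<Sum>e\<in>B. inc t h e u)"
            unfolding inc_def rt_def rh_def by (simp add: sum_subtractf)
          finally show ?thesis .
        qed
        moreover have "ns S' u = ns (S - B) u + ns A u" unfolding S'_def ns_def
          by (rule sum.union_disjoint) (use finS finAB AE in auto)
        moreover have "ns (S - B) u = ns S u - ns B u" unfolding ns_def
          by (rule sum_diff) (use finS BS in auto)
        ultimately show ?thesis using p(3)[of u] unfolding ns_def by simp
      qed
      have "(\<Sum>v\<in>V. \<bar>ns S' v - b v\<bar>) < (\<Sum>v\<in>V. \<bar>ns S v - b v\<bar>)"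
        by (rule sum_strict_mono_ex1[OF fin(1)])
          (use a c ns' in \<open>auto intro!: bexI[of _ a]\<close>)
      moreover have "0 \<le> (\<Sum>v\<in>V. \<bar>ns S' v - b v\<bar>)" by (rule sum_nonneg) simp
      ultimately have "dev S' < dev S" unfolding dev_def by linarith
      then show False using Smin[OF S'E] by simp
    next
      case False
      then have le: "\<And>z. z \<in> Z \<Longrightarrow> ns S z \<le> b z" by force
      have finZ: "finite Z" using ZV fin(1) finite_subset by blast
      have "(\<Sum>v\<in>Z. ns S v) < (\<Sum>v\<in>Z. b v)"
        by (rule sum_strict_mono_ex1[OF finZ]) (use le a aZ in auto)
      \<comment> \<open>All edges of \<open>E\<close> that leave \<open>Z\<close> lie in
        \<open>S\<close> and no edge of \<open>S\<close> enters \<open>Z\<close>, so the net value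
        of \<open>Z\<close> is its full outgoing capacity.\<close>
      moreover have "(\<Sum>v\<in>Z. ns S v) = int (card {e \<in> E. t e \<in> Z \<and> h e \<notin> Z})"
      proof -
        have "(\<Sum>v\<in>Z. ns S v) = (\<Sum>e\<in>S. cross t h e Z)" unfolding ns_def
          by (subst sum.swap) (simp add: sum_inc finZ)
        also have "\<dots> = (\<Sum>e\<in>S. of_bool (t e \<in> Z \<and> h e \<notin> Z))"
          by (rule sum.cong) (use inn in \<open>auto simp: cross_def\<close>)
        also have "\<dots> = int (card {e \<in> S. t e \<in> Z \<and> h e \<notin> Z})" using finS by (simp add: sum.inter_filter[symmetric] of_bool_def)
        also have "{e \<in> S. t e \<in> Z \<and> h e \<notin> Z} = {e \<in> E. t e \<in> Z \<and> h e \<notin> Z}" using out S by auto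
        finally show ?thesis .
      qed
      ultimately show False using cut[OF ZV] by simp
    qed
  qed
  then show ?thesis using S unfolding ns_def by blast
qed

section \<open>Acyclic flows between two vertices\<close>

abbreviation reach :: "('e \<Rightarrow> 'v) \<Rightarrow> ('e \<Rightarrow> 'v) \<Rightarrow> 'e set \<Rightarrow> 'v \<Rightarrow> 'v set" where
  "reach t h S v \<equiv> {x. (v, x) \<in> (arcrel t h S)\<^sup>*}"

lemma reach_step: "a \<in> S \<Longrightarrow> (v, t a) \<in> (arcrel t h S)\<^sup>* \<Longrightarrow> (v, h a) \<in> (arcrel t h S)\<^sup>*"
  using arcrelI[of a S t h] by (auto intro: rtrancl_into_rtrancl)

lemma sum_inc_eq:
  assumes "finite S"
  shows "(\<Sum>e\<in>S. inc t h e v) = int (card {e\<in>S. t e = v}) - int (card {e\<in>S. h e = v})"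
  using assms unfolding inc_def
  by (simp add: sum_subtractf of_bool_def sum.inter_filter[symmetric])

text \<open>Menger's theorem for directed edges in the language of flows: \<open>gale\<close> with
  supply \<open>q\<close> at \<alpha> and demand \<open>q\<close> at \<beta>. A solution with the
  fewest edges is acyclic, since a directed circuit could be deleted.\<close>

lemma minflow:
  fixes t h :: "'e \<Rightarrow> 'v" and q :: nat
  assumes fin: "finite V" "finite E"
    and ends: "\<And>e. e \<in> E \<Longrightarrow> t e \<in> V \<and> h e \<in> V"
    and ab: "\<alpha> \<in> V" "\<beta> \<in> V" "\<alpha> \<noteq> \<beta>"
    and cut: "\<And>Z. Z \<subseteq> V \<Longrightarrow> \<alpha> \<in> Z \<Longrightarrow> \<beta> \<notin> Z \<Longrightarrow> q \<le> card {e \<in> E. t e \<in> Z \<and> h e \<notin> Z}"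
  shows "\<exists>S \<subseteq> E. (\<forall>v. (\<Sum>e\<in>S. inc t h e v) = int q * (of_bool (v = \<alpha>) - of_bool (v = \<beta>)))
       \<and> (\<forall>a\<in>S. (h a, t a) \<notin> (arcrel t h S)\<^sup>*)"
proof -
  define b where "b = (\<lambda>v. int q * (of_bool (v = \<alpha>) - of_bool (v = \<beta>)))"
  define good where "good = (\<lambda>S. S \<subseteq> E \<and> (\<forall>v. (\<Sum>e\<in>S. inc t h e v) = b v))"
  have bZ: "(\<Sum>v\<in>Z. b v) = int q * (of_bool (\<alpha> \<in> Z) - of_bool (\<beta> \<in> Z))" if "Z \<subseteq> V" for Z
  proof -
    have "finite Z" using that fin(1) finite_subset by blast
    then show ?thesis unfolding b_def
      by (simp add: sum_distrib_left[symmetric] sum_subtractf of_bool_def sum.delta)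
  qed
  have "\<exists>S\<subseteq>E. \<forall>v\<in>V. (\<Sum>e\<in>S. inc t h e v) = b v"
  proof (rule gale[OF fin ends])
    show "(\<Sum>v\<in>V. b v) = 0" using bZ[OF subset_refl] ab by simp
  next
    fix Z assume Z: "Z \<subseteq> V"
    show "(\<Sum>v\<in>Z. b v) \<le> int (card {e \<in> E. t e \<in> Z \<and> h e \<notin> Z})"
      unfolding bZ[OF Z] using cut[OF Z] by (cases "\<alpha> \<in> Z"; cases "\<beta> \<in> Z") auto
  qed
  then obtain S0 where S0: "S0 \<subseteq> E" "\<forall>v\<in>V. (\<Sum>e\<in>S0. inc t h e v) = b v" by blast
  have out: "(\<Sum>e\<in>S. inc t h e v) = b v" if "S \<subseteq> E" "v \<notin> V" for S v
  proof -
    have "(\<Sum>e\<in>S. inc t h e v) = 0" by (rule sum.neutral) (use that ends in \<open>auto simp: inc_def\<close>)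
    then show ?thesis using that ab by (auto simp: b_def)
  qed
  have "good S0" unfolding good_def using S0 out by blast
  then obtain S where S: "good S" and Smin: "\<And>S'. good S' \<Longrightarrow> card S \<le> card S'"
    using ex_has_least_nat[of good S0 card] by auto
  have SE: "S \<subseteq> E" and Sb: "\<And>v. (\<Sum>e\<in>S. inc t h e v) = b v" using S unfolding good_def by auto
  have finS: "finite S" using SE fin(2) finite_subset by blast
  have "(h a, t a) \<notin> (arcrel t h S)\<^sup>*" if a: "a \<in> S" for a
  proof
    assume "(h a, t a) \<in> (arcrel t h S)\<^sup>*"
    \<comment> \<open>No arc of the path starts at its end \<open>t a\<close>, so the path avoids
      \<open>a\<close> and closes up with it to a directed circuit.\<close>
    from path_arcs[OF this] obtain p where p: "p \<subseteq> S" "finite p"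
      "\<And>u. (\<Sum>e\<in>p. inc t h e u) = of_bool (u = h a) - of_bool (u = t a)" "\<And>e. e \<in> p \<Longrightarrow> t e \<noteq> t a"
      by blast
    have ap: "a \<notin> p" using p(4)[of a] by auto
    define C where "C = insert a p"
    have C0: "(\<Sum>e\<in>C. inc t h e u) = 0" for u
      unfolding C_def using ap p(2) p(3)[of u] by (simp add: inc_def)
    have CS: "C \<subseteq> S" unfolding C_def using a p(1) by auto
    have "(\<Sum>e\<in>S - C. inc t h e v) = b v" for v
      using sum_diff[OF finS CS, of "\<lambda>e. inc t h e v"] C0 Sb by simp
    then have "good (S - C)" unfolding good_def using SE by auto
    then have "card S \<le> card (S - C)" by (rule Smin)
    moreover have "card (S - C) < card S" using finS CS a by (intro psubset_card_mono) (auto simp: C_def)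
    ultimately show False by simp
  qed
  then show ?thesis using SE Sb unfolding b_def by blast
qed

section \<open>Chains of circuits\<close>

text \<open>Serves for chains of circuits with \<open>q = 2\<close> and for paths with
  \<open>q = 1\<close>. Acyclicity puts the tail of every arc into \<open>v\<close> outside the set
  reachable from \<open>v\<close>, so all these arcs cross the boundary of that set.\<close>

locale acyclic_flow =
  fixes t h :: "'e \<Rightarrow> 'v" and V :: "'v set" and S :: "'e set" and \<alpha> \<beta> :: 'v and q :: nat
  assumes finV: "finite V" and finS: "finite S"
    and ends: "\<And>e. e \<in> S \<Longrightarrow> t e \<in> V \<and> h e \<in> V"
    and ab: "\<alpha> \<in> V" "\<beta> \<in> V" "\<alpha> \<noteq> \<beta>" and q: "q > 0"
    and flow: "\<And>v. (\<Sum>e\<in>S. inc t h e v) = int q * (of_bool (v = \<alpha>) - of_bool (v = \<beta>))"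
    and acyc: "\<And>a. a \<in> S \<Longrightarrow> (h a, t a) \<notin> (arcrel t h S)\<^sup>*"
begin

abbreviation "R \<equiv> (arcrel t h S)\<^sup>*"

definition "indeg v = card {e\<in>S. h e = v}"
definition "outdeg v = card {e\<in>S. t e = v}"
definition "inarcs v = {e\<in>S. t e \<notin> reach t h S v \<and> h e \<in> reach t h S v}"

lemma reach_V: "v \<in> V \<Longrightarrow> reach t h S v \<subseteq> V"
proof
  fix x assume v: "v \<in> V" and "x \<in> reach t h S v"
  then have "(v, x) \<in> R" by simp
  then show "x \<in> V" by induction (use v ends in \<open>auto simp: arcrel_def\<close>)
qed

text \<open>No arc of \<open>S\<close> leaves the set reachable from \<open>v\<close>, so a flow
  \<open>S'\<close> inside \<open>S\<close> meets its boundary only in entering arcs, and their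
  number is minus the net value of the set. A smaller \<open>S'\<close> shows how single units of
  flow are distributed over the entering arcs.\<close>

lemma card_in:
  assumes "v \<in> V" "S' \<subseteq> S" "\<And>u. (\<Sum>e\<in>S'. inc t h e u) = k * (of_bool (u = \<alpha>) - of_bool (u = \<beta>))"
  shows "int (card (inarcs v \<inter> S')) = k * (of_bool ((v, \<beta>) \<in> R) - of_bool ((v, \<alpha>) \<in> R))"
proof -
  let ?Z = "reach t h S v"
  have fin: "finite ?Z" using reach_V[OF assms(1)] finV finite_subset by blast
  have finS': "finite S'" using assms(2) finS finite_subset by blast
  have "(\<Sum>u\<in>?Z. \<Sum>e\<in>S'. inc t h e u) = (\<Sum>e\<in>S'. cross t h e ?Z)"
    by (subst sum.swap) (simp add: sum_inc[OF fin])
  also have "\<dots> = (\<Sum>e\<in>S'. - of_bool (e \<in> inarcs v))"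
    by (rule sum.cong) (use assms(2) reach_step[of _ S v t h] in \<open>auto simp: cross_def inarcs_def\<close>)
  also have "\<dots> = - int (card (inarcs v \<inter> S'))"
    using finS' by (simp add: sum_negf of_bool_def sum.inter_filter[symmetric] Int_def conj_commute)
  finally have "int (card (inarcs v \<inter> S')) = - (\<Sum>u\<in>?Z. k * (of_bool (u = \<alpha>) - of_bool (u = \<beta>)))"
    unfolding assms(3) by simp
  also have "\<dots> = k * (of_bool ((v, \<beta>) \<in> R) - of_bool ((v, \<alpha>) \<in> R))"
    using fin by (simp add: sum_distrib_left[symmetric] sum_subtractf of_bool_def sum.delta algebra_simps)
  finally show ?thesis .
qed

lemma at_inarcs: "{e\<in>S. h e = v} \<subseteq> inarcs v"
  unfolding inarcs_def using acyc by auto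

lemma inarcs_S: "inarcs v \<subseteq> S" unfolding inarcs_def by auto

lemma card_inarcs: "v \<in> V \<Longrightarrow> int (card (inarcs v)) = int q * (of_bool ((v, \<beta>) \<in> R) - of_bool ((v, \<alpha>) \<in> R))"
  using card_in[of v S, OF _ subset_refl flow] by (simp add: Int_absorb2 inarcs_S)

lemma indeg_le: "v \<in> V \<Longrightarrow> indeg v \<le> q"
proof -
  assume v: "v \<in> V"
  have "indeg v \<le> card (inarcs v)" unfolding indeg_def
    by (rule card_mono) (use at_inarcs finite_subset[OF inarcs_S finS] in auto)
  also have "\<dots> \<le> q" using card_inarcs[OF v] by (cases "(v, \<beta>) \<in> R"; cases "(v, \<alpha>) \<in> R") auto
  finally show ?thesis .
qed

lemma indeg_reach: "v \<in> V \<Longrightarrow> indeg v > 0 \<Longrightarrow> (v, \<beta>) \<in> R \<and> (v, \<alpha>) \<notin> R"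
proof -
  assume v: "v \<in> V" and pos: "indeg v > 0"
  have "indeg v \<le> card (inarcs v)" unfolding indeg_def
    by (rule card_mono) (use at_inarcs finite_subset[OF inarcs_S finS] in auto)
  then show ?thesis using card_inarcs[OF v] pos q
    by (cases "(v, \<beta>) \<in> R"; cases "(v, \<alpha>) \<in> R") auto
qed

lemma deg_eq: "int (outdeg v) - int (indeg v) = int q * (of_bool (v = \<alpha>) - of_bool (v = \<beta>))"
  using flow[of v] sum_inc_eq[OF finS, of t h v] unfolding outdeg_def indeg_def by simp

lemma indeg_\<alpha>: "indeg \<alpha> = 0" using indeg_reach[OF ab(1)] by (cases "indeg \<alpha>") auto
lemma outdeg_\<alpha>: "outdeg \<alpha> = q" using deg_eq[of \<alpha>] indeg_\<alpha> ab by simp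
lemma indeg_\<beta>: "indeg \<beta> = q" using deg_eq[of \<beta>] indeg_le[OF ab(2)] ab by simp
lemma outdeg_\<beta>: "outdeg \<beta> = 0" using deg_eq[of \<beta>] indeg_\<beta> ab by simp
lemma deg_inner: "v \<noteq> \<alpha> \<Longrightarrow> v \<noteq> \<beta> \<Longrightarrow> outdeg v = indeg v" using deg_eq[of v] by simp

lemma touch_reach:
  assumes "a \<in> S"
  shows "(h a, \<beta>) \<in> R" "(t a, \<beta>) \<in> R"
proof -
  have "indeg (h a) > 0" unfolding indeg_def using assms finS by (auto simp: card_gt_0_iff)
  then show 1: "(h a, \<beta>) \<in> R" using indeg_reach ends[OF assms] by blast
  show "(t a, \<beta>) \<in> R" using arcrelI[OF assms, of t h] 1 by (auto intro: converse_rtrancl_into_rtrancl)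
qed

lemma card_touch: "v \<in> V \<Longrightarrow> card {e\<in>S. t e = v \<or> h e = v} = outdeg v + indeg v"
proof -
  have "{e\<in>S. t e = v \<or> h e = v} = {e\<in>S. t e = v} \<union> {e\<in>S. h e = v}" by auto
  moreover have "{e\<in>S. t e = v} \<inter> {e\<in>S. h e = v} = {}" using acyc by fastforce
  ultimately show ?thesis unfolding outdeg_def indeg_def using finS by (simp add: card_Un_disjoint)
qed

end

text \<open>With two units of flow the arcs are two-coloured by the parity of the number of cut vertices
  (those entered by both units) behind them; each colour class is then a disjoint union of circuits.\<close>

lemma chain_arcs:
  fixes t h :: "'e \<Rightarrow> 'v"
  assumes af: "acyclic_flow t h V S \<alpha> \<beta> 2"
  shows "\<exists>z c. (\<forall>a\<in>S. z a = 1 \<or> z a = (- 1 :: int)) \<and> 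
     (\<forall>k::bool. \<forall>v\<in>V. (\<Sum>e\<in>{e\<in>S. c e = k}. inc t h e v * z e) = 0
         \<and> card {e\<in>S. c e = k \<and> (t e = v \<or> h e = v)} \<le> 2)"
proof -
  interpret acyclic_flow t h V S \<alpha> \<beta> 2 by (rule af)
  define F where "F = {v\<in>V. v \<noteq> \<beta> \<and> indeg v = 2}"
  have finF: "finite F" unfolding F_def using finV by auto
  define N where "N = (\<lambda>x. card {v\<in>F. (v, x) \<in> R})"
  define c where "c = (\<lambda>a. even (N (t a)))"
  \<comment> \<open>Both units of flow enter \<open>v\<close>, so no other arc enters the set
    reachable from \<open>v\<close>: whatever lies behind \<open>v\<close> is reached through
    \<open>v\<close> only.\<close>
  have full: "{e\<in>S. h e = v} = inarcs v" if "v \<in> V" "indeg v = 2" for v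
  proof (rule card_subset_eq)
    show "finite (inarcs v)" using inarcs_S finS finite_subset by blast
    show "{e\<in>S. h e = v} \<subseteq> inarcs v" by (rule at_inarcs)
    have "card (inarcs v) \<ge> 2" using that(2) unfolding indeg_def[symmetric]
      by (metis (no_types, lifting) at_inarcs card_mono finS finite_subset inarcs_S indeg_def)
    then show "card {e\<in>S. h e = v} = card (inarcs v)" using card_inarcs[OF that(1)] that(2)
      unfolding indeg_def by (cases "(v, \<beta>) \<in> R"; cases "(v, \<alpha>) \<in> R") auto
  qed
  \<comment> \<open>Along an arc the only cut vertex that can be gained is its head, so the colour
    changes exactly at the vertices of \<open>F\<close>.\<close>
  have Nin: "{v\<in>F. (v, t a) \<in> R} = {v\<in>F. (v, h a) \<in> R} - {h a}" if a: "a \<in> S" for a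
  proof (intro equalityI subsetI)
    fix v assume "v \<in> {v\<in>F. (v, t a) \<in> R}"
    then show "v \<in> {v\<in>F. (v, h a) \<in> R} - {h a}" using reach_step[OF a, of v t h] acyc[OF a] by auto
  next
    fix v assume v: "v \<in> {v\<in>F. (v, h a) \<in> R} - {h a}"
    then have "a \<notin> inarcs v" using full[of v] unfolding F_def by auto
    then show "v \<in> {v\<in>F. (v, t a) \<in> R}" using v a unfolding inarcs_def by auto
  qed
  have NNt: "N (t a) = card ({v\<in>F. (v, h a) \<in> R} - {h a})" if "a \<in> S" for a
    using Nin[OF that] by (simp add: N_def)
  have cin_full: "c a = odd (N (h a))" if "a \<in> S" "h a \<in> F" for a
  proof -
    have "card ({v\<in>F. (v, h a) \<in> R} - {h a}) = N (h a) - 1" unfolding N_def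
      by (rule card_Diff_singleton) (use that in auto)
    moreover have "N (h a) > 0" unfolding N_def using that finF by (auto simp: card_gt_0_iff)
    ultimately show ?thesis unfolding c_def NNt[OF that(1)] by (cases "N (h a)") auto
  qed
  have cin: "c a = even (N (h a))" if "a \<in> S" "h a \<notin> F" for a
  proof -
    have "{v\<in>F. (v, h a) \<in> R} - {h a} = {v\<in>F. (v, h a) \<in> R}" using that by auto
    then show ?thesis unfolding c_def NNt[OF that(1)] unfolding N_def by simp
  qed
  have "\<exists>Y\<subseteq>S. (\<forall>v. (\<Sum>e\<in>Y. inc t h e v) = int 1 * (of_bool (v = \<alpha>) - of_bool (v = \<beta>)))
       \<and> (\<forall>a\<in>Y. (h a, t a) \<notin> (arcrel t h Y)\<^sup>*)"
  proof (rule minflow[OF finV finS ends ab])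
    fix Z assume Z: "Z \<subseteq> V" "\<alpha> \<in> Z" "\<beta> \<notin> Z"
    have finZ: "finite Z" using Z finV finite_subset by blast
    have "(\<Sum>u\<in>Z. \<Sum>e\<in>S. inc t h e u) = (\<Sum>e\<in>S. cross t h e Z)"
      by (subst sum.swap) (simp add: sum_inc[OF finZ])
    also have "\<dots> \<le> (\<Sum>e\<in>S. of_bool (t e \<in> Z \<and> h e \<notin> Z))"
      by (rule sum_mono) (auto simp: cross_def)
    also have "\<dots> = int (card {e \<in> S. t e \<in> Z \<and> h e \<notin> Z})"
      using finS by (simp add: of_bool_def sum.inter_filter[symmetric])
    also have "(\<Sum>u\<in>Z. \<Sum>e\<in>S. inc t h e u) = 2"
      unfolding flow using Z finZ by (simp add: sum_distrib_left[symmetric] sum_subtractf of_bool_def sum.delta)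
    finally show "1 \<le> card {e \<in> S. t e \<in> Z \<and> h e \<notin> Z}" by simp
  qed
  then obtain Y where Y: "Y \<subseteq> S" and Yf: "\<And>v. (\<Sum>e\<in>Y. inc t h e v) = of_bool (v = \<alpha>) - of_bool (v = \<beta>)"
    by auto
  have finY: "finite Y" using Y finS finite_subset by blast
  \<comment> \<open>One unit of flow counts 1 and the other -1, so they cancel at every vertex. At a
    vertex of \<open>F\<close> each unit enters by one of the two arcs, so already the entering arcs
    cancel; hence each colour class conserves \<open>z\<close> by itself.\<close>
  define z where "z = (\<lambda>a. 2 * of_bool (a \<in> Y) - 1 :: int)"
  have sz: "(\<Sum>e\<in>T. z e) = 2 * int (card (T \<inter> Y)) - int (card T)" if "finite T" for T
    unfolding z_def using that
    by (simp add: sum_subtractf sum_distrib_left[symmetric] of_bool_def sum.inter_filter[symmetric] Int_def)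
  have zin: "(\<Sum>e\<in>{e\<in>S. h e = v}. z e) = 0" if "v \<in> F" for v
  proof -
    have v: "v \<in> V" "indeg v = 2" using that unfolding F_def by auto
    have "(v, \<beta>) \<in> R \<and> (v, \<alpha>) \<notin> R" using indeg_reach v by simp
    then have "card (inarcs v \<inter> Y) = 1" using card_in[OF v(1) Y, of 1] Yf by simp
    then show ?thesis using sz[of "inarcs v"] full[OF v] v(2) finite_subset[OF inarcs_S finS] unfolding indeg_def by simp
  qed
  have znet: "(\<Sum>e\<in>{e\<in>S. t e = v}. z e) = (\<Sum>e\<in>{e\<in>S. h e = v}. z e)" for v
  proof -
    have "(\<Sum>e\<in>S. inc t h e v * z e) = 2 * (\<Sum>e\<in>S. inc t h e v * of_bool (e \<in> Y)) - (\<Sum>e\<in>S. inc t h e v)"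
      unfolding z_def by (simp add: algebra_simps sum_subtractf sum_distrib_left)
    also have "(\<Sum>e\<in>S. inc t h e v * of_bool (e \<in> Y)) = (\<Sum>e\<in>Y. inc t h e v)"
      using net_of_bool[OF finS Y, of t h v] unfolding net_def .
    finally have "(\<Sum>e\<in>S. inc t h e v * z e) = 0" unfolding Yf flow by simp
    moreover have "(\<Sum>e\<in>S. inc t h e v * z e) = (\<Sum>e\<in>{e\<in>S. t e = v}. z e) - (\<Sum>e\<in>{e\<in>S. h e = v}. z e)"
    proof -
      have "(\<Sum>e\<in>S. inc t h e v * z e) =
        (\<Sum>e\<in>S. (if t e = v then z e else 0) - (if h e = v then z e else 0))"
        by (rule sum.cong) (auto simp: inc_def)
      then show ?thesis using finS by (simp add: sum_subtractf sum.inter_filter)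
    qed
    ultimately show ?thesis by simp
  qed
  have key: "(\<Sum>e\<in>{e\<in>S. c e = k}. inc t h e v * z e) = 0 \<and> card {e\<in>S. c e = k \<and> (t e = v \<or> h e = v)} \<le> 2"
    if v: "v \<in> V" for k v
  proof -
    let ?I = "{e\<in>S. h e = v}" and ?O = "{e\<in>S. t e = v}"
    have cO: "c e = even (N v)" if "e \<in> ?O" for e using that unfolding c_def by auto
    have split: "(\<Sum>e\<in>{e\<in>S. c e = k}. inc t h e v * z e) =
        (\<Sum>e\<in>{e\<in>?O. c e = k}. z e) - (\<Sum>e\<in>{e\<in>?I. c e = k}. z e)"
    proof -
      have "(\<Sum>e\<in>{e\<in>S. c e = k}. inc t h e v * z e) =
        (\<Sum>e\<in>S. if c e = k then inc t h e v * z e else 0)"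
        using finS by (simp add: sum.inter_filter)
      also have "\<dots> = (\<Sum>e\<in>S. (if t e = v \<and> c e = k then z e else 0) - (if h e = v \<and> c e = k then z e else 0))"
        by (rule sum.cong) (auto simp: inc_def)
      also have "\<dots> = (\<Sum>e\<in>{e\<in>?O. c e = k}. z e) - (\<Sum>e\<in>{e\<in>?I. c e = k}. z e)"
        using finS by (simp add: sum_subtractf sum.inter_filter[symmetric] conj_ac)
      finally show ?thesis .
    qed
    have sub: "{e\<in>S. c e = k \<and> (t e = v \<or> h e = v)} = {e\<in>?O. c e = k} \<union> {e\<in>?I. c e = k}" by auto
    show ?thesis
    proof (cases "v \<in> F")
      case True
      then have v2: "indeg v = 2" "v \<noteq> \<beta>" "v \<noteq> \<alpha>" using indeg_\<alpha> unfolding F_def by auto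
      have cI: "c e = odd (N v)" if "e \<in> ?I" for e using cin_full[of e] that True by auto
      have o2: "outdeg v = 2" using deg_inner v2 by simp
      show ?thesis
      proof (cases "k = even (N v)")
        case True
        then have e: "{e\<in>?O. c e = k} = ?O" "{e\<in>?I. c e = k} = {}" using cO cI by auto
        have "card ?O = 2" using o2 unfolding outdeg_def .
        then show ?thesis unfolding split sub e using znet[of v] zin[OF \<open>v \<in> F\<close>] by simp
      next
        case False
        then have e: "{e\<in>?O. c e = k} = {}" "{e\<in>?I. c e = k} = ?I" using cO cI by auto
        have "card ?I = 2" using v2 unfolding indeg_def by simp
        then show ?thesis unfolding split sub e using zin[OF \<open>v \<in> F\<close>] by simp
      qed
    next
      case False
      have cI: "c e = even (N v)" if "e \<in> ?I" for e using cin[of e] that False by auto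
      have "card (?O \<union> ?I) \<le> 2"
      proof -
        have "card (?O \<union> ?I) \<le> outdeg v + indeg v" unfolding outdeg_def indeg_def by (rule card_Un_le)
        also have "\<dots> \<le> 2"
        proof (cases "v = \<alpha> \<or> v = \<beta>")
          case True
          then show ?thesis using indeg_\<alpha> outdeg_\<alpha> indeg_\<beta> outdeg_\<beta> by auto
        next
          case n: False
          then have "indeg v \<noteq> 2" using False v unfolding F_def by auto
          then show ?thesis using n deg_inner[of v] indeg_le[OF v] by auto
        qed
        finally show ?thesis .
      qed
      then show ?thesis
      proof (cases "k = even (N v)")
        case True
        then have e: "{e\<in>?O. c e = k} = ?O" "{e\<in>?I. c e = k} = ?I" using cO cI by auto
        show ?thesis unfolding split sub e using znet[of v] \<open>card (?O \<union> ?I) \<le> 2\<close> by simp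
      next
        case False
        then have e: "{e\<in>?O. c e = k} = {}" "{e\<in>?I. c e = k} = {}" using cO cI by auto
        show ?thesis unfolding split sub e by simp
      qed
    qed
  qed
  have "\<forall>a\<in>S. z a = 1 \<or> z a = - 1" unfolding z_def by auto
  then show ?thesis using key by blast
qed

section \<open>Connectedness through flows, and circuits encoded as flows\<close>

definition inside :: "('e \<Rightarrow> 'v) \<Rightarrow> ('e \<Rightarrow> 'v) \<Rightarrow> 'e set \<Rightarrow> 'v set \<Rightarrow> 'e set" where
  "inside t h E W = {e\<in>E. t e \<in> W \<and> h e \<in> W}"

definition between :: "('e \<Rightarrow> 'v) \<Rightarrow> ('e \<Rightarrow> 'v) \<Rightarrow> 'e set \<Rightarrow> 'v set \<Rightarrow> 'v set \<Rightarrow> 'e set" where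
  "between t h E A B = {e\<in>E. t e \<in> A \<and> h e \<in> B \<or> t e \<in> B \<and> h e \<in> A}"

definition star :: "('e \<Rightarrow> 'v) \<Rightarrow> ('e \<Rightarrow> 'v) \<Rightarrow> 'e set \<Rightarrow> 'v \<Rightarrow> 'e set" where
  "star t h E v = {e\<in>E. t e = v \<or> h e = v}"

text \<open>Connectedness of \<open>P\<close> through \<open>D\<close>, put as the existence of
  integer unit flows supported on \<open>D\<close>. This is the form needed for repairing net values
  on \<open>P\<close> by changing values on \<open>D\<close> only.\<close>

definition connects :: "('e \<Rightarrow> 'v) \<Rightarrow> ('e \<Rightarrow> 'v) \<Rightarrow> 'e set \<Rightarrow> 'e set \<Rightarrow> 'v set \<Rightarrow> bool" where
  "connects t h E D P \<longleftrightarrow> (\<forall>u\<in>P. \<forall>w\<in>P. \<exists>y. (\<forall>e. e \<notin> D \<longrightarrow> y e = 0) \<and>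
     (\<forall>x. net t h E y x = of_bool (x = u) - of_bool (x = w)))"

lemma connects_singleton: "connects t h E D {u}"
  unfolding connects_def net_def by (auto intro!: exI[of _ "\<lambda>_. 0"])

lemma connectsI:
  assumes "\<And>u. u \<in> P \<Longrightarrow> \<exists>y. (\<forall>e. e \<notin> D \<longrightarrow> y e = 0) \<and>
     (\<forall>x. net t h E y x = of_bool (x = u) - of_bool (x = \<beta>))"
  shows "connects t h E D P"
  unfolding connects_def
proof (intro ballI)
  fix u w assume "u \<in> P" "w \<in> P"
  then obtain y y' where "\<forall>e. e \<notin> D \<longrightarrow> y e = (0::int)" "\<forall>e. e \<notin> D \<longrightarrow> y' e = (0::int)"
    "\<And>x. net t h E y x = of_bool (x = u) - of_bool (x = \<beta>)"
    "\<And>x. net t h E y' x = of_bool (x = w) - of_bool (x = \<beta>)" using assms by metis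
  then show "\<exists>y. (\<forall>e. e \<notin> D \<longrightarrow> y e = 0) \<and> (\<forall>x. net t h E y x = of_bool (x = u) - of_bool (x = w))"
    by (intro exI[of _ "\<lambda>e. y e - y' e"]) (simp add: net_diff)
qed

text \<open>Each vertex \<open>u\<close> of \<open>P\<close> sends its demand \<open>d u\<close> to
  a root \<open>b\<close>. The root is then off by the sum of all demands, a multiple of
  \<open>K\<close>.\<close>

lemma connects_flow:
  assumes "connects t h E D P" "finite P" "K dvd (\<Sum>v\<in>P. d v)"
  shows "\<exists>y. (\<forall>e. e \<notin> D \<longrightarrow> y e = 0) \<and> (\<forall>x\<in>P. K dvd net t h E y x - d x) \<and> (\<forall>x. x \<notin> P \<longrightarrow> net t h E y x = 0)"
proof (cases "P = {}")
  case True
  then show ?thesis by (intro exI[of _ "\<lambda>_. 0"]) (simp add: net_def)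
next
  case False
  then obtain b where b: "b \<in> P" by blast
  have "\<forall>u\<in>P. \<exists>y. (\<forall>e. e \<notin> D \<longrightarrow> y e = (0::int)) \<and>
     (\<forall>x. net t h E y x = of_bool (x = u) - of_bool (x = b))"
    using assms(1) b unfolding connects_def by blast
  from bchoice[OF this] obtain y where y: "\<And>u. u \<in> P \<Longrightarrow> (\<forall>e. e \<notin> D \<longrightarrow> y u e = (0::int)) \<and>
     (\<forall>x. net t h E (y u) x = of_bool (x = u) - of_bool (x = b))" by blast
  let ?y = "\<lambda>e. \<Sum>u\<in>P. d u * y u e"
  have n: "net t h E ?y x = (if x \<in> P then d x else 0) - of_bool (x = b) * (\<Sum>u\<in>P. d u)" for x
  proof -
    have "net t h E ?y x = (\<Sum>u\<in>P. d u * (of_bool (x = u) - of_bool (x = b)))"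
      unfolding net_sum net_scale by (rule sum.cong) (use y in auto)
    also have "\<dots> = (\<Sum>u\<in>P. if x = u then d u else 0) - of_bool (x = b) * (\<Sum>u\<in>P. d u)"
    proof -
      have "(\<Sum>u\<in>P. d u * (of_bool (x = u) - of_bool (x = b))) =
        (\<Sum>u\<in>P. (if x = u then d u else 0) - of_bool (x = b) * d u)"
        by (rule sum.cong) auto
      then show ?thesis by (simp add: sum_subtractf sum_distrib_left)
    qed
    finally show ?thesis using assms(2) by (simp add: sum.delta)
  qed
  show ?thesis
    by (intro exI[of _ ?y]) (use y n b assms(3) in auto)
qed

text \<open>An undirected graph is treated as having every edge in both directions.\<close>

definition rt :: "('e \<Rightarrow> 'v) \<Rightarrow> ('e \<Rightarrow> 'v) \<Rightarrow> 'e \<times> bool \<Rightarrow> 'v" where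
  "rt t h a = (if snd a then t (fst a) else h (fst a))"

text \<open>\<open>rt t h\<close> and \<open>rt h t\<close> are tail and head of a directed copy.
  The copy with \<open>False\<close> runs against the edge, so its weight counts negatively.\<close>

definition toedge :: "('e \<times> bool) set \<Rightarrow> ('e \<times> bool \<Rightarrow> int) \<Rightarrow> 'e \<Rightarrow> int" where
  "toedge S w e = (if (e, True) \<in> S then w (e, True) else 0) - (if (e, False) \<in> S then w (e, False) else 0)"

lemma net_toedge:
  assumes "finite E" "S \<subseteq> E \<times> UNIV"
  shows "net t h E (toedge S w) v = (\<Sum>a\<in>S. inc (rt t h) (rt h t) a v * w a)"
proof -
  have "(\<Sum>a\<in>S. inc (rt t h) (rt h t) a v * w a) =
     (\<Sum>a\<in>E \<times> UNIV. if a \<in> S then inc (rt t h) (rt h t) a v * w a else 0)"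
    using assms by (simp add: sum.inter_restrict[symmetric] Int_absorb1)
  also have "\<dots> = (\<Sum>e\<in>E. \<Sum>d\<in>UNIV. if (e, d) \<in> S then inc (rt t h) (rt h t) (e, d) v * w (e, d) else 0)"
    by (simp add: sum.cartesian_product case_prod_unfold cong: if_cong)
  also have "\<dots> = (\<Sum>e\<in>E. inc t h e v * toedge S w e)"
    by (rule sum.cong) (auto simp: UNIV_bool toedge_def inc_def rt_def algebra_simps)
  finally show ?thesis unfolding net_def by simp
qed

lemma toedge_nonzero: "toedge S w e \<noteq> 0 \<Longrightarrow> e \<in> fst ` S"
  unfolding toedge_def by (force split: if_splits)

lemma region_flow:
  fixes t h :: "'e \<Rightarrow> 'v" and q :: nat
  assumes fin: "finite W" "finite E" and ab: "\<alpha> \<in> W" "\<beta> \<in> W" "\<alpha> \<noteq> \<beta>" and q: "q > 0"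
    and cut: "\<And>Z. Z \<subseteq> W \<Longrightarrow> \<alpha> \<in> Z \<Longrightarrow> \<beta> \<notin> Z \<Longrightarrow> q \<le> card (between t h E Z (W - Z))"
  shows "\<exists>S \<subseteq> inside t h E W \<times> UNIV. acyclic_flow (rt t h) (rt h t) W S \<alpha> \<beta> q"
proof -
  let ?A = "inside t h E W \<times> (UNIV :: bool set)"
  have finA: "finite ?A" using fin unfolding inside_def by auto
  have ends: "rt t h a \<in> W \<and> rt h t a \<in> W" if "a \<in> ?A" for a
    using that unfolding rt_def inside_def by auto
  have "\<exists>S\<subseteq>?A. (\<forall>v. (\<Sum>e\<in>S. inc (rt t h) (rt h t) e v) = int q * (of_bool (v = \<alpha>) - of_bool (v = \<beta>)))
       \<and> (\<forall>a\<in>S. (rt h t a, rt t h a) \<notin> (arcrel (rt t h) (rt h t) S)\<^sup>*)"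
  proof (rule minflow[OF fin(1) finA ends ab])
    fix Z assume Z: "Z \<subseteq> W" "\<alpha> \<in> Z" "\<beta> \<notin> Z"
    let ?B = "between t h E Z (W - Z)" and ?C = "{a \<in> ?A. rt t h a \<in> Z \<and> rt h t a \<notin> Z}"
    \<comment> \<open>An edge between \<open>Z\<close> and \<open>W - Z\<close> is sent to that one
      of its two copies which leaves \<open>Z\<close>.\<close>
    have "card ?B \<le> card ?C"
    proof (rule card_inj_on_le[of "\<lambda>e. (e, t e \<in> Z)"])
      show "inj_on (\<lambda>e. (e, t e \<in> Z)) ?B" by (auto simp: inj_on_def)
      show "(\<lambda>e. (e, t e \<in> Z)) ` ?B \<subseteq> ?C"
        using Z by (auto simp: between_def inside_def rt_def)
      show "finite ?C" using finA by simp
    qed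
    then show "q \<le> card ?C" using cut[OF Z] by simp
  qed auto
  then obtain S where S: "S \<subseteq> ?A" "\<And>v. (\<Sum>e\<in>S. inc (rt t h) (rt h t) e v) = int q * (of_bool (v = \<alpha>) - of_bool (v = \<beta>))"
    "\<And>a. a \<in> S \<Longrightarrow> (rt h t a, rt t h a) \<notin> (arcrel (rt t h) (rt h t) S)\<^sup>*" by blast
  have "acyclic_flow (rt t h) (rt h t) W S \<alpha> \<beta> q"
    by unfold_locales (use fin S finite_subset[OF S(1) finA] ends ab q in auto)
  then show ?thesis using S(1) by blast
qed

text \<open>By acyclicity no edge is traversed in both directions and no loop is traversed, so arcs
  and edges correspond. From every vertex of \<open>P\<close> the flow leads on to \<beta>, which
  gives connectedness.\<close>

lemma acyclic_flow_edges:
  fixes t h :: "'e \<Rightarrow> 'v"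
  assumes af: "acyclic_flow (rt t h) (rt h t) W S \<alpha> \<beta> q" and fin: "finite E" and SE: "S \<subseteq> E \<times> UNIV"
  defines "D \<equiv> fst ` S" and "P \<equiv> {v\<in>W. \<exists>e\<in>fst ` S. t e = v \<or> h e = v}"
  shows "inj_on fst S" "\<And>e. e \<in> D \<Longrightarrow> e \<in> E \<and> t e \<noteq> h e \<and> t e \<in> P \<and> h e \<in> P"
    "\<alpha> \<in> P" "\<beta> \<in> P" "connects t h E D P"
proof -
  interpret acyclic_flow "rt t h" "rt h t" W S \<alpha> \<beta> q by (rule af)
  have two: "\<not> ((e, True) \<in> S \<and> (e, False) \<in> S)" for e
  proof
    assume a: "(e, True) \<in> S \<and> (e, False) \<in> S"
    then have "(h e, t e) \<in> arcrel (rt t h) (rt h t) S"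
      using arcrelI[of "(e, False)" S "rt t h" "rt h t"] by (simp add: rt_def)
    then show False using acyc[of "(e, True)"] a by (auto simp: rt_def)
  qed
  show "inj_on fst S"
  proof (rule inj_onI)
    fix x y assume "x \<in> S" "y \<in> S" "fst x = fst y"
    then show "x = y" using two[of "fst x"] by (cases x; cases y; cases "snd x"; cases "snd y") auto
  qed
  show e: "e \<in> E \<and> t e \<noteq> h e \<and> t e \<in> P \<and> h e \<in> P" if "e \<in> D" for e
  proof -
    from that obtain d where d: "(e, d) \<in> S" unfolding D_def by auto
    have "t e \<noteq> h e" using acyc[OF d] by (auto simp: rt_def split: if_splits)
    moreover have "t e \<in> W \<and> h e \<in> W" using ends[OF d] by (auto simp: rt_def split: if_splits)
    ultimately show ?thesis using d SE that unfolding P_def D_def by auto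
  qed
  have touch: "v \<in> P" if "a \<in> S" "rt t h a = v \<or> rt h t a = v" for a v
  proof -
    have "fst a \<in> D" using that unfolding D_def by auto
    then show ?thesis using e[of "fst a"] that by (auto simp: rt_def split: if_splits)
  qed
  show "\<alpha> \<in> P"
  proof -
    have "card {e \<in> S. rt t h e = \<alpha>} > 0" using outdeg_\<alpha> q unfolding outdeg_def by simp
    then obtain a where "a \<in> S" "rt t h a = \<alpha>" by (auto simp: card_gt_0_iff)
    then show ?thesis using touch by auto
  qed
  show "\<beta> \<in> P"
  proof -
    have "card {e \<in> S. rt h t e = \<beta>} > 0" using indeg_\<beta> q unfolding indeg_def by simp
    then obtain a where "a \<in> S" "rt h t a = \<beta>" by (auto simp: card_gt_0_iff)
    then show ?thesis using touch by auto
  qed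
  show "connects t h E D P"
  proof (rule connectsI)
    fix u assume "u \<in> P"
    then obtain a where a: "a \<in> S" "t (fst a) = u \<or> h (fst a) = u" unfolding P_def by auto
    then have "rt t h a = u \<or> rt h t a = u" by (auto simp: rt_def)
    then have "(u, \<beta>) \<in> R" using touch_reach[OF a(1)] by auto
    from path_arcs[OF this] obtain p where p: "p \<subseteq> S" "finite p"
       "\<forall>x. (\<Sum>e\<in>p. inc (rt t h) (rt h t) e x) = of_bool (x = u) - of_bool (x = \<beta>)"
      by (elim exE conjE)
    have pE: "p \<subseteq> E \<times> UNIV" using p(1) SE by auto
    have "toedge p (\<lambda>_. 1) e = 0" if "e \<notin> D" for e
      using toedge_nonzero[of p "\<lambda>_. 1" e] that p(1) unfolding D_def by blast
    then show "\<exists>y. (\<forall>e. e \<notin> D \<longrightarrow> y e = 0) \<and> (\<forall>x. net t h E y x = of_bool (x = u) - of_bool (x = \<beta>))"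
      using net_toedge[OF fin pE, of t h "\<lambda>_. 1"] p(3) by (intro exI[of _ "toedge p (\<lambda>_. 1)"]) simp
  qed
qed

lemma toedge_values:
  assumes "inj_on fst S" "\<And>a. a \<in> S \<Longrightarrow> w a = 1 \<or> w a = (-1::int)" "S' \<subseteq> S"
  shows "toedge S' w e \<in> {-1, 0, 1}" "toedge S' w e \<noteq> 0 \<longleftrightarrow> e \<in> fst ` S'"
proof -
  have "\<not> ((e, True) \<in> S' \<and> (e, False) \<in> S')" using inj_onD[OF assms(1), of "(e, True)" "(e, False)"] assms(3) by auto
  moreover have "w (e, True) = 1 \<or> w (e, True) = -1" if "(e, True) \<in> S'" using assms that by blast
  moreover have "w (e, False) = 1 \<or> w (e, False) = -1" if "(e, False) \<in> S'" using assms that by blast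
  moreover have "e \<in> fst ` S' \<longleftrightarrow> (e, True) \<in> S' \<or> (e, False) \<in> S'"
  proof -
    have "e \<in> fst ` S' \<longleftrightarrow> (\<exists>d. (e, d) \<in> S')" by force
    then show ?thesis by (simp add: ex_bool_eq)
  qed
  ultimately show "toedge S' w e \<in> {-1, 0, 1}" "toedge S' w e \<noteq> 0 \<longleftrightarrow> e \<in> fst ` S'"
    unfolding toedge_def by auto
qed

lemma card_star_toedge:
  assumes "inj_on fst S" "S' \<subseteq> S" "finite S" "\<And>e. f e \<noteq> 0 \<longleftrightarrow> e \<in> fst ` S'" 
  shows "card {e\<in>star t h E v. f e \<noteq> (0::int)} \<le> card {a\<in>S'. rt t h a = v \<or> rt h t a = v}"
proof -
  have "{e\<in>star t h E v. f e \<noteq> 0} \<subseteq> fst ` {a\<in>S'. rt t h a = v \<or> rt h t a = v}"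
    unfolding assms(4) star_def by (force simp: rt_def)
  moreover have "finite {a\<in>S'. rt t h a = v \<or> rt h t a = v}" using finite_subset[OF assms(2,3)] by auto
  ultimately show ?thesis by (meson card_image_le card_mono finite_imageI order_trans)
qed

definition unit_valued :: "('e \<Rightarrow> int) \<Rightarrow> bool" where
  "unit_valued f \<longleftrightarrow> (\<forall>e. f e \<in> {-1, 0, 1})"

definition circ :: "(bool \<Rightarrow> 'e \<Rightarrow> int) \<Rightarrow> 'e \<Rightarrow> bool" where
  "circ f e \<longleftrightarrow> f True e \<noteq> 0 \<or> f False e \<noteq> 0"

text \<open>A family of vertex-disjoint circuits is encoded by a flow with values 0, 1, -1 that is
  nonzero on at most two edges at each vertex; conservation excludes exactly one. Two families are
  needed because consecutive circuits of a chain share a vertex, so they have to alternate.\<close>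

definition circuits :: "('e \<Rightarrow> 'v) \<Rightarrow> ('e \<Rightarrow> 'v) \<Rightarrow> 'e set \<Rightarrow> (bool \<Rightarrow> 'e \<Rightarrow> int) \<Rightarrow> bool" where
  "circuits t h E f \<longleftrightarrow>
     (\<forall>k. unit_valued (f k) \<and> (\<forall>v. net t h E (f k) v = 0) \<and> (\<forall>v. card {e\<in>star t h E v. f k e \<noteq> 0} \<le> 2) \<and>
        (\<forall>e. f k e \<noteq> 0 \<longrightarrow> e \<in> E \<and> t e \<noteq> h e)) \<and>
     (\<forall>e. f True e = 0 \<or> f False e = 0)"

lemma circuitsD:
  assumes "circuits t h E f"
  shows "unit_valued (f k)" "net t h E (f k) v = 0" "card {e\<in>star t h E v. f k e \<noteq> 0} \<le> 2"
    "f k e \<noteq> 0 \<Longrightarrow> e \<in> E \<and> t e \<noteq> h e" "f True e = 0 \<or> f False e = 0"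
  using assms unfolding circuits_def by simp_all

text \<open>The cut condition supplies two units of flow, and the two colour classes of
  \<open>chain_arcs\<close> become the two families.\<close>

lemma region_chain:
  fixes t h :: "'e \<Rightarrow> 'v"
  assumes fin: "finite W" "finite E" and ab: "\<alpha> \<in> W" "\<beta> \<in> W" "\<alpha> \<noteq> \<beta>"
    and cut: "\<And>Z. Z \<subseteq> W \<Longrightarrow> \<alpha> \<in> Z \<Longrightarrow> \<beta> \<notin> Z \<Longrightarrow> 2 \<le> card (between t h E Z (W - Z))"
  shows "\<exists>f P. P \<subseteq> W \<and> \<alpha> \<in> P \<and> \<beta> \<in> P \<and>
    circuits t h E f \<and> (\<forall>e. circ f e \<longrightarrow> e \<in> inside t h E P) \<and>
    (\<forall>v\<in>P. \<exists>e\<in>star t h E v. circ f e) \<and> connects t h E {e. circ f e} P"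
proof -
  have "\<exists>S \<subseteq> inside t h E W \<times> UNIV. acyclic_flow (rt t h) (rt h t) W S \<alpha> \<beta> 2"
    by (rule region_flow[OF fin ab]) (use cut in auto)
  then obtain S where S: "S \<subseteq> inside t h E W \<times> UNIV" and af: "acyclic_flow (rt t h) (rt h t) W S \<alpha> \<beta> 2"
    by blast
  interpret acyclic_flow "rt t h" "rt h t" W S \<alpha> \<beta> 2 by (rule af)
  have SE: "S \<subseteq> E \<times> UNIV" using S unfolding inside_def by auto
  from chain_arcs[OF af] obtain z c where z': "\<forall>a\<in>S. z a = 1 \<or> z a = (- 1 :: int)" and
     zc': "\<forall>k::bool. \<forall>v\<in>W. (\<Sum>e\<in>{e\<in>S. c e = k}. inc (rt t h) (rt h t) e v * z e) = 0
         \<and> card {e\<in>S. c e = k \<and> (rt t h e = v \<or> rt h t e = v)} \<le> 2"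
    by (elim exE conjE) (rule that)
  have z: "\<And>a. a \<in> S \<Longrightarrow> z a = 1 \<or> z a = - 1" using z' by simp
  have zc: "\<And>(k::bool) v. v \<in> W \<Longrightarrow> (\<Sum>e\<in>{e\<in>S. c e = k}. inc (rt t h) (rt h t) e v * z e) = 0
         \<and> card {e\<in>S. c e = k \<and> (rt t h e = v \<or> rt h t e = v)} \<le> 2" using zc' by simp
  note aE = acyclic_flow_edges[OF af fin(2) SE]
  define P where "P = {v\<in>W. \<exists>e\<in>fst ` S. t e = v \<or> h e = v}"
  define Sk where "Sk = (\<lambda>k. {e\<in>S. c e = k})"
  define f where "f = (\<lambda>k. toedge (Sk k) z)"
  have SkS: "Sk k \<subseteq> S" for k unfolding Sk_def by auto
  have tv: "f k e \<in> {-1, 0, 1}" "f k e \<noteq> 0 \<longleftrightarrow> e \<in> fst ` Sk k" for k e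
    unfolding f_def by (rule toedge_values[OF aE(1) z SkS]; assumption)+
  have disj: "f True e = 0 \<or> f False e = 0" for e
  proof (rule ccontr)
    assume "\<not> ?thesis"
    then have "e \<in> fst ` Sk True" "e \<in> fst ` Sk False" using tv(2)[of True e] tv(2)[of False e] by blast+
    then obtain a b where ab: "a \<in> S" "b \<in> S" "c a" "\<not> c b" "fst a = e" "fst b = e" unfolding Sk_def by auto
    then have "a = b" using inj_onD[OF aE(1)] by metis
    then show False using ab by simp
  qed
  have D: "{e. circ f e} = fst ` S"
    unfolding circ_def tv(2) by (auto simp: Sk_def)
  have fS: "e \<in> fst ` S" if "f k e \<noteq> 0" for k e using tv(2)[of k e] that SkS by blast
  have outW: "inc t h e v = 0" if "v \<notin> W" "f k e \<noteq> 0" for v e k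
  proof -
    show ?thesis using aE(2)[OF fS[OF that(2)]] that(1) by (auto simp: inc_def)
  qed
  have net0: "net t h E (f k) v = 0" for k v
  proof (cases "v \<in> W")
    case True
    have "Sk k \<subseteq> E \<times> UNIV" using SkS SE by blast
    from net_toedge[OF fin(2) this, of t h z v]
    have "net t h E (f k) v = (\<Sum>a\<in>Sk k. inc (rt t h) (rt h t) a v * z a)" unfolding f_def .
    also have "\<dots> = 0" using zc[OF True, of k] unfolding Sk_def by (rule conjunct1)
    finally show ?thesis .
  next
    case False
    then show ?thesis unfolding net_def by (intro sum.neutral) (use outW in auto)
  qed
  have crd: "card {e\<in>star t h E v. f k e \<noteq> 0} \<le> 2" for k v
  proof (cases "v \<in> W")
    case True
    have "card {e\<in>star t h E v. f k e \<noteq> 0} \<le> card {a\<in>Sk k. rt t h a = v \<or> rt h t a = v}"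
      by (rule card_star_toedge[OF aE(1) SkS finS tv(2)])
    also have "{a\<in>Sk k. rt t h a = v \<or> rt h t a = v} = {e\<in>S. c e = k \<and> (rt t h e = v \<or> rt h t e = v)}"
      unfolding Sk_def by auto
    finally show ?thesis using zc[OF True, of k] by simp
  next
    case False
    have "{e\<in>star t h E v. f k e \<noteq> 0} = {}"
    proof -
      have "v \<in> W" if "e \<in> star t h E v" "f k e \<noteq> 0" for e
        using aE(2)[OF fS[OF that(2)]] that(1) by (auto simp: star_def)
      then show ?thesis using False by auto
    qed
    then show ?thesis by (metis card.empty zero_le)
  qed
  show ?thesis
  proof (intro exI[of _ f] exI[of _ P] conjI allI impI ballI)
    show "P \<subseteq> W" unfolding P_def by auto
    show "\<alpha> \<in> P" "\<beta> \<in> P" using aE(3,4) unfolding P_def by auto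
    show "circuits t h E f"
      unfolding circuits_def unit_valued_def using tv(1) net0 crd disj aE(2)[OF fS] by blast
    show "e \<in> inside t h E P" if "circ f e" for e
      using that D aE(2)[of e] unfolding inside_def P_def by auto
    show "\<exists>e\<in>star t h E v. circ f e" if v: "v \<in> P" for v
    proof -
      from v obtain e where e: "e \<in> fst ` S" "t e = v \<or> h e = v" unfolding P_def by auto
      moreover have "e \<in> star t h E v" using e aE(2)[of e] unfolding star_def by auto
      ultimately show ?thesis using D by blast
    qed
    show "connects t h E {e. circ f e} P" using aE(5) unfolding D P_def .
  qed
qed

text \<open>Needed where a circuit runs through a 2-edge-cut and has to be closed on the far side.
  The bound 1 at \<alpha> and \<beta> leaves room there for the cut edge.\<close>

lemma region_path:
  fixes t h :: "'e \<Rightarrow> 'v"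
  assumes fin: "finite W" "finite E" and ab: "\<alpha> \<in> W" "\<beta> \<in> W" "\<alpha> \<noteq> \<beta>"
    and cut: "\<And>Z. Z \<subseteq> W \<Longrightarrow> \<alpha> \<in> Z \<Longrightarrow> \<beta> \<notin> Z \<Longrightarrow> 1 \<le> card (between t h E Z (W - Z))"
  shows "\<exists>f P. P \<subseteq> W \<and> \<alpha> \<in> P \<and> \<beta> \<in> P \<and> unit_valued f \<and>
    (\<forall>v. net t h E f v = of_bool (v = \<alpha>) - of_bool (v = \<beta>)) \<and>
    (\<forall>v. card {e\<in>star t h E v. f e \<noteq> 0} \<le> (if v = \<alpha> \<or> v = \<beta> then 1 else 2)) \<and>
    (\<forall>e. f e \<noteq> 0 \<longrightarrow> e \<in> inside t h E P \<and> t e \<noteq> h e) \<and>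
    (\<forall>v\<in>P. \<exists>e\<in>star t h E v. f e \<noteq> 0) \<and>
    connects t h E {e. f e \<noteq> 0} P"
proof -
  have "\<exists>S \<subseteq> inside t h E W \<times> UNIV. acyclic_flow (rt t h) (rt h t) W S \<alpha> \<beta> 1"
    by (rule region_flow[OF fin ab]) (use cut in auto)
  then obtain S where S: "S \<subseteq> inside t h E W \<times> UNIV" and af: "acyclic_flow (rt t h) (rt h t) W S \<alpha> \<beta> 1"
    by blast
  interpret acyclic_flow "rt t h" "rt h t" W S \<alpha> \<beta> 1 by (rule af)
  have SE: "S \<subseteq> E \<times> UNIV" using S unfolding inside_def by auto
  note aE = acyclic_flow_edges[OF af fin(2) SE]
  define P where "P = {v\<in>W. \<exists>e\<in>fst ` S. t e = v \<or> h e = v}"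
  define f where "f = toedge S (\<lambda>_. 1)"
  have tv: "f e \<in> {-1, 0, 1}" "f e \<noteq> 0 \<longleftrightarrow> e \<in> fst ` S" for e
    unfolding f_def by (rule toedge_values[OF aE(1) _ subset_refl]; simp)+
  have D: "{e. f e \<noteq> 0} = fst ` S" using tv(2) by auto
  have crd: "card {e\<in>star t h E v. f e \<noteq> 0} \<le> (if v = \<alpha> \<or> v = \<beta> then 1 else 2)" for v
  proof (cases "v \<in> W")
    case True
    have "card {e\<in>star t h E v. f e \<noteq> 0} \<le> card {a\<in>S. rt t h a = v \<or> rt h t a = v}"
      by (rule card_star_toedge[OF aE(1) subset_refl finS]) (use tv(2) in auto)
    also have "\<dots> = outdeg v + indeg v" by (rule card_touch[OF True])
    also have "\<dots> \<le> (if v = \<alpha> \<or> v = \<beta> then 1 else 2)"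
      using indeg_\<alpha> outdeg_\<alpha> indeg_\<beta> outdeg_\<beta> deg_inner[of v] indeg_le[OF True] by auto
    finally show ?thesis .
  next
    case False
    have "v \<in> W" if "e \<in> star t h E v" "f e \<noteq> 0" for e
    proof -
      have "e \<in> fst ` S" using D that by auto
      then show ?thesis using aE(2)[of e] that by (auto simp: star_def)
    qed
    then have "{e\<in>star t h E v. f e \<noteq> 0} = {}" using False by auto
    then show ?thesis by (metis card.empty zero_le)
  qed
  show ?thesis
  proof (intro exI[of _ f] exI[of _ P] conjI allI impI ballI)
    show "P \<subseteq> W" unfolding P_def by auto
    show "\<alpha> \<in> P" "\<beta> \<in> P" using aE(3,4) unfolding P_def by auto
    show "unit_valued f" unfolding unit_valued_def using tv(1) by auto
    show "net t h E f v = of_bool (v = \<alpha>) - of_bool (v = \<beta>)" for v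
      using net_toedge[OF fin(2) SE, of t h "\<lambda>_. 1"] flow[of v] unfolding f_def by simp
    show "card {e\<in>star t h E v. f e \<noteq> 0} \<le> (if v = \<alpha> \<or> v = \<beta> then 1 else 2)" for v by (rule crd)
    show "e \<in> inside t h E P" "t e \<noteq> h e" if "f e \<noteq> 0" for e
    proof -
      have "e \<in> fst ` S" using D that by auto
      then show "e \<in> inside t h E P" "t e \<noteq> h e" using aE(2)[of e] unfolding inside_def P_def by auto
    qed
    show "\<exists>e\<in>star t h E v. f e \<noteq> 0" if v: "v \<in> P" for v
    proof -
      from v obtain e where e: "e \<in> fst ` S" "t e = v \<or> h e = v" unfolding P_def by auto
      then have "f e \<noteq> 0" using D by auto
      moreover have "e \<in> star t h E v" using e aE(2)[of e] unfolding star_def by auto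
      ultimately show ?thesis by blast
    qed
    show "connects t h E {e. f e \<noteq> 0} P"
      using aE(5) unfolding D P_def .
  qed
qed

section \<open>Pieces with two edges to the region\<close>

lemma between_split:
  assumes "A \<inter> B = {}" "finite E" "A \<inter> C = {}" "B \<inter> C = {}"
  shows "card (between t h E C (A \<union> B)) = card (between t h E C A) + card (between t h E C B)"
proof -
  have "between t h E C (A \<union> B) = between t h E C A \<union> between t h E C B"
    unfolding between_def by auto
  moreover have "between t h E C A \<inter> between t h E C B = {}"
    using assms unfolding between_def by auto
  moreover have "finite (between t h E C A)" "finite (between t h E C B)"
    using assms(2) unfolding between_def by auto
  ultimately show ?thesis by (simp add: card_Un_disjoint)
qed

lemma between_commute: "between t h E A B = between t h E B A"
  unfolding between_def by auto

lemma between_empty [simp]: "between t h E {} B = {}" "between t h E B {} = {}"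
  unfolding between_def by auto

text \<open>Such a piece lies in a minimal set that at most one edge joins to the rest of \<open>Y - U\<close>; by minimality
  this set is 2-edge-connected. The vertex \<open>x\<close> is the one that is allowed to lie in cuts of size 2.\<close>

lemma piece_exists:
  fixes t h :: "'e \<Rightarrow> 'v"
  assumes fin: "finite Y" "finite E" and U: "U \<subseteq> Y" "U \<noteq> Y"
    and c2: "\<And>Z. Z \<subseteq> Y - U \<Longrightarrow> Z \<noteq> {} \<Longrightarrow> 2 \<le> card (between t h E Z (Y - Z))"
    and c3: "\<And>Z. Z \<subseteq> Y - U \<Longrightarrow> Z \<noteq> {} \<Longrightarrow> x \<notin> Z \<Longrightarrow> 3 \<le> card (between t h E Z (Y - Z))"
  shows "\<exists>f P. P \<subseteq> Y - U \<and> P \<noteq> {} \<and> 2 \<le> card (between t h E P U) \<and>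
    circuits t h E f \<and> (\<forall>e. circ f e \<longrightarrow> e \<in> inside t h E P) \<and>
    ((\<exists>u. P = {u}) \<or> (\<forall>v\<in>P. \<exists>e\<in>star t h E v. circ f e)) \<and>
    connects t h E {e. circ f e} P"
proof -
  define H where "H = Y - U"
  define dH where "dH = (\<lambda>W. card (between t h E W (H - W)))"
  \<comment> \<open>At most one edge to the rest of \<open>Y - U\<close>, and none if
    \<open>x\<close> lies in \<open>W\<close>: by \<open>c3\<close> and \<open>c2\<close> this
    leaves at least two edges to \<open>U\<close>.\<close>
  define good where "good = (\<lambda>W. W \<subseteq> H \<and> W \<noteq> {} \<and> (dH W = 0 \<or> (dH W = 1 \<and> x \<notin> W)))"
  have "good H" unfolding good_def dH_def H_def using U by auto
  then obtain W where W: "good W" and Wmin: "\<And>W'. good W' \<Longrightarrow> card W \<le> card W'"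
    using ex_has_least_nat[of good H card] by blast
  have WH: "W \<subseteq> H" "W \<noteq> {}" using W unfolding good_def by auto
  have finH: "finite H" unfolding H_def using fin by auto
  have finW: "finite W" using WH finH finite_subset by blast
  have dW: "card (between t h E W (Y - W)) = dH W + card (between t h E W U)" 
  proof -
    have "Y - W = (H - W) \<union> U" using WH U unfolding H_def by auto
    moreover have "(H - W) \<inter> U = {}" "W \<inter> U = {}" using WH unfolding H_def by auto
    ultimately show ?thesis unfolding dH_def
      using between_split[of "H - W" U E W t h] fin(2) by (metis Diff_disjoint inf_commute)
  qed
  have toU: "2 \<le> card (between t h E W U)"
  proof (cases "dH W = 0")
    case True
    then show ?thesis using c2[of W] dW WH unfolding H_def by simp
  next
    case False
    then show ?thesis using c3[of W] dW WH W unfolding good_def H_def by simp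
  qed
  have cutW: "2 \<le> card (between t h E Z (W - Z))" if Z: "Z \<subseteq> W" "Z \<noteq> {}" "W - Z \<noteq> {}" for Z
  proof (rule ccontr)
    assume "\<not> ?thesis"
    then have le1: "card (between t h E Z (W - Z)) \<le> 1" by simp
    have notgood: "\<not> good Z'" if "Z' \<subset> W" for Z'
      using Wmin[of Z'] psubset_card_mono[OF finW that] by linarith
    have a: "dH Z = card (between t h E Z (W - Z)) + card (between t h E Z (H - W))"
    proof -
      have "H - Z = (W - Z) \<union> (H - W)" using Z WH by auto
      then show ?thesis unfolding dH_def using between_split[of "W - Z" "H - W" E Z t h] fin(2) Z by auto
    qed
    have b: "dH (W - Z) = card (between t h E Z (W - Z)) + card (between t h E (W - Z) (H - W))"
    proof -
      have "H - (W - Z) = Z \<union> (H - W)" using Z WH by auto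
      then show ?thesis unfolding dH_def
        using between_split[of Z "H - W" E "W - Z" t h] fin(2) Z between_commute[of t h E Z "W - Z"] by auto
    qed
    have c: "dH W = card (between t h E Z (H - W)) + card (between t h E (W - Z) (H - W))"
    proof -
      have "card (between t h E (H - W) (Z \<union> (W - Z))) =
        card (between t h E (H - W) Z) + card (between t h E (H - W) (W - Z))"
        by (rule between_split) (use fin Z in auto)
      moreover have "Z \<union> (W - Z) = W" using Z by auto
      ultimately show ?thesis unfolding dH_def by (simp add: between_commute[of t h E "H - W"])
    qed
    \<comment> \<open>By the counts above, \<open>dH Z + dH (W - Z)\<close> is \<open>dH W\<close>
      plus twice the number of edges between \<open>Z\<close> and \<open>W - Z\<close>: at most 3,
      and at most 2 if \<open>x\<close> lies in \<open>W\<close>. As neither part is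
      \<open>good\<close>, the sum is at least 4, or at least 3 if one part contains
      \<open>x\<close>.\<close>
    have "\<not> good Z" "\<not> good (W - Z)" using notgood Z by auto
    then have n: "dH Z \<noteq> 0" "dH Z = 1 \<Longrightarrow> x \<in> Z" "dH (W - Z) \<noteq> 0" "dH (W - Z) = 1 \<Longrightarrow> x \<in> W - Z"
      using Z WH unfolding good_def by auto
    have "dH W = 0 \<or> dH W = 1 \<and> x \<notin> W" using W unfolding good_def by auto
    moreover have "\<not> (dH Z = 1 \<and> x \<notin> W)" "\<not> (dH (W - Z) = 1 \<and> x \<notin> W)" "\<not> (dH Z = 1 \<and> dH (W - Z) = 1)"
      using n Z by auto
    ultimately show False using a b c n(1,3) le1 by linarith
  qed
  have "\<exists>e1 e2. e1 \<in> between t h E W U \<and> e2 \<in> between t h E W U \<and> e1 \<noteq> e2"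
    using toU by (metis card_le_Suc0_iff_eq not_less_eq_eq numeral_2_eq_2 card.infinite zero_le)
  then obtain e1 e2 where e12: "e1 \<in> between t h E W U" "e2 \<in> between t h E W U" "e1 \<noteq> e2" by blast
  have WU: "W \<inter> U = {}" using WH unfolding H_def by auto
  have ex: "\<exists>\<alpha>\<in>W. e \<in> between t h E {\<alpha>} U" if "e \<in> between t h E W U" for e
    using that unfolding between_def by auto
  obtain \<alpha> \<beta> where ab: "\<alpha> \<in> W" "e1 \<in> between t h E {\<alpha>} U" "\<beta> \<in> W" "e2 \<in> between t h E {\<beta>} U"
    using ex e12 by blast
  have two: "2 \<le> card (between t h E P U)" if "\<alpha> \<in> P" "\<beta> \<in> P" for P
  proof -
    have "{e1, e2} \<subseteq> between t h E P U" using ab that unfolding between_def by auto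
    moreover have "finite (between t h E P U)" using fin unfolding between_def by auto
    ultimately have "card {e1, e2} \<le> card (between t h E P U)" by (rule card_mono[rotated])
    then show ?thesis using e12 by simp
  qed
  show ?thesis
  proof (cases "\<alpha> = \<beta>")
    case True
    have "circuits t h E (\<lambda>k e. 0)" by (auto simp: circuits_def unit_valued_def net_def)
    then show ?thesis using ab WH two[of "{\<alpha>}"] True connects_singleton[of t h E _ \<alpha>]
      by (intro exI[of _ "\<lambda>k e. 0"] exI[of _ "{\<alpha>}"]) (auto simp: H_def circ_def)
  next
    case False
    have "\<exists>f P. P \<subseteq> W \<and> \<alpha> \<in> P \<and> \<beta> \<in> P \<and>
    circuits t h E f \<and> (\<forall>e. circ f e \<longrightarrow> e \<in> inside t h E P) \<and>
    (\<forall>v\<in>P. \<exists>e\<in>star t h E v. circ f e) \<and>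
    connects t h E {e. circ f e} P"
      by (rule region_chain[OF finW fin(2) ab(1,3) False]) (use cutW ab in auto)
    then obtain f P where fP: "P \<subseteq> W" "\<alpha> \<in> P" "\<beta> \<in> P"
      "circuits t h E f" "\<forall>e. circ f e \<longrightarrow> e \<in> inside t h E P"
      "\<forall>v\<in>P. \<exists>e\<in>star t h E v. circ f e" "connects t h E {e. circ f e} P"
      by (elim exE conjE) (rule that; assumption)
    show ?thesis
    proof (intro exI[of _ f] exI[of _ P] conjI)
      show "P \<subseteq> Y - U" using fP(1) WH unfolding H_def by blast
      show "P \<noteq> {}" using fP(2) by blast
      show "2 \<le> card (between t h E P U)" by (rule two[OF fP(2,3)])
    qed (use fP(4-7) in simp_all)
  qed
qed

section \<open>Choosing flow values greedily\<close>

definition share :: "('e \<Rightarrow> 'v) \<Rightarrow> ('e \<Rightarrow> 'v) \<Rightarrow> 'e \<Rightarrow> 'e \<Rightarrow> bool" where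
  "share t h e g \<longleftrightarrow> {t e, h e} \<inter> {t g, h g} \<noteq> {}"

lemma share_commute: "share t h e g = share t h g e"
  unfolding share_def by auto

text \<open>The \<open>K\<close> values \<open>a + m * k\<close> with \<open>0 \<le> k < K\<close>
  are distinct modulo \<open>m * K\<close>, so each element of \<open>C\<close> rules out at most
  one of them.\<close>

lemma pick_value:
  fixes m K a :: int
  assumes "finite C" "int (card C) < K" "m \<noteq> 0"
  shows "\<exists>k. \<forall>c\<in>C. \<not> m * K dvd a + m * k - c"
proof (rule ccontr)
  assume "\<not> ?thesis"
  then have "\<forall>k. \<exists>c\<in>C. m * K dvd a + m * k - c" by blast
  then obtain g where g: "\<And>k. g k \<in> C \<and> m * K dvd a + m * k - g k" by metis
  have "inj_on g {0..<K}"
  proof (rule inj_onI)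
    fix k k' assume k: "k \<in> {0..<K}" "k' \<in> {0..<K}" "g k = g k'"
    have "m * K dvd (a + m * k - g k) - (a + m * k' - g k')" by (rule dvd_diff[OF conjunct2[OF g] conjunct2[OF g]])
    then have "m * K dvd m * (k - k')" using k(3) by (simp add: algebra_simps)
    then have "K dvd k - k'" using assms(3) by simp
    then show "k = k'" using k by (metis atLeastLessThan_iff mod_eq_dvd_iff mod_pos_pos_trivial)
  qed
  then have "card {0..<K} \<le> card C" using g assms(1) by (intro card_inj_on_le[of g]) auto
  then show False using assms(2) by simp
qed

text \<open>The condition \<open>2 c = s\<close> on an admissible value has at most one solution, since \<open>K\<close> is odd.\<close>

lemma double_target:
  fixes m K a s :: int
  assumes "odd K" "m \<noteq> 0"
  shows "\<exists>C. finite C \<and> card C \<le> 1 \<and>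
     (\<forall>k. (\<forall>c\<in>C. \<not> m * K dvd a + m * k - c) \<longrightarrow> \<not> m * K dvd 2 * (a + m * k) + s)"
proof (cases "\<exists>k. m * K dvd 2 * (a + m * k) + s")
  case True
  then obtain k0 where k0: "m * K dvd 2 * (a + m * k0) + s" by blast
  have "m * K dvd a + m * k - (a + m * k0)" if "m * K dvd 2 * (a + m * k) + s" for k
  proof -
    have "m * K dvd (2 * (a + m * k) + s) - (2 * (a + m * k0) + s)" using that k0 by (rule dvd_diff)
    then have "m * K dvd m * (2 * (k - k0))" by (simp add: algebra_simps)
    then have "K dvd 2 * (k - k0)" using assms(2) by simp
    moreover have "coprime K 2" using assms(1) by simp
    ultimately have "K dvd k - k0" using coprime_dvd_mult_right_iff by blast
    then have "m * K dvd m * (k - k0)" by simp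
    then show ?thesis by (simp add: algebra_simps)
  qed
  then show ?thesis by (intro exI[of _ "{a + m * k0}"]) auto
next
  case False
  then show ?thesis by (intro exI[of _ "{}"]) auto
qed

lemma card_signed: "finite T \<Longrightarrow> card (\<psi> ` T \<union> (\<lambda>g. - \<psi> g :: int) ` T) \<le> 2 * card T"
proof -
  assume "finite T"
  then have "card (\<psi> ` T) \<le> card T" "card ((\<lambda>g. - \<psi> g) ` T) \<le> card T" by (auto intro: card_image_le)
  then show ?thesis using card_Un_le[of "\<psi> ` T" "(\<lambda>g. - \<psi> g) ` T"] by linarith
qed

text \<open>The case without richness, with \<open>m = 2\<close> and \<open>K = 3\<close>, yields Seymour's 6-flow theorem. With richness,
  the last two edges of a piece have to avoid at most \<open>2 (4 \<Delta> - 8) + 1\<close> values together, and \<open>K\<close> is the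
  odd number \<open>8 \<Delta> - 13\<close>.\<close>

locale avoidance =
  fixes V :: "'v set" and E :: "'e set" and t h :: "'e \<Rightarrow> 'v"
    and rich :: bool and \<Delta> :: nat and m K :: int
  assumes finV: "finite V" and finE: "finite E"
    and ends: "\<And>e. e \<in> E \<Longrightarrow> t e \<in> V \<and> h e \<in> V"
    and m0: "m > 0"
    and rich: "rich \<Longrightarrow> \<Delta> \<ge> 3 \<and> K = 8 * int \<Delta> - 13 \<and> (\<forall>v\<in>V. card (star t h E v) \<le> \<Delta>) \<and> (\<forall>e\<in>E. t e \<noteq> h e)"
    and not_rich: "\<not> rich \<Longrightarrow> K = 3"
begin

abbreviation "N \<equiv> m * K"
abbreviation "Net \<equiv> net t h E"
abbreviation "Star \<equiv> star t h E"
abbreviation "Inside \<equiv> inside t h E"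
abbreviation "Between \<equiv> between t h E"

text \<open>A flow \<open>\<Phi>\<close> prescribes the residues modulo \<open>m\<close> of the flow modulo \<open>m K\<close> to be found; these alone must
  separate all adjacent pairs that involve an edge of a circuit. An element \<open>(v, S)\<close> of \<open>M\<close> is a pair
  \<open>S\<close> of edges at \<open>v\<close> whose sum must not vanish modulo \<open>m\<close>.\<close>

definition ok :: "(bool \<Rightarrow> 'e \<Rightarrow> int) \<Rightarrow> ('v \<times> 'e set) set \<Rightarrow> ('e \<Rightarrow> int) \<Rightarrow> bool" where
  "ok f M \<Phi> \<longleftrightarrow> (\<forall>v\<in>V. N dvd Net \<Phi> v) \<and> (\<forall>e\<in>E. rich \<or> circ f e \<longrightarrow> \<not> m dvd \<Phi> e) \<and>
     (rich \<longrightarrow> (\<forall>e\<in>E. \<forall>g\<in>E. e \<noteq> g \<and> share t h e g \<and> circ f e \<longrightarrow> \<not> m dvd \<Phi> e - \<Phi> g \<and> \<not> m dvd \<Phi> e + \<Phi> g) \<and>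
        (\<forall>(v, S)\<in>M. \<not> m dvd (\<Sum>e\<in>S. inc t h e v * \<Phi> e)))"

definition proper :: "('e \<Rightarrow> int) \<Rightarrow> 'e set \<Rightarrow> ('e \<Rightarrow> int) \<Rightarrow> bool" where
  "proper \<Phi> A \<psi> \<longleftrightarrow> (\<forall>e\<in>A. m dvd \<psi> e - \<Phi> e \<and> \<not> N dvd \<psi> e) \<and>
     (rich \<longrightarrow> (\<forall>e\<in>A. \<forall>g\<in>A. e \<noteq> g \<and> share t h e g \<longrightarrow> \<not> N dvd \<psi> e - \<psi> g \<and> \<not> N dvd \<psi> e + \<psi> g))"

text \<open>The edges inside \<open>U\<close> are those that have no value yet; \<open>\<psi>\<close> is meaningless on them.\<close>

definition partial_flow :: "('e \<Rightarrow> int) \<Rightarrow> 'v set \<Rightarrow> ('e \<Rightarrow> int) \<Rightarrow> bool" where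
  "partial_flow \<Phi> U \<psi> \<longleftrightarrow> proper \<Phi> (E - Inside U) \<psi> \<and> (\<forall>v\<in>V - U. N dvd Net \<psi> v)"

section \<open>Extending admissible values to further edges\<close>

lemma proper_cong: "proper \<Phi> A \<psi> \<Longrightarrow> (\<And>e. e \<in> A \<Longrightarrow> \<psi>' e = \<psi> e) \<Longrightarrow> proper \<Phi> A \<psi>'"
  unfolding proper_def by simp

lemma not_N: "\<not> m dvd a \<Longrightarrow> m dvd b - a \<Longrightarrow> \<not> N dvd b"
  by (metis dvd_mult_left dvd_diff diff_diff_eq2 add_diff_cancel_left')

lemma N_sep:
  assumes "\<not> m dvd a - b" "\<not> m dvd a + b" "m dvd a' - a" "m dvd b' - b"
  shows "\<not> N dvd a' - b'" "\<not> N dvd a' + b'"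
proof -
  have "m dvd (a' - b') - (a - b)" using dvd_diff[OF assms(3,4)] by (simp add: algebra_simps)
  then show "\<not> N dvd a' - b'" by (rule not_N[OF assms(1)])
  have "m dvd (a' + b') - (a + b)" using dvd_add[OF assms(3,4)] by (simp add: algebra_simps)
  then show "\<not> N dvd a' + b'" by (rule not_N[OF assms(2)])
qed

lemma ok_cls:
  "ok f M \<Phi> \<Longrightarrow> rich \<Longrightarrow> e \<in> E \<Longrightarrow> g \<in> E \<Longrightarrow> e \<noteq> g \<Longrightarrow> share t h e g \<Longrightarrow> circ f e \<Longrightarrow>
    \<not> m dvd \<Phi> e - \<Phi> g \<and> \<not> m dvd \<Phi> e + \<Phi> g"
  unfolding ok_def by simp

lemma share_cls:
  assumes "ok f M \<Phi>" "rich" "e \<in> E" "g \<in> E" "e \<noteq> g" "share t h e g" "circ f e \<or> circ f g"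
    "m dvd \<psi> e - \<Phi> e" "m dvd \<psi> g - \<Phi> g"
  shows "\<not> N dvd \<psi> e - \<psi> g" "\<not> N dvd \<psi> e + \<psi> g"
proof -
  have *: "\<not> m dvd \<Phi> e - \<Phi> g \<and> \<not> m dvd \<Phi> e + \<Phi> g"
  proof (cases "circ f e")
    case True
    then show ?thesis using ok_cls assms(1-6) by blast
  next
    case False
    then have "circ f g" "share t h g e" using assms share_commute[of t h] by auto
    then have "\<not> m dvd \<Phi> g - \<Phi> e \<and> \<not> m dvd \<Phi> g + \<Phi> e"
      using ok_cls[OF assms(1,2,4,3)] assms(5) by blast
    then show ?thesis by (metis add.commute dvd_minus_iff minus_diff_eq)
  qed
  show "\<not> N dvd \<psi> e - \<psi> g" "\<not> N dvd \<psi> e + \<psi> g" using N_sep[OF _ _ assms(8,9)] * by auto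
qed

text \<open>Circuit edges accept every value with the prescribed residue: \<open>ok\<close>
  separates them modulo \<open>m\<close> from 0 and, in the rich case, from all their neighbours.
  They are therefore free to absorb defects.\<close>

lemma proper_cls:
  assumes "ok f M \<Phi>" "proper \<Phi> A \<psi>" "A \<subseteq> E" "B \<subseteq> E" "\<And>e. e \<in> B \<Longrightarrow> circ f e \<and> m dvd \<psi>' e - \<Phi> e"
    "\<And>e. e \<in> A \<Longrightarrow> \<psi>' e = \<psi> e"
  shows "proper \<Phi> (A \<union> B) \<psi>'"
proof -
  have A: "proper \<Phi> A \<psi>'" by (rule proper_cong[OF assms(2,6)])
  have cong: "m dvd \<psi>' e - \<Phi> e" if "e \<in> A \<union> B" for e using A assms(5) that unfolding proper_def by blast
  have nz: "\<not> N dvd \<psi>' e" if "e \<in> A \<union> B" for e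
  proof (cases "e \<in> A")
    case True
    then show ?thesis using A unfolding proper_def by blast
  next
    case False
    then have "circ f e" "e \<in> E" using that assms(4,5) by auto
    then have "\<not> m dvd \<Phi> e" using assms(1) unfolding ok_def by blast
    then show ?thesis using cong[OF that] by (rule not_N)
  qed
  have sep: "\<not> N dvd \<psi>' e - \<psi>' g \<and> \<not> N dvd \<psi>' e + \<psi>' g"
    if "rich" "e \<in> A \<union> B" "g \<in> A \<union> B" "e \<noteq> g" "share t h e g" for e g
  proof (cases "e \<in> A \<and> g \<in> A")
    case True
    then show ?thesis using A that unfolding proper_def by blast
  next
    case False
    then have "circ f e \<or> circ f g" using that assms(5) by blast
    moreover have "e \<in> E" "g \<in> E" using that assms(3,4) by auto
    ultimately show ?thesis using share_cls[OF assms(1) that(1) _ _ that(4,5)] cong that by blast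
  qed
  show ?thesis unfolding proper_def using cong nz sep by blast
qed

lemma share_star: "g \<in> E \<Longrightarrow> share t h e g \<Longrightarrow> g \<in> Star (t e) \<union> Star (h e)"
  unfolding share_def star_def by auto

lemma fin_star: "finite (Star v)" unfolding star_def using finE by auto

lemma proper_free1:
  assumes "ok f M \<Phi>" "proper \<Phi> A \<psi>" "A \<subseteq> E" "e \<in> E" "e \<notin> A"
  shows "\<exists>x. proper \<Phi> (insert e A) (\<psi>(e := x))"
proof -
  define T where "T = {g\<in>A. rich \<and> share t h e g}"
  have finA: "finite A" using assms(3) finE finite_subset by blast
  have finT: "finite T" unfolding T_def using finA by auto
  \<comment> \<open>Absolute values have to differ, so each neighbour forbids two values. In the
    rich case 0 is excluded by the residue of \<open>\<Phi> e\<close>; otherwise it is the only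
    value to avoid.\<close>
  define C where "C = (if rich then \<psi> ` T \<union> (\<lambda>g. - \<psi> g) ` T else {0})"
  have "int (card C) < K"
  proof (cases rich)
    case True
    have "T \<subseteq> (Star (t e) - {e}) \<union> (Star (h e) - {e})"
      unfolding T_def using share_star[of _ e] assms(3,5) by blast
    then have "card T \<le> card ((Star (t e) - {e}) \<union> (Star (h e) - {e}))"
      by (rule card_mono[rotated]) (use fin_star in auto)
    also have "\<dots> \<le> card (Star (t e) - {e}) + card (Star (h e) - {e})" by (rule card_Un_le)
    also have "\<dots> \<le> (\<Delta> - 1) + (\<Delta> - 1)"
    proof -
      have "e \<in> Star (t e)" "e \<in> Star (h e)" using assms(4) unfolding star_def by auto
      moreover have "card (Star (t e)) \<le> \<Delta>" "card (Star (h e)) \<le> \<Delta>"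
        using rich[OF True] ends[OF assms(4)] by auto
      ultimately show ?thesis using fin_star by (simp add: add_mono diff_le_mono)
    qed
    finally have "card T \<le> 2 * \<Delta> - 2" by simp
    moreover have "card C \<le> 2 * card T" unfolding C_def using True card_signed[OF finT] by simp
    \<comment> \<open>\<open>4 * \<Delta> - 4 < 8 * \<Delta> - 13\<close> holds from
      \<open>\<Delta> = 3\<close> on.\<close>
    ultimately have "int (card C) \<le> 4 * int \<Delta> - 4" using rich[OF True] by linarith
    then show ?thesis using rich[OF True] by linarith
  next
    case False
    then show ?thesis unfolding C_def using not_rich by simp
  qed
  moreover have "finite C" unfolding C_def using finT by auto
  ultimately obtain k where k: "\<And>c. c \<in> C \<Longrightarrow> \<not> N dvd \<Phi> e + m * k - c"
    using pick_value[of C K m "\<Phi> e"] m0 by auto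
  define x where "x = \<Phi> e + m * k"
  have nz: "\<not> N dvd x"
  proof (cases rich)
    case True
    then have "\<not> m dvd \<Phi> e" using assms(1,4) unfolding ok_def by blast
    then show ?thesis by (rule not_N) (simp add: x_def)
  next
    case False
    then show ?thesis using k[of 0] unfolding C_def x_def by simp
  qed
  have sep: "\<not> N dvd x - \<psi> g" "\<not> N dvd x + \<psi> g" "\<not> N dvd \<psi> g - x" "\<not> N dvd \<psi> g + x"
    if "rich" "g \<in> A" "share t h e g" for g
  proof -
    have "\<psi> g \<in> C" "- \<psi> g \<in> C" using that unfolding C_def T_def by auto
    then show *: "\<not> N dvd x - \<psi> g" "\<not> N dvd x + \<psi> g" using k unfolding x_def by fastforce+
    show "\<not> N dvd \<psi> g - x" "\<not> N dvd \<psi> g + x" using * by (metis dvd_minus_iff minus_diff_eq, metis add.commute)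
  qed
  have "proper \<Phi> (insert e A) (\<psi>(e := x))"
    unfolding proper_def
  proof (intro conjI impI ballI)
    fix g assume "g \<in> insert e A"
    then show "m dvd (\<psi>(e := x)) g - \<Phi> g" "\<not> N dvd (\<psi>(e := x)) g"
      using assms(2) nz unfolding proper_def by (auto simp: x_def)
  next
    fix g g' assume r: "rich" and g: "g \<in> insert e A" "g' \<in> insert e A" and s: "g \<noteq> g' \<and> share t h g g'"
    consider "g = e" "g' \<in> A" "g' \<noteq> e" | "g' = e" "g \<in> A" "g \<noteq> e" | "g \<in> A" "g' \<in> A" "g \<noteq> e" "g' \<noteq> e" using g s assms(5) by auto
    then have "\<not> N dvd (\<psi>(e := x)) g - (\<psi>(e := x)) g' \<and> \<not> N dvd (\<psi>(e := x)) g + (\<psi>(e := x)) g'"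
    proof cases
      case 1
      then show ?thesis using sep(1,2)[OF r 1(2)] s by simp
    next
      case 2
      then show ?thesis using sep(3,4)[OF r 2(2)] s share_commute[of t h e g] by simp
    next
      case 3
      then show ?thesis using assms(2) r s unfolding proper_def by simp
    qed
    then show "\<not> N dvd (\<psi>(e := x)) g - (\<psi>(e := x)) g'" "\<not> N dvd (\<psi>(e := x)) g + (\<psi>(e := x)) g'" by auto
  qed
  then show ?thesis by blast
qed

lemma proper_free:
  assumes "ok f M \<Phi>" "proper \<Phi> A \<psi>" "A \<subseteq> E" "B \<subseteq> E" "A \<inter> B = {}"
  shows "\<exists>\<psi>'. proper \<Phi> (A \<union> B) \<psi>' \<and> (\<forall>e. e \<notin> B \<longrightarrow> \<psi>' e = \<psi> e)"
proof -
  have "finite B" using assms(4) finE finite_subset by blast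
  then show ?thesis using assms(4,5)
  proof (induction B)
    case empty
    then show ?case using assms(2) by auto
  next
    case (insert b B)
    then obtain \<psi>' where \<psi>': "proper \<Phi> (A \<union> B) \<psi>'" "\<forall>e. e \<notin> B \<longrightarrow> \<psi>' e = \<psi> e" by auto
    obtain x where "proper \<Phi> (insert b (A \<union> B)) (\<psi>'(b := x))"
      using proper_free1[OF assms(1) \<psi>'(1), of b] insert assms(3) by auto
    then show ?case using \<psi>'(2) by (intro exI[of _ "\<psi>'(b := x)"]) (rule conjI, simp only: Un_insert_right, auto)
  qed
qed

text \<open>Conservation across the piece makes \<open>y\<close> a function of \<open>x\<close>, so
  all restrictions are read as restrictions on \<open>x\<close>. The signed sum of the two values is
  forced to be \<open>- s\<close>; that it does not vanish is left to the residues, by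
  \<open>pair\<close>.\<close>

lemma proper_pair:
  assumes okf: "ok f M \<Phi>" and A: "proper \<Phi> A \<psi>" "A \<subseteq> E" and e: "e \<in> E" "e \<notin> A" and g: "g \<in> E" "g \<notin> A" and ne: "e \<noteq> g"
    and sg: "\<sigma> = 1 \<or> \<sigma> = -1" "\<tau> = 1 \<or> \<tau> = (-1::int)"
    and s: "m dvd s + \<sigma> * \<Phi> e + \<tau> * \<Phi> g"
    and bound: "rich \<Longrightarrow> card {a\<in>A. \<not> circ f a \<and> share t h e a} \<le> 2 * \<Delta> - 4"
      "rich \<Longrightarrow> card {a\<in>A. \<not> circ f a \<and> share t h g a} \<le> 2 * \<Delta> - 4"
    and pair: "rich \<Longrightarrow> share t h e g \<Longrightarrow> \<not> m dvd \<sigma> * \<Phi> e + \<tau> * \<Phi> g"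
  shows "\<exists>x y. proper \<Phi> (insert e (insert g A)) (\<psi>(e := x, g := y)) \<and> N dvd s + \<sigma> * x + \<tau> * y"
proof -
  define T where "T = (\<lambda>e. {a\<in>A. \<not> circ f a \<and> share t h e a})"
  have finA: "finite A" using A(2) finE finite_subset by blast
  have finT: "finite (T e)" for e unfolding T_def using finA by auto
  define Cf where "Cf = (\<lambda>e. if rich then \<psi> ` T e \<union> (\<lambda>a. - \<psi> a) ` T e else {0})"
  \<comment> \<open>For the \<open>y\<close> forced by \<open>x\<close>, the equation
    \<open>y = c\<close> is equivalent to \<open>x = tr c\<close>.\<close>
  define tr where "tr = (\<lambda>c. - (\<sigma> * \<tau> * c) - \<sigma> * s)"
  have KK: "odd K" using rich not_rich by (cases rich) auto
  obtain C2 where C2: "finite C2" "card C2 \<le> 1"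
    "\<And>k. (\<forall>c\<in>C2. \<not> m * K dvd \<Phi> e + m * k - c) \<Longrightarrow> \<not> m * K dvd 2 * (\<Phi> e + m * k) + \<sigma> * s"
    using double_target[OF KK, of m "\<Phi> e" "\<sigma> * s"] m0 by auto
  define C where "C = Cf e \<union> tr ` Cf g \<union> (if rich then C2 else {})"
  have finCf: "finite (Cf e)" for e unfolding Cf_def using finT by auto
  have finC: "finite C" unfolding C_def using finCf C2(1) by auto
  have "int (card C) < K"
  proof -
    have "card C \<le> card (Cf e) + card (tr ` Cf g) + card (if rich then C2 else {})"
      unfolding C_def using card_Un_le[of "Cf e \<union> tr ` Cf g" "if rich then C2 else {}"] card_Un_le[of "Cf e" "tr ` Cf g"] by linarith
    also have "card (tr ` Cf g) \<le> card (Cf g)" by (rule card_image_le[OF finCf])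
    finally have le: "card C \<le> card (Cf e) + card (Cf g) + card (if rich then C2 else {})" by simp
    show ?thesis
    proof (cases rich)
      case True
      have "card (Cf e) \<le> 2 * (2 * \<Delta> - 4)" "card (Cf g) \<le> 2 * (2 * \<Delta> - 4)"
        using card_signed[OF finT, of \<psi> e] card_signed[OF finT, of \<psi> g] bound[OF True] True unfolding Cf_def T_def by auto
      \<comment> \<open>Two signs for each of at most \<open>2 * \<Delta> - 4\<close> neighbours of
        either edge, and one value for \<open>2 * x + \<sigma> * s\<close>: at most
        \<open>8 * \<Delta> - 15\<close> values, fewer than \<open>K\<close>.\<close>
      then have "card C \<le> 2 * (2 * \<Delta> - 4) + 2 * (2 * \<Delta> - 4) + 1" using le C2(2) True by simp
      then show ?thesis using rich[OF True] by linarith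
    next
      case False
      then have "card C \<le> 2" using le unfolding Cf_def by simp
      then show ?thesis using not_rich[OF False] by simp
    qed
  qed
  then obtain k where k: "\<And>c. c \<in> C \<Longrightarrow> \<not> N dvd \<Phi> e + m * k - c"
    using pick_value[of C K m "\<Phi> e"] m0 finC by auto
  define x where "x = \<Phi> e + m * k"
  define y where "y = - \<tau> * (s + \<sigma> * x)"
  have \<sigma>2: "\<sigma> * \<sigma> = 1" "\<tau> * \<tau> = 1" using sg by auto
  have xc: "m dvd x - \<Phi> e" unfolding x_def by simp
  have sum0: "s + \<sigma> * x + \<tau> * y = 0" unfolding y_def using sg by (auto simp: algebra_simps)
  have yc: "m dvd y - \<Phi> g"
  proof -
    have eq: "\<tau> * (y - \<Phi> g) = - (s + \<sigma> * \<Phi> e + \<tau> * \<Phi> g) - \<sigma> * (x - \<Phi> e)"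
      using sum0 by (simp add: algebra_simps)
    have "m dvd - (s + \<sigma> * \<Phi> e + \<tau> * \<Phi> g)" using s by (simp only: dvd_minus_iff)
    moreover have "m dvd \<sigma> * (x - \<Phi> e)" using xc by (rule dvd_mult)
    ultimately have "m dvd \<tau> * (y - \<Phi> g)" unfolding eq by (rule dvd_diff)
    then show ?thesis using sg(2) by (auto simp: dvd_diff_commute)
  qed
  have avx: "\<not> N dvd x - c" if "c \<in> Cf e" for c using k[of c] that unfolding C_def x_def by simp
  have avy: "\<not> N dvd y - c" if "c \<in> Cf g" for c
  proof -
    have "tr c \<in> C" using that unfolding C_def by simp
    then have "\<not> N dvd x - tr c" using k unfolding x_def by simp
    moreover have "x - tr c = - \<sigma> * \<tau> * (y - c)"
      unfolding y_def tr_def using sg by (auto simp: algebra_simps)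
    ultimately show ?thesis by (metis dvd_mult)
  qed
  have nz: "\<not> N dvd z" if "e' \<in> E" "m dvd z - \<Phi> e'" "\<And>c. c \<in> Cf e' \<Longrightarrow> \<not> N dvd z - c" for z e'
  proof (cases rich)
    case True
    then have "\<not> m dvd \<Phi> e'" using okf that(1) unfolding ok_def by blast
    then show ?thesis using that(2) by (rule not_N)
  next
    case False
    then show ?thesis using that(3)[of 0] unfolding Cf_def by simp
  qed
  have sep: "\<not> N dvd z - \<psi> a \<and> \<not> N dvd z + \<psi> a"
    if "rich" "e' \<in> E" "e' \<notin> A" "m dvd z - \<Phi> e'" "\<And>c. c \<in> Cf e' \<Longrightarrow> \<not> N dvd z - c" "a \<in> A" "share t h e' a" for z e' a
  proof (cases "circ f a")
    case True
    have "m dvd \<psi> a - \<Phi> a" "a \<in> E" "e' \<noteq> a" using A that unfolding proper_def by auto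
    then show ?thesis using share_cls[OF okf that(1) that(2), of a "\<psi>(e' := z)"] that True by auto
  next
    case False
    then have "\<psi> a \<in> Cf e'" "- \<psi> a \<in> Cf e'" using that unfolding Cf_def T_def by auto
    then show ?thesis using that(5)[of "\<psi> a"] that(5)[of "- \<psi> a"] by simp
  qed
  \<comment> \<open>Up to sign and order, \<open>x + y\<close> and \<open>x - y\<close> are
    \<open>\<sigma> * x + \<tau> * y\<close> and \<open>\<sigma> * x - \<tau> * y\<close>. The
    former is nonzero by its residue; the latter is
    \<open>\<sigma> * (2 * x + \<sigma> * s)\<close>, which \<open>C2\<close> excludes from being
    0.\<close>
  have xy: "\<not> N dvd x - y \<and> \<not> N dvd x + y" if "rich" "share t h e g"
  proof -
    have "\<not> m dvd \<sigma> * \<Phi> e + \<tau> * \<Phi> g" by (rule pair[OF that])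
    moreover have "m dvd (\<sigma> * x + \<tau> * y) - (\<sigma> * \<Phi> e + \<tau> * \<Phi> g)"
    proof -
      have "m dvd \<sigma> * (x - \<Phi> e) + \<tau> * (y - \<Phi> g)" using xc yc by simp
      then show ?thesis by (simp add: algebra_simps)
    qed
    ultimately have 1: "\<not> N dvd \<sigma> * x + \<tau> * y" by (rule not_N)
    have "\<not> N dvd 2 * x + \<sigma> * s" using C2(3)[of k] k that(1) unfolding C_def x_def by auto
    moreover have "2 * x + \<sigma> * s = \<sigma> * (\<sigma> * x - \<tau> * y)"
      unfolding y_def using sg by (auto simp: algebra_simps)
    ultimately have 2: "\<not> N dvd \<sigma> * x - \<tau> * y" by auto
    have "N dvd - x - y \<longleftrightarrow> N dvd x + y" using dvd_minus_iff[of N "x + y"] by simp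
    moreover have "N dvd y - x \<longleftrightarrow> N dvd x - y" by (rule dvd_diff_commute)
    ultimately show ?thesis using 1 2 sg by auto
  qed
  have "proper \<Phi> (insert e (insert g A)) (\<psi>(e := x, g := y))"
    unfolding proper_def
  proof (intro conjI impI ballI)
    fix a assume a: "a \<in> insert e (insert g A)"
    show "m dvd (\<psi>(e := x, g := y)) a - \<Phi> a" using a A(1) xc yc ne unfolding proper_def by auto
    show "\<not> N dvd (\<psi>(e := x, g := y)) a"
      using a A(1) nz[OF e(1) xc avx] nz[OF g(1) yc avy] ne unfolding proper_def by auto
  next
    fix a b assume r: "rich" and ab: "a \<in> insert e (insert g A)" "b \<in> insert e (insert g A)" and s: "a \<noteq> b \<and> share t h a b"
    define w where "w = \<psi>(e := x, g := y)"
    have we: "w e = x" "w g = y" unfolding w_def using ne by auto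
    have wA: "w a = \<psi> a" if "a \<in> A" for a unfolding w_def using that e g by auto
    have sx: "\<not> N dvd x - \<psi> a \<and> \<not> N dvd x + \<psi> a" if "a \<in> A" "share t h e a" for a
      by (rule sep[OF r e xc avx that])
    have sy: "\<not> N dvd y - \<psi> a \<and> \<not> N dvd y + \<psi> a" if "a \<in> A" "share t h g a" for a
      by (rule sep[OF r g yc avy that])
    have main: "\<not> N dvd w a - w b \<and> \<not> N dvd w a + w b" if "a = e \<and> (b = g \<or> b \<in> A) \<or> a = g \<and> b \<in> A \<or> a \<in> A \<and> b \<in> A" "a \<noteq> b" "share t h a b" for a b
      using that(1)
    proof (elim disjE conjE)
      assume "a = e" "b = g" then show ?thesis using xy[OF r] that(3) we by simp
    next
      assume "a = e" "b \<in> A" then show ?thesis using sx[of b] that(3) we wA by simp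
    next
      assume "a = g" "b \<in> A" then show ?thesis using sy[of b] that(3) we wA by simp
    next
      assume "a \<in> A" "b \<in> A" then show ?thesis using A(1) r that(2,3) wA unfolding proper_def by simp
    qed
    have "\<not> N dvd w a - w b \<and> \<not> N dvd w a + w b"
    proof (cases "a = e \<and> (b = g \<or> b \<in> A) \<or> a = g \<and> b \<in> A \<or> a \<in> A \<and> b \<in> A")
      case True
      then show ?thesis using main s by blast
    next
      case False
      then have "\<not> N dvd w b - w a \<and> \<not> N dvd w b + w a"
        using ab s by (intro main) (auto simp: share_commute)
      then show ?thesis by (metis add.commute dvd_minus_iff minus_diff_eq)
    qed
    then show "\<not> N dvd (\<psi>(e := x, g := y)) a - (\<psi>(e := x, g := y)) b"
      "\<not> N dvd (\<psi>(e := x, g := y)) a + (\<psi>(e := x, g := y)) b" unfolding w_def by auto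
  qed
  then show ?thesis using sum0 by (intro exI[of _ x] exI[of _ y]) simp
qed

end

section \<open>Extending a flow across one piece\<close>

context avoidance
begin

text \<open>Edges of \<open>P\<close> off the circuits get arbitrary admissible values, circuit
  edges first their residues \<open>\<Phi>\<close>. All net values on \<open>P\<close> are then
  divisible by \<open>m\<close>, and the quotients are discharged modulo \<open>K\<close> by a flow
  along the circuits; taken \<open>m\<close> times, it does not change residues.\<close>

lemma fill:
  assumes okf: "ok f M \<Phi>" and UP: "U \<inter> P = {}" "U \<subseteq> V" "P \<subseteq> V"
    and conn: "connects t h E {e\<in>Inside P. circ f e} P"
    and A: "proper \<Phi> (E - Inside U - Inside P) \<psi>"
    and cons: "\<And>v. v \<in> V - (U \<union> P) \<Longrightarrow> N dvd Net \<psi> v"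
    and cut: "N dvd (\<Sum>e\<in>E. cross t h e P * \<psi> e)"
  shows "\<exists>\<psi>'. partial_flow \<Phi> U \<psi>'"
proof -
  define D where "D = {e\<in>Inside P. circ f e}"
  define B where "B = Inside P - D"
  define A0 where "A0 = E - Inside U - Inside P"
  have finP: "finite P" using UP(3) finV finite_subset by blast
  have dis: "Inside U \<inter> Inside P = {}" using UP(1) unfolding inside_def by auto
  have EU: "E - Inside U = (A0 \<union> B) \<union> D" using dis unfolding A0_def B_def D_def inside_def by auto
  have sub: "A0 \<subseteq> E" "B \<subseteq> E" "D \<subseteq> E" unfolding A0_def B_def D_def inside_def by auto
  have "A0 \<inter> B = {}" unfolding A0_def B_def by auto
  from proper_free[OF okf A[folded A0_def] sub(1,2) this]
  obtain \<psi>1 where \<psi>1: "proper \<Phi> (A0 \<union> B) \<psi>1" "\<And>e. e \<notin> B \<Longrightarrow> \<psi>1 e = \<psi> e" by blast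
  define \<psi>2 where "\<psi>2 = (\<lambda>e. if e \<in> D then \<Phi> e else \<psi>1 e)"
  have \<psi>2out: "\<psi>2 e = \<psi> e" if "e \<notin> Inside P" for e
    using that \<psi>1(2)[of e] unfolding \<psi>2_def B_def D_def by auto
  have net\<Phi>: "N dvd Net \<Phi> v" if "v \<in> V" for v using okf that unfolding ok_def by blast
  have mdiv: "m dvd Net \<psi>2 v" if v: "v \<in> P" for v
  proof -
    have "m dvd Net (\<lambda>e. \<psi>2 e - \<Phi> e) v"
      unfolding net_def
    proof (rule dvd_sum)
      fix e assume e: "e \<in> E"
      show "m dvd inc t h e v * (\<psi>2 e - \<Phi> e)"
      proof (cases "e \<in> Inside U")
        case True
        then have "inc t h e v = 0" using v UP(1) unfolding inside_def inc_def by auto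
        then show ?thesis by simp
      next
        case False
        then have "e \<in> (A0 \<union> B) \<union> D" using EU e by blast
        then have "m dvd \<psi>2 e - \<Phi> e" using \<psi>1(1) unfolding proper_def \<psi>2_def by auto
        then show ?thesis by simp
      qed
    qed
    moreover have "m dvd Net \<Phi> v" using net\<Phi>[of v] v UP(3) by (meson dvd_mult_left subsetD)
    ultimately show ?thesis unfolding net_diff by (metis diff_add_cancel dvd_add)
  qed
  define d where "d = (\<lambda>v. Net \<psi>2 v div m)"
  have d: "Net \<psi>2 v = m * d v" if "v \<in> P" for v using mdiv[OF that] unfolding d_def by simp
  \<comment> \<open>Edges inside \<open>P\<close> cancel in the sum, so the total defect depends
    only on the edges leaving \<open>P\<close>, which \<open>cut\<close> balances.\<close>
  have "(\<Sum>v\<in>P. Net \<psi>2 v) = (\<Sum>e\<in>E. cross t h e P * \<psi> e)"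
    unfolding sum_net[OF finP]
  proof (rule sum.cong)
    fix e assume "e \<in> E"
    then show "cross t h e P * \<psi>2 e = cross t h e P * \<psi> e"
      using \<psi>2out[of e] by (cases "e \<in> Inside P") (auto simp: inside_def cross_def)
  qed simp
  moreover have "(\<Sum>v\<in>P. Net \<psi>2 v) = m * (\<Sum>v\<in>P. d v)" using d by (simp add: sum_distrib_left)
  ultimately have "m * K dvd m * (\<Sum>v\<in>P. d v)" using cut by simp
  then have "K dvd (\<Sum>v\<in>P. - d v)" using m0 by (simp add: sum_negf)
  from connects_flow[OF conn[folded D_def] finP this]
  obtain y where y: "\<And>e. e \<notin> D \<Longrightarrow> y e = 0" "\<And>x. x \<in> P \<Longrightarrow> K dvd Net y x - (- d x)"
    "\<And>x. x \<notin> P \<Longrightarrow> Net y x = 0" by blast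
  define \<psi>3 where "\<psi>3 = (\<lambda>e. \<psi>2 e + m * y e)"
  have n3: "Net \<psi>3 v = Net \<psi>2 v + m * Net y v" for v unfolding \<psi>3_def net_add net_scale ..
  have "proper \<Phi> ((A0 \<union> B) \<union> D) \<psi>3"
  proof (rule proper_cls[OF okf \<psi>1(1)])
    show "A0 \<union> B \<subseteq> E" "D \<subseteq> E" using sub by auto
    show "circ f e \<and> m dvd \<psi>3 e - \<Phi> e" if "e \<in> D" for e
      using that unfolding \<psi>3_def \<psi>2_def D_def by auto
    show "\<psi>3 e = \<psi>1 e" if "e \<in> A0 \<union> B" for e
    proof -
      have "e \<notin> D" using that unfolding A0_def B_def D_def by auto
      then show ?thesis using y(1) unfolding \<psi>3_def \<psi>2_def by simp
    qed
  qed
  moreover have "N dvd Net \<psi>3 v" if v: "v \<in> V - U" for v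
  proof (cases "v \<in> P")
    case True
    have "m * K dvd m * (Net y v - (- d v))" using y(2)[OF True] by simp
    then show ?thesis unfolding n3 d[OF True] by (simp add: algebra_simps)
  next
    case False
    have "Net \<psi>2 v = Net \<psi> v" unfolding net_def
    proof (rule sum.cong)
      fix e assume "e \<in> E"
      show "inc t h e v * \<psi>2 e = inc t h e v * \<psi> e"
        using \<psi>2out[of e] False by (cases "e \<in> Inside P") (auto simp: inside_def inc_def)
    qed simp
    then show ?thesis unfolding n3 y(3)[OF False] using cons[of v] v False by auto
  qed
  ultimately have "partial_flow \<Phi> U \<psi>3" unfolding partial_flow_def EU by blast
  then show ?thesis by blast
qed

text \<open>The edges from \<open>P\<close> to \<open>U\<close> other than \<open>e\<close> and
  \<open>g\<close> are chosen freely, \<open>e\<close> and \<open>g\<close> together balance the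
  boundary of \<open>P\<close>, and \<open>fill\<close> treats the inside.\<close>

lemma step:
  assumes okf: "ok f M \<Phi>" and UP: "U \<inter> P = {}" "U \<subseteq> V" "P \<subseteq> V"
    and conn: "connects t h E {e\<in>Inside P. circ f e} P"
    and eg: "e \<in> Between P U" "g \<in> Between P U" "e \<noteq> g" "\<not> circ f e" "\<not> circ f g"
    and pairM: "rich \<Longrightarrow> share t h e g \<Longrightarrow> \<exists>v. (v, {e, g}) \<in> M \<and> e \<in> Star v \<and> g \<in> Star v"
    and cntP: "\<And>p. p \<in> P \<Longrightarrow> P = {p} \<or> (\<exists>a\<in>Star p. circ f a)"
    and cntU: "\<And>w. w \<in> U \<Longrightarrow> U = {w} \<or> Star w \<inter> Inside U \<noteq> {}"
    and pf: "partial_flow \<Phi> (U \<union> P) \<psi>"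
  shows "\<exists>\<psi>'. partial_flow \<Phi> U \<psi>'"
proof -
  define A1 where "A1 = E - Inside (U \<union> P)"
  define B where "B = Between P U - {e, g}"
  have finP: "finite P" using UP(3) finV finite_subset by blast
  have egE: "e \<in> E" "g \<in> E" using eg unfolding between_def by auto
  have sub: "A1 \<subseteq> E" "B \<subseteq> E" unfolding A1_def B_def between_def by auto
  have disj: "A1 \<inter> B = {}" unfolding A1_def B_def between_def inside_def by auto
  have part: "E - Inside U - Inside P = insert e (insert g (A1 \<union> B))"
    using eg UP(1) unfolding A1_def B_def between_def inside_def by auto
  have pA1: "proper \<Phi> A1 \<psi>" using pf unfolding partial_flow_def A1_def by blast
  from proper_free[OF okf pA1 sub disj] obtain \<psi>1 where
    \<psi>1: "proper \<Phi> (A1 \<union> B) \<psi>1" "\<And>a. a \<notin> B \<Longrightarrow> \<psi>1 a = \<psi> a" by blast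
  have notin: "e \<notin> A1 \<union> B" "g \<notin> A1 \<union> B" using eg unfolding A1_def B_def between_def inside_def by auto
  define \<sigma> where "\<sigma> = cross t h e P"
  define \<tau> where "\<tau> = cross t h g P"
  have sg: "\<sigma> = 1 \<or> \<sigma> = -1" "\<tau> = 1 \<or> \<tau> = -1"
    using eg(1,2) UP(1) unfolding \<sigma>_def \<tau>_def cross_def between_def by auto
  define s where "s = (\<Sum>a\<in>E - {e, g}. cross t h a P * \<psi>1 a)"
  have split: "(\<Sum>a\<in>E. F a) = (\<Sum>a\<in>E - {e, g}. F a) + F e + F g" for F :: "'e \<Rightarrow> int"
  proof -
    have "(\<Sum>a\<in>E. F a) = (\<Sum>a\<in>E - {e, g}. F a) + (\<Sum>a\<in>{e, g}. F a)"
      by (rule sum.subset_diff) (use egE finE in auto)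
    then show ?thesis using eg(3) by simp
  qed
  have sm: "m dvd s + \<sigma> * \<Phi> e + \<tau> * \<Phi> g"
  proof -
    have "N dvd (\<Sum>v\<in>P. Net \<Phi> v)" by (rule dvd_sum) (use okf UP(3) in \<open>auto simp: ok_def\<close>)
    then have "m dvd (\<Sum>a\<in>E. cross t h a P * \<Phi> a)" unfolding sum_net[OF finP] by (rule dvd_mult_left)
    moreover have "m dvd (\<Sum>a\<in>E - {e, g}. cross t h a P * (\<psi>1 a - \<Phi> a))"
    proof (rule dvd_sum)
      fix a assume a: "a \<in> E - {e, g}"
      show "m dvd cross t h a P * (\<psi>1 a - \<Phi> a)"
      proof (cases "a \<in> A1 \<union> B")
        case True
        then show ?thesis using \<psi>1(1) unfolding proper_def by simp
      next
        case False
        then have "a \<in> Inside U \<or> a \<in> Inside P" using a part by blast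
        then have "cross t h a P = 0" using UP(1) unfolding cross_def inside_def by auto
        then show ?thesis by simp
      qed
    qed
    moreover have "s + \<sigma> * \<Phi> e + \<tau> * \<Phi> g = (\<Sum>a\<in>E. cross t h a P * \<Phi> a) + (\<Sum>a\<in>E - {e, g}. cross t h a P * (\<psi>1 a - \<Phi> a))"
      unfolding s_def \<sigma>_def \<tau>_def split[of "\<lambda>a. cross t h a P * \<Phi> a"] by (simp add: algebra_simps sum_subtractf)
    ultimately show ?thesis by simp
  qed
  \<comment> \<open>Of the at most \<Delta> edges at each end of \<open>x\<close>, two do not count:
    \<open>x\<close> itself and a further one. At the end in \<open>P\<close> this is
    \<open>z\<close> or a circuit edge; at the end in \<open>U\<close> it is \<open>z\<close> or an
    edge inside \<open>U\<close>, which has no value yet.\<close>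
  have bound: "card {a\<in>A1 \<union> B. \<not> circ f a \<and> share t h x a} \<le> 2 * \<Delta> - 4"
    if r: "rich" and x: "x \<in> Between P U" "z \<in> Between P U" "x \<noteq> z" "\<not> circ f x" "{x, z} = {e, g}" for x z
  proof -
    obtain p w where pw: "p \<in> P" "w \<in> U" "{t x, h x} = {p, w}" using x(1) unfolding between_def by auto
    have "p \<in> {t x, h x}" "w \<in> {t x, h x}" unfolding pw(3) by auto
    then have xE: "x \<in> E" "x \<in> Star p" "x \<in> Star w" using x(1) unfolding between_def star_def by auto
    let ?S = "{a\<in>A1 \<union> B. \<not> circ f a \<and> share t h x a}"
    have xz: "x \<notin> A1 \<union> B" "z \<notin> A1 \<union> B" using notin x(5) by auto
    obtain q where q: "q \<in> Star p" "q \<noteq> x" "q \<notin> ?S"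
    proof (cases "z \<in> Star p")
      case True
      then show ?thesis using that[of z] x(3) xz by blast
    next
      case False
      then have "P \<noteq> {p}" using x(2) unfolding between_def star_def by auto
      then obtain a where "a \<in> Star p" "circ f a" using cntP pw by blast
      then show ?thesis using that[of a] x(4) by blast
    qed
    obtain q' where q': "q' \<in> Star w" "q' \<noteq> x" "q' \<notin> ?S"
    proof (cases "z \<in> Star w")
      case True
      then show ?thesis using that[of z] x(3) xz by blast
    next
      case False
      then have "U \<noteq> {w}" using x(2) unfolding between_def star_def by auto
      then obtain a where a: "a \<in> Star w" "a \<in> Inside U" using cntU pw by blast
      then have "a \<notin> A1 \<union> B" "a \<noteq> x" using x(1) UP(1) unfolding A1_def B_def inside_def between_def by auto
      then show ?thesis using that[of a] a by blast
    qed
    have "?S \<subseteq> (Star p - {x, q}) \<union> (Star w - {x, q'})"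
    proof
      fix a assume a: "a \<in> ?S"
      then have "a \<in> Star (t x) \<union> Star (h x)" using share_star[of a x] sub by blast
      then have "a \<in> Star p \<union> Star w" using pw(3) by (auto simp: doubleton_eq_iff)
      then show "a \<in> (Star p - {x, q}) \<union> (Star w - {x, q'})" using a q q' xz by blast
    qed
    then have "card ?S \<le> card ((Star p - {x, q}) \<union> (Star w - {x, q'}))"
      by (rule card_mono[rotated]) (use fin_star in auto)
    also have "\<dots> \<le> card (Star p - {x, q}) + card (Star w - {x, q'})" by (rule card_Un_le)
    also have "\<dots> \<le> (\<Delta> - 2) + (\<Delta> - 2)"
    proof -
      have "card (Star p) \<le> \<Delta>" "card (Star w) \<le> \<Delta>" using rich[OF r] pw UP by auto
      moreover have "card (Star p - {x, q}) = card (Star p) - card {x, q}"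
        by (rule card_Diff_subset) (use xE q in auto)
      moreover have "card (Star w - {x, q'}) = card (Star w) - card {x, q'}"
        by (rule card_Diff_subset) (use xE q' in auto)
      moreover have "card {x, q} = 2" "card {x, q'} = 2" using q(2) q'(2) by auto
      ultimately show ?thesis by linarith
    qed
    finally show ?thesis by simp
  qed
  \<comment> \<open>At a common vertex in \<open>P\<close> the pair sum is
    \<open>\<sigma> * \<Phi> e + \<tau> * \<Phi> g\<close>, at one in \<open>U\<close> it is the
    negative of this.\<close>
  have pr: "\<not> m dvd \<sigma> * \<Phi> e + \<tau> * \<Phi> g" if "rich" "share t h e g"
  proof -
    from pairM[OF that] obtain v where v: "(v, {e, g}) \<in> M" "e \<in> Star v" "g \<in> Star v" by blast
    have "\<not> m dvd (\<Sum>a\<in>{e, g}. inc t h a v * \<Phi> a)" using okf that(1) v(1) unfolding ok_def by blast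
    then have n: "\<not> m dvd inc t h e v * \<Phi> e + inc t h g v * \<Phi> g" using eg(3) by simp
    show ?thesis
    proof (cases "v \<in> P")
      case True
      then have "inc t h e v = \<sigma>" "inc t h g v = \<tau>"
        using v eg(1,2) UP(1) unfolding \<sigma>_def \<tau>_def inc_def cross_def star_def between_def by auto
      then show ?thesis using n by simp
    next
      case False
      then have "inc t h e v = - \<sigma>" "inc t h g v = - \<tau>"
        using v eg(1,2) UP(1) unfolding \<sigma>_def \<tau>_def inc_def cross_def star_def between_def by auto
      then have "\<not> m dvd - (\<sigma> * \<Phi> e + \<tau> * \<Phi> g)" using n by simp
      then show ?thesis by (simp only: dvd_minus_iff) simp
    qed
  qed
  have "\<exists>x y. proper \<Phi> (insert e (insert g (A1 \<union> B))) (\<psi>1(e := x, g := y)) \<and> N dvd s + \<sigma> * x + \<tau> * y"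
  proof (rule proper_pair[OF okf \<psi>1(1) _ egE(1) notin(1) egE(2) notin(2) eg(3) sg sm])
    show "A1 \<union> B \<subseteq> E" using sub by auto
    show "card {a\<in>A1 \<union> B. \<not> circ f a \<and> share t h e a} \<le> 2 * \<Delta> - 4" if "rich"
      by (rule bound[OF that eg(1,2,3,4)]) simp
    show "card {a\<in>A1 \<union> B. \<not> circ f a \<and> share t h g a} \<le> 2 * \<Delta> - 4" if "rich"
      by (rule bound[OF that eg(2,1) eg(3)[symmetric] eg(5)]) auto
    show "\<not> m dvd \<sigma> * \<Phi> e + \<tau> * \<Phi> g" if "rich" "share t h e g" by (rule pr[OF that])
  qed
  then obtain x y where xy: "proper \<Phi> (insert e (insert g (A1 \<union> B))) (\<psi>1(e := x, g := y))"
    "N dvd s + \<sigma> * x + \<tau> * y" by blast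
  define \<psi>2 where "\<psi>2 = \<psi>1(e := x, g := y)"
  show ?thesis
  proof (rule fill[OF okf UP conn])
    show "proper \<Phi> (E - Inside U - Inside P) \<psi>2" unfolding part \<psi>2_def by (rule xy(1))
    show "N dvd Net \<psi>2 v" if v: "v \<in> V - (U \<union> P)" for v
    proof -
      have "Net \<psi>2 v = Net \<psi> v" unfolding net_def
      proof (rule sum.cong)
        fix a assume "a \<in> E"
        show "inc t h a v * \<psi>2 a = inc t h a v * \<psi> a"
        proof (cases "a \<in> Between P U")
          case True
          then have "inc t h a v = 0" using v unfolding between_def inc_def by auto
          then show ?thesis by simp
        next
          case False
          then have "a \<noteq> e" "a \<noteq> g" "a \<notin> B" using eg unfolding B_def by auto
          then show ?thesis using \<psi>1(2) unfolding \<psi>2_def by simp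
        qed
      qed simp
      then show ?thesis using pf v unfolding partial_flow_def by auto
    qed
    have "(\<Sum>a\<in>E - {e, g}. cross t h a P * \<psi>2 a) = s"
      unfolding s_def \<psi>2_def by (rule sum.cong) auto
    moreover have "\<psi>2 e = x" "\<psi>2 g = y" unfolding \<psi>2_def using eg(3) by auto
    ultimately show "N dvd (\<Sum>a\<in>E. cross t h a P * \<psi>2 a)"
      unfolding split using xy(2) unfolding \<sigma>_def \<tau>_def by simp
  qed
qed

text \<open>Conservation on the last block of vertices is inherited from all the others.\<close>

lemma fill_last:
  assumes okf: "ok f M \<Phi>" and P: "P \<subseteq> V"
    and conn: "connects t h E {e\<in>Inside P. circ f e} P"
    and pf: "partial_flow \<Phi> P \<psi>"
  shows "\<exists>\<psi>'. partial_flow \<Phi> {} \<psi>'"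
proof (rule fill[OF okf _ _ P conn])
  have "Inside {} = {}" unfolding inside_def by auto
  then show "proper \<Phi> (E - Inside {} - Inside P) \<psi>" using pf unfolding partial_flow_def by simp
  show "N dvd Net \<psi> v" if "v \<in> V - ({} \<union> P)" for v using pf that unfolding partial_flow_def by auto
  have "(\<Sum>e\<in>E. cross t h e P * \<psi> e) = - (\<Sum>e\<in>E. cross t h e (V - P) * \<psi> e)"
    unfolding sum_negf[symmetric] by (rule sum.cong) (use ends in \<open>auto simp: cross_def\<close>)
  also have "\<dots> = - (\<Sum>v\<in>V - P. Net \<psi> v)" using sum_net[of "V - P" t h E \<psi>] finV by simp
  finally have eq: "(\<Sum>e\<in>E. cross t h e P * \<psi> e) = - (\<Sum>v\<in>V - P. Net \<psi> v)" .
  have "N dvd (\<Sum>v\<in>V - P. Net \<psi> v)" by (rule dvd_sum) (use pf in \<open>auto simp: partial_flow_def\<close>)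
  then show "N dvd (\<Sum>e\<in>E. cross t h e P * \<psi> e)" unfolding eq by (simp only: dvd_minus_iff)
qed auto

end

context avoidance
begin

section \<open>Reduction along small cuts\<close>

text \<open>The conditions on \<open>M\<close> allow its pairs to be split off simultaneously with
  those of consecutive circuit edges: at each vertex all these pairs are disjoint.\<close>

definition good :: "(bool \<Rightarrow> 'e \<Rightarrow> int) \<Rightarrow> ('v \<times> 'e set) set \<Rightarrow> bool" where
  "good f M \<longleftrightarrow>
     circuits t h E f \<and>
     (rich \<longrightarrow> (\<forall>(v, S)\<in>M. v \<in> V \<and> S \<subseteq> Star v \<and> card S = 2 \<and> (\<forall>e\<in>S. \<not> circ f e)) \<and>
        (\<forall>v S S'. (v, S) \<in> M \<and> (v, S') \<in> M \<and> S \<noteq> S' \<longrightarrow> S \<inter> S' = {}))"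

text \<open>Demanded for all \<open>\<Phi>\<close>, as the residues become known only after all
  circuits and pairs are fixed.\<close>

definition completes :: "(bool \<Rightarrow> 'e \<Rightarrow> int) \<Rightarrow> ('v \<times> 'e set) set \<Rightarrow> 'v set \<Rightarrow> bool" where
  "completes f M U \<longleftrightarrow> (\<forall>\<Phi>. ok f M \<Phi> \<and> (\<exists>\<psi>. partial_flow \<Phi> U \<psi>) \<longrightarrow> (\<exists>\<psi>. partial_flow \<Phi> {} \<psi>))"

text \<open>Invariant for growing \<open>U\<close> inside \<open>Y\<close>. The conditions on the
  support of \<open>f\<close> and on the location of pairs keep \<open>Y - U\<close> clear, so that
  later pieces bring disjoint circuits and pairs; the last condition provides the edge without a
  value at the lower end in \<open>step\<close>.\<close>

definition region_state :: "'v set \<Rightarrow> 'v set \<Rightarrow> (bool \<Rightarrow> 'e \<Rightarrow> int) \<Rightarrow> ('v \<times> 'e set) set \<Rightarrow> bool" where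
  "region_state Y U f M \<longleftrightarrow> U \<subseteq> Y \<and> U \<noteq> {} \<and> good f M \<and> completes f M U \<and>
     (\<forall>e. circ f e \<longrightarrow> {t e, h e} \<inter> (Y - U) = {}) \<and>
     (rich \<longrightarrow> (\<forall>(v, S)\<in>M. S \<subseteq> (E - Inside Y) \<union> Inside U)) \<and>
     (\<forall>w\<in>U. U = {w} \<or> Star w \<inter> Inside U \<noteq> {})"

text \<open>Residues that suit the final circuits and pairs suit every earlier stage, so the stages
  can be completed one after the other.\<close>

lemma ok_mono:
  assumes "ok f' M' \<Phi>" "\<And>e. circ f e \<Longrightarrow> circ f' e" "M \<subseteq> M'"
  shows "ok f M \<Phi>"
  unfolding ok_def
proof (intro conjI ballI impI)
  show "N dvd Net \<Phi> v" if "v \<in> V" for v using assms(1) that unfolding ok_def by simp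
  show "\<not> m dvd \<Phi> e" if "e \<in> E" "rich \<or> circ f e" for e using assms(1,2) that unfolding ok_def by blast
  show "\<not> m dvd \<Phi> e - \<Phi> g" "\<not> m dvd \<Phi> e + \<Phi> g"
    if "rich" "e \<in> E" "g \<in> E" "e \<noteq> g \<and> share t h e g \<and> circ f e" for e g
    using ok_cls[OF assms(1), of e g] assms(2) that by auto
  show "case x of (v, S) \<Rightarrow> \<not> m dvd (\<Sum>e\<in>S. inc t h e v * \<Phi> e)" if "rich" "x \<in> M" for x
    using assms(1,3) that unfolding ok_def by blast
qed

lemma okI:
  assumes "\<And>v. v \<in> V \<Longrightarrow> N dvd Net \<Phi> v" "\<And>e. e \<in> E \<Longrightarrow> rich \<or> circ f e \<Longrightarrow> \<not> m dvd \<Phi> e"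
    "\<And>e g. rich \<Longrightarrow> e \<in> E \<Longrightarrow> g \<in> E \<Longrightarrow> e \<noteq> g \<Longrightarrow> share t h e g \<Longrightarrow> circ f e \<Longrightarrow>
       \<not> m dvd \<Phi> e - \<Phi> g \<and> \<not> m dvd \<Phi> e + \<Phi> g"
    "\<And>v S. rich \<Longrightarrow> (v, S) \<in> M \<Longrightarrow> \<not> m dvd (\<Sum>e\<in>S. inc t h e v * \<Phi> e)"
  shows "ok f M \<Phi>"
  unfolding ok_def
proof (intro conjI ballI impI)
  fix y assume "rich" "y \<in> M"
  then show "case y of (v, S) \<Rightarrow> \<not> m dvd (\<Sum>e\<in>S. inc t h e v * \<Phi> e)"
    using assms(4)[of "fst y" "snd y"] by (simp add: case_prod_unfold)
qed (use assms(1-3) in blast)+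

lemma okD:
  assumes "ok f M \<Phi>"
  shows "v \<in> V \<Longrightarrow> N dvd Net \<Phi> v" "e \<in> E \<Longrightarrow> rich \<or> circ f e \<Longrightarrow> \<not> m dvd \<Phi> e"
    "rich \<Longrightarrow> (v, S) \<in> M \<Longrightarrow> \<not> m dvd (\<Sum>e\<in>S. inc t h e v * \<Phi> e)"
  using assms unfolding ok_def by blast+

lemma properI:
  assumes "\<And>e. e \<in> A \<Longrightarrow> m dvd \<psi> e - \<Phi> e \<and> \<not> N dvd \<psi> e"
    "\<And>e g. rich \<Longrightarrow> e \<in> A \<Longrightarrow> g \<in> A \<Longrightarrow> e \<noteq> g \<Longrightarrow> share t h e g \<Longrightarrow> \<not> N dvd \<psi> e - \<psi> g \<and> \<not> N dvd \<psi> e + \<psi> g"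
  shows "proper \<Phi> A \<psi>"
  unfolding proper_def using assms by simp

lemma properD:
  assumes "proper \<Phi> A \<psi>"
  shows "e \<in> A \<Longrightarrow> m dvd \<psi> e - \<Phi> e" "e \<in> A \<Longrightarrow> \<not> N dvd \<psi> e"
    "rich \<Longrightarrow> e \<in> A \<Longrightarrow> g \<in> A \<Longrightarrow> e \<noteq> g \<Longrightarrow> share t h e g \<Longrightarrow> \<not> N dvd \<psi> e - \<psi> g \<and> \<not> N dvd \<psi> e + \<psi> g"
  using assms unfolding proper_def by simp_all

lemma good_circuits: "good f M \<Longrightarrow> circuits t h E f"
  unfolding good_def by blast

lemmas goodD = circuitsD[OF good_circuits]

lemma good_pair:
  "good f M \<Longrightarrow> rich \<Longrightarrow> (v, S) \<in> M \<Longrightarrow> v \<in> V \<and> S \<subseteq> Star v \<and> card S = 2 \<and> (\<forall>e\<in>S. \<not> circ f e)"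
  unfolding good_def by (drule conjunct2) blast

lemma good_disjoint:
  "good f M \<Longrightarrow> rich \<Longrightarrow> (v, S) \<in> M \<Longrightarrow> (v, S') \<in> M \<Longrightarrow> S \<noteq> S' \<Longrightarrow> S \<inter> S' = {}"
  unfolding good_def by (drule conjunct2) blast

lemma goodI:
  assumes "circuits t h E f"
    "\<And>v S. rich \<Longrightarrow> (v, S) \<in> M \<Longrightarrow> v \<in> V \<and> S \<subseteq> Star v \<and> card S = 2 \<and> (\<forall>e\<in>S. \<not> circ f e)"
    "\<And>v S S'. rich \<Longrightarrow> (v, S) \<in> M \<Longrightarrow> (v, S') \<in> M \<Longrightarrow> S \<noteq> S' \<Longrightarrow> S \<inter> S' = {}"
  shows "good f M"
  unfolding good_def
proof (intro conjI allI impI ballI)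
  fix y assume "rich" "y \<in> M"
  then show "case y of (v, S) \<Rightarrow> v \<in> V \<and> S \<subseteq> Star v \<and> card S = 2 \<and> (\<forall>e\<in>S. \<not> circ f e)"
    using assms(2)[of "fst y" "snd y"] by (simp add: case_prod_unfold)
next
  fix v S S' assume "rich" "(v, S) \<in> M \<and> (v, S') \<in> M \<and> S \<noteq> S'"
  then show "S \<inter> S' = {}" using assms(3) by blast
qed (rule assms(1))

lemma region_stateI:
  assumes "U \<subseteq> Y" "U \<noteq> {}" "good f M" "completes f M U"
    "\<And>e. circ f e \<Longrightarrow> {t e, h e} \<inter> (Y - U) = {}"
    "\<And>v S. rich \<Longrightarrow> (v, S) \<in> M \<Longrightarrow> S \<subseteq> E - Inside Y"
    "\<And>w. w \<in> U \<Longrightarrow> U = {w} \<or> Star w \<inter> Inside U \<noteq> {}"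
  shows "region_state Y U f M"
  unfolding region_state_def
proof (intro conjI allI impI ballI)
  fix y assume "rich" "y \<in> M"
  then show "case y of (v, S) \<Rightarrow> S \<subseteq> (E - Inside Y) \<union> Inside U"
    using assms(6)[of "fst y" "snd y"] by (auto simp: case_prod_unfold)
qed (use assms(1-5,7) in blast)+

lemma extend_region1:
  assumes Y: "Y \<subseteq> V" and st: "region_state Y U f M" and ne: "U \<noteq> Y"
    and c2: "\<And>Z. Z \<subseteq> Y - U \<Longrightarrow> Z \<noteq> {} \<Longrightarrow> 2 \<le> card (Between Z (Y - Z))"
    and c3: "\<And>Z. Z \<subseteq> Y - U \<Longrightarrow> Z \<noteq> {} \<Longrightarrow> x \<notin> Z \<Longrightarrow> 3 \<le> card (Between Z (Y - Z))"
  shows "\<exists>U' f' M'. region_state Y U' f' M' \<and> U \<subset> U' \<and> (\<forall>e. circ f e \<longrightarrow> circ f' e) \<and> M \<subseteq> M'"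
proof -
  have UY: "U \<subseteq> Y" "U \<noteq> {}" and gd: "good f M" and comp: "completes f M U"
    and supp: "\<And>e. circ f e \<Longrightarrow> {t e, h e} \<inter> (Y - U) = {}"
    and Mloc: "\<And>v S. rich \<Longrightarrow> (v, S) \<in> M \<Longrightarrow> S \<subseteq> (E - Inside Y) \<union> Inside U"
    and touch: "\<And>w. w \<in> U \<Longrightarrow> U = {w} \<or> Star w \<inter> Inside U \<noteq> {}"
    using st unfolding region_state_def by blast+
  have finY: "finite Y" using Y finV finite_subset by blast
  have "\<exists>f P. P \<subseteq> Y - U \<and> P \<noteq> {} \<and> 2 \<le> card (Between P U) \<and>
    circuits t h E f \<and> (\<forall>e. circ f e \<longrightarrow> e \<in> Inside P) \<and>
    ((\<exists>u. P = {u}) \<or> (\<forall>v\<in>P. \<exists>e\<in>Star v. circ f e)) \<and> connects t h E {e. circ f e} P"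
    by (rule piece_exists[OF finY finE UY(1) ne c2 c3])
  then obtain f0 P where P: "P \<subseteq> Y - U" "P \<noteq> {}" and card2: "2 \<le> card (Between P U)" and
    f0: "circuits t h E f0" and f0in: "\<forall>e. circ f0 e \<longrightarrow> e \<in> Inside P"
    and f0P: "(\<exists>u. P = {u}) \<or> (\<forall>v\<in>P. \<exists>e\<in>Star v. circ f0 e)"
    and conn: "connects t h E {e. circ f0 e} P"
    by (elim exE conjE) (rule that; assumption)
  have UP: "U \<inter> P = {}" using P by auto
  have "\<exists>e g. e \<in> Between P U \<and> g \<in> Between P U \<and> e \<noteq> g"
    using card2 by (metis card_le_Suc0_iff_eq not_less_eq_eq numeral_2_eq_2 card.infinite zero_le)
  then obtain e g where eg: "e \<in> Between P U" "g \<in> Between P U" "e \<noteq> g" by blast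
  \<comment> \<open>At each edge one summand vanishes: \<open>f\<close> avoids all edges that meet
    \<open>Y - U\<close>, and \<open>f0\<close> lives inside \<open>P\<close>.\<close>
  define f' where "f' = (\<lambda>k a. f k a + f0 k a)"
  have clsf0: "a \<in> Inside P" if "circ f0 a" for a using f0in that by blast
  have notboth: "\<not> (circ f a \<and> circ f0 a)" for a
    using supp[of a] clsf0[of a] P unfolding inside_def by auto
  have f'f: "f' k a = f k a" if "\<not> circ f0 a" for k a
    using that unfolding f'_def circ_def by (cases k) auto
  have f'f0: "f' k a = f0 k a" if "\<not> circ f a" for k a
    using that unfolding f'_def circ_def by (cases k) auto
  have circ': "circ f' a \<longleftrightarrow> circ f a \<or> circ f0 a" for a
    using notboth[of a] f'f[of a] f'f0[of a] unfolding circ_def by metis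
  have egE: "e \<in> E" "g \<in> E" using eg unfolding between_def by auto
  have ncls: "\<not> circ f' a" if "a \<in> Between P U" for a
    using that supp[of a] clsf0[of a] P UP unfolding circ' between_def inside_def by auto
  \<comment> \<open>Only adjacent edges can collide, so only they are recorded as a pair. Parallel
    edges have two common vertices, hence the choice.\<close>
  define M0 where "M0 = (if share t h e g then {((SOME v. e \<in> Star v \<and> g \<in> Star v), {e, g})} else {})"
  define M' where "M' = M \<union> M0"
  have sharev: "\<exists>v. e \<in> Star v \<and> g \<in> Star v" if "share t h e g"
    using that egE unfolding share_def star_def by auto
  have M0: "e \<in> Star v \<and> g \<in> Star v \<and> S = {e, g}" if "(v, S) \<in> M0" for v S
    using that someI_ex[OF sharev] unfolding M0_def by (auto split: if_splits)
  have loc0: "a \<notin> (E - Inside Y) \<union> Inside U" if "a \<in> {e, g}" for a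
    using that eg P UP UY unfolding between_def inside_def by auto
  have good': "good f' M'"
  proof -
    have A: "unit_valued (f' k)" "Net (f' k) v = 0" "card {a\<in>Star v. f' k a \<noteq> 0} \<le> 2"
      "f' k a \<noteq> 0 \<Longrightarrow> a \<in> E \<and> t a \<noteq> h a" for k v a
    proof -
      have *: "f' k a = f k a \<or> f' k a = f0 k a" for a using f'f f'f0 notboth by blast
      show "unit_valued (f' k)" unfolding unit_valued_def
        using * goodD(1)[OF gd, of k] circuitsD(1)[OF f0, of k] unfolding unit_valued_def by metis
      show "Net (f' k) v = 0" unfolding f'_def net_add using goodD(2)[OF gd] circuitsD(2)[OF f0] by simp
      show "card {a\<in>Star v. f' k a \<noteq> 0} \<le> 2"
      proof (cases "v \<in> Y - U")
        case True
        have "f' k a = f0 k a" if "a \<in> Star v" for a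
          using that supp[of a] True by (intro f'f0) (auto simp: star_def)
        then have "{a\<in>Star v. f' k a \<noteq> 0} = {a\<in>Star v. f0 k a \<noteq> 0}" by auto
        then show ?thesis using circuitsD(3)[OF f0] by simp
      next
        case False
        have "f' k a = f k a" if "a \<in> Star v" for a
          using that clsf0[of a] False P by (intro f'f) (auto simp: star_def inside_def)
        then have "{a\<in>Star v. f' k a \<noteq> 0} = {a\<in>Star v. f k a \<noteq> 0}" by auto
        then show ?thesis using goodD(3)[OF gd] by simp
      qed
      show "a \<in> E \<and> t a \<noteq> h a" if "f' k a \<noteq> 0"
      proof -
        have "f k a \<noteq> 0 \<or> f0 k a \<noteq> 0" using that *[of a] by auto
        then show ?thesis using goodD(4)[OF gd, of k a] circuitsD(4)[OF f0, of k a] by blast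
      qed
    qed
    have B: "f' True a = 0 \<or> f' False a = 0" for a
    proof (cases "circ f0 a")
      case True
      then have "\<not> circ f a" using notboth by blast
      then show ?thesis using f'f0 circuitsD(5)[OF f0] by metis
    next
      case False
      then show ?thesis using f'f goodD(5)[OF gd] by metis
    qed
    have C: "v \<in> V \<and> S \<subseteq> Star v \<and> card S = 2 \<and> (\<forall>a\<in>S. \<not> circ f' a)" if r: "rich" and "(v, S) \<in> M'" for v S
    proof (cases "(v, S) \<in> M")
      case True
      have old: "v \<in> V \<and> S \<subseteq> Star v \<and> card S = 2 \<and> (\<forall>a\<in>S. \<not> circ f a)"
        by (rule good_pair[OF gd r True])
      have "\<not> circ f0 a" if "a \<in> S" for a
      proof
        assume "circ f0 a"
        then have "a \<in> Inside P" by (rule clsf0)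
        moreover have "a \<in> (E - Inside Y) \<union> Inside U" using Mloc[OF r True] that by blast
        ultimately show False using P UP unfolding inside_def by blast
      qed
      then show ?thesis using old circ' by blast
    next
      case False
      then have *: "e \<in> Star v \<and> g \<in> Star v \<and> S = {e, g}" using that M0 unfolding M'_def by blast
      moreover have "v \<in> V" using * ends unfolding star_def by auto
      ultimately show ?thesis using eg ncls by auto
    qed
    have D: "S \<inter> S' = {}" if r: "rich" and "(v, S) \<in> M'" "(v, S') \<in> M'" "S \<noteq> S'" for v S S'
    proof -
      have old0: "S \<inter> {e, g} = {}" if "(v, S) \<in> M" for v S using Mloc[OF r that] loc0 by blast
      consider "(v, S) \<in> M" "(v, S') \<in> M" | "(v, S) \<in> M" "(v, S') \<in> M0" | "(v, S) \<in> M0" "(v, S') \<in> M"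
        | "(v, S) \<in> M0" "(v, S') \<in> M0" using \<open>(v, S) \<in> M'\<close> \<open>(v, S') \<in> M'\<close> unfolding M'_def by blast
      then show ?thesis
      proof cases
        case 1 then show ?thesis by (rule good_disjoint[OF gd r _ _ \<open>S \<noteq> S'\<close>])
      next
        case 2 then show ?thesis using old0 M0 by blast
      next
        case 3 then show ?thesis using old0 M0 by blast
      next
        case 4 then show ?thesis using M0 \<open>S \<noteq> S'\<close> by blast
      qed
    qed
    have "circuits t h E f'" unfolding circuits_def using A B by blast
    then show ?thesis using C D by (rule goodI)
  qed
  have mono: "\<And>a. circ f a \<Longrightarrow> circ f' a" "M \<subseteq> M'" using circ' unfolding M'_def by auto
  have comp': "completes f' M' (U \<union> P)"
    unfolding completes_def
  proof (intro allI impI)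
    fix \<Phi> assume a: "ok f' M' \<Phi> \<and> (\<exists>\<psi>. partial_flow \<Phi> (U \<union> P) \<psi>)"
    then obtain \<psi> where \<psi>: "partial_flow \<Phi> (U \<union> P) \<psi>" by blast
    have eqD: "{a\<in>Inside P. circ f' a} = {e. circ f0 e}"
    proof -
      have "\<not> circ f a" if "a \<in> Inside P" for a using supp[of a] that P unfolding inside_def by auto
      then show ?thesis using circ' clsf0 unfolding circ_def by blast
    qed
    have "\<exists>\<psi>'. partial_flow \<Phi> U \<psi>'"
    proof (rule step[OF _ UP _ _ _ eg _ _ _ _ _ \<psi>])
      show "ok f' M' \<Phi>" using a by blast
      show "U \<subseteq> V" "P \<subseteq> V" using P UY Y by auto
      show "connects t h E {e \<in> Inside P. circ f' e} P" unfolding eqD by (rule conn)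
      show "\<not> circ f' e" "\<not> circ f' g" using ncls eg by auto
      show "\<exists>v. (v, {e, g}) \<in> M' \<and> e \<in> Star v \<and> g \<in> Star v" if "share t h e g"
      proof -
        have "((SOME v. e \<in> Star v \<and> g \<in> Star v), {e, g}) \<in> M0" using that unfolding M0_def by simp
        then show ?thesis using M0 unfolding M'_def by blast
      qed
      show "P = {p} \<or> (\<exists>a\<in>Star p. circ f' a)" if "p \<in> P" for p
        using f0P that circ' unfolding circ_def by blast
      show "U = {w} \<or> Star w \<inter> Inside U \<noteq> {}" if "w \<in> U" for w by (rule touch[OF that])
    qed
    moreover have "ok f M \<Phi>" using a mono by (blast intro: ok_mono)
    ultimately show "\<exists>\<psi>. partial_flow \<Phi> {} \<psi>" using comp unfolding completes_def by blast
  qed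
  have supp': "{t a, h a} \<inter> (Y - (U \<union> P)) = {}" if "circ f' a" for a
    using that supp[of a] clsf0[of a] unfolding circ' inside_def by auto
  have Mloc': "S \<subseteq> (E - Inside Y) \<union> Inside (U \<union> P)" if "rich" "(v, S) \<in> M'" for v S
  proof (cases "(v, S) \<in> M")
    case True
    have "Inside U \<subseteq> Inside (U \<union> P)" unfolding inside_def by auto
    then show ?thesis using Mloc[OF that(1) True] by blast
  next
    case False
    then have "S = {e, g}" using that M0 unfolding M'_def by blast
    then show ?thesis using eg unfolding between_def inside_def by auto
  qed
  have touch': "Star w \<inter> Inside (U \<union> P) \<noteq> {}" if w: "w \<in> U \<union> P" for w
  proof -
    have e: "e \<in> Inside (U \<union> P)" "e \<in> Star (t e)" "e \<in> Star (h e)"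
      using eg unfolding between_def inside_def star_def by auto
    consider "w \<in> U" "U = {w}" | "w \<in> U" "Star w \<inter> Inside U \<noteq> {}" | "w \<in> P" "P = {w}"
      | a where "w \<in> P" "a \<in> Star w" "circ f0 a"
      using w touch[of w] f0P by blast
    then show ?thesis
    proof cases
      case 1
      then have "w = t e \<or> w = h e" using eg unfolding between_def by auto
      then show ?thesis using e by auto
    next
      case 2
      moreover have "Inside U \<subseteq> Inside (U \<union> P)" unfolding inside_def by auto
      ultimately show ?thesis by blast
    next
      case 3
      then have "w = t e \<or> w = h e" using eg unfolding between_def by auto
      then show ?thesis using e by auto
    next
      case 4
      moreover have "Inside P \<subseteq> Inside (U \<union> P)" unfolding inside_def by auto
      ultimately show ?thesis using clsf0 by blast
    qed
  qed
  have "region_state Y (U \<union> P) f' M'"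
    unfolding region_state_def
  proof (intro conjI allI impI ballI)
    show "U \<union> P \<subseteq> Y" "U \<union> P \<noteq> {}" using UY P by auto
    show "case y of (v, S) \<Rightarrow> S \<subseteq> (E - Inside Y) \<union> Inside (U \<union> P)" if "rich" "y \<in> M'" for y
      using Mloc'[OF that(1), of "fst y" "snd y"] that(2) by (simp add: case_prod_unfold)
  qed (use good' comp' supp' touch' in blast)+
  moreover have "U \<subset> U \<union> P" using P UP by blast
  ultimately show ?thesis using mono by blast
qed

lemma extend_region:
  assumes Y: "Y \<subseteq> V" and st: "region_state Y U f M"
    and c2: "\<And>Z. Z \<subseteq> Y - U \<Longrightarrow> Z \<noteq> {} \<Longrightarrow> 2 \<le> card (Between Z (Y - Z))"
    and c3: "\<And>Z. Z \<subseteq> Y - U \<Longrightarrow> Z \<noteq> {} \<Longrightarrow> x \<notin> Z \<Longrightarrow> 3 \<le> card (Between Z (Y - Z))"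
  shows "\<exists>f' M'. region_state Y Y f' M' \<and> (\<forall>e. circ f e \<longrightarrow> circ f' e) \<and> M \<subseteq> M'"
  using st c2 c3
proof (induction "card (Y - U)" arbitrary: U f M rule: less_induct)
  case less
  show ?case
  proof (cases "U = Y")
    case True
    then show ?thesis using less.prems(1) by blast
  next
    case False
    have "\<exists>U' f' M'. region_state Y U' f' M' \<and> U \<subset> U' \<and> (\<forall>e. circ f e \<longrightarrow> circ f' e) \<and> M \<subseteq> M'"
      by (rule extend_region1[OF Y less.prems(1) False]) (rule less.prems; assumption)+
    then obtain U' f' M' where
      s: "region_state Y U' f' M'" "U \<subset> U'" "\<forall>e. circ f e \<longrightarrow> circ f' e" "M \<subseteq> M'"
      by (elim exE conjE) (rule that; assumption)
    have finY: "finite Y" using Y finV finite_subset by blast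
    have "U' \<subseteq> Y" using s(1) unfolding region_state_def by blast
    then have "card (Y - U') < card (Y - U)"
      using s(2) finY by (intro psubset_card_mono) auto
    moreover have "Y - U' \<subseteq> Y - U" using s(2) by auto
    ultimately have "\<exists>f'' M''. region_state Y Y f'' M'' \<and> (\<forall>e. circ f' e \<longrightarrow> circ f'' e) \<and> M' \<subseteq> M''"
      using less.prems(2,3) by (intro less.hyps[OF _ s(1)]) auto
    then show ?thesis using s(3,4) by blast
  qed
qed

lemma completes_start:
  assumes "P \<subseteq> V" "connects t h E {e\<in>Inside P. circ f e} P"
  shows "completes f M P"
  unfolding completes_def using fill_last[OF _ assms] by blast

end

section \<open>Edge cuts and the inductive statement\<close>

definition cut :: "('e \<Rightarrow> 'v) \<Rightarrow> ('e \<Rightarrow> 'v) \<Rightarrow> 'e set \<Rightarrow> 'v set \<Rightarrow> 'e set" where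
  "cut t h E Z = {e\<in>E. (t e \<in> Z) \<noteq> (h e \<in> Z)}"

lemma net_restrict:
  assumes "finite E" "E' \<subseteq> E" "\<And>e. e \<in> E - E' \<Longrightarrow> inc t h e v * x e = 0"
  shows "net t h E x v = net t h E' x v"
  unfolding net_def by (rule sum.mono_neutral_right) (use assms in auto)

context avoidance
begin

abbreviation "Cut \<equiv> cut t h E"

definition admissible :: bool where
  "admissible \<longleftrightarrow> (\<forall>X\<subseteq>V. card (Cut X) \<noteq> 1) \<and>
     (rich \<longrightarrow> (\<forall>X\<subseteq>V. \<forall>e g. e \<noteq> g \<and> Cut X = {e, g} \<longrightarrow> \<not> share t h e g))"

text \<open>The order of quantifiers matters: the 6-flow that yields the residues
  \<open>\<Phi>\<close> lives on the graph expanded at the pairs, so \<open>f\<close> and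
  \<open>M\<close> come first.\<close>

definition solvable :: bool where
  "solvable \<longleftrightarrow> (\<exists>f M. good f M \<and> (\<forall>\<Phi>. ok f M \<Phi> \<longrightarrow> (\<exists>\<psi>. partial_flow \<Phi> {} \<psi>)))"

text \<open>In passing from \<open>Cut Z\<close> to the edges between \<open>Z\<close> and
  \<open>Y - Z\<close> only edges of \<open>Cut Y\<close> are lost. All of these but
  \<open>b\<close> have an end in the starting region \<open>U\<close>, so a set disjoint from
  \<open>U\<close> loses at most \<open>b\<close>, and only if it contains the end \<open>x\<close>
  of \<open>b\<close>.\<close>

lemma solvable_by_region:
  assumes Y: "Y \<subseteq> V" and big: "\<And>Z. Z \<subset> Y \<Longrightarrow> Z \<noteq> {} \<Longrightarrow> 3 \<le> card (Cut Z)"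
    and b: "\<And>a. a \<in> Cut Y \<Longrightarrow> a \<noteq> b \<Longrightarrow> {t a, h a} \<inter> U \<noteq> {}"
    and x: "\<And>z. b \<in> Cut Y \<Longrightarrow> z \<in> {t b, h b} \<Longrightarrow> z \<in> Y \<Longrightarrow> z = x"
    and st: "region_state Y U f M"
    and red: "\<And>\<Phi>. ok f M \<Phi> \<Longrightarrow> \<exists>\<psi>. partial_flow \<Phi> Y \<psi>"
  shows solvable
proof -
  have UY: "U \<subseteq> Y" "U \<noteq> {}" using st unfolding region_state_def by auto
  have fin: "finite (Between A B)" for A B using finE unfolding between_def by auto
  have sub: "Cut Z \<subseteq> Between Z (Y - Z) \<union> {a\<in>Cut Y. a = b \<and> {t a, h a} \<inter> Z \<noteq> {}}" if Z: "Z \<subseteq> Y - U" for Z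
  proof
    fix a assume a: "a \<in> Cut Z"
    show "a \<in> Between Z (Y - Z) \<union> {a\<in>Cut Y. a = b \<and> {t a, h a} \<inter> Z \<noteq> {}}"
    proof (cases "a \<in> Cut Y")
      case True
      have "a = b"
      proof (rule ccontr)
        assume "a \<noteq> b"
        then have "{t a, h a} \<inter> U \<noteq> {}" using b True by blast
        then show False using a True Z UY unfolding cut_def by auto
      qed
      then show ?thesis using a True unfolding cut_def by auto
    next
      case False
      then show ?thesis using a Z unfolding cut_def between_def by auto
    qed
  qed
  have c3: "3 \<le> card (Between Z (Y - Z))" if Z: "Z \<subseteq> Y - U" "Z \<noteq> {}" "x \<notin> Z" for Z
  proof -
    have "{a\<in>Cut Y. a = b \<and> {t a, h a} \<inter> Z \<noteq> {}} = {}" using x Z by auto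
    then have "Cut Z \<subseteq> Between Z (Y - Z)" using sub[OF Z(1)] by blast
    then have "card (Cut Z) \<le> card (Between Z (Y - Z))" using fin by (rule card_mono[rotated])
    moreover have "Z \<subset> Y" using Z(1) UY by blast
    ultimately show ?thesis using big[of Z] Z(2) by linarith
  qed
  have c2: "2 \<le> card (Between Z (Y - Z))" if Z: "Z \<subseteq> Y - U" "Z \<noteq> {}" for Z
  proof -
    have "Cut Z \<subseteq> insert b (Between Z (Y - Z))" using sub[OF Z(1)] by blast
    then have "card (Cut Z) \<le> card (insert b (Between Z (Y - Z)))" using fin by (intro card_mono) auto
    also have "\<dots> \<le> Suc (card (Between Z (Y - Z)))" using fin by (simp add: card_insert_if)
    finally have "card (Cut Z) \<le> Suc (card (Between Z (Y - Z)))" .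
    moreover have "Z \<subset> Y" using Z(1) UY by blast
    ultimately show ?thesis using big[of Z] Z(2) by linarith
  qed
  have "\<exists>f' M'. region_state Y Y f' M' \<and> (\<forall>e. circ f e \<longrightarrow> circ f' e) \<and> M \<subseteq> M'"
    by (rule extend_region[OF Y st]) (rule c2 c3; assumption)+
  then obtain f' M' where f': "region_state Y Y f' M'" "\<forall>e. circ f e \<longrightarrow> circ f' e" "M \<subseteq> M'" by blast
  have "\<exists>\<psi>. partial_flow \<Phi> {} \<psi>" if o: "ok f' M' \<Phi>" for \<Phi>
  proof -
    have "ok f M \<Phi>" by (rule ok_mono[OF o]) (use f' in auto)
    then have "\<exists>\<psi>. partial_flow \<Phi> Y \<psi>" by (rule red)
    moreover have "completes f' M' Y" using f'(1) unfolding region_state_def by blast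
    ultimately show ?thesis using o unfolding completes_def by blast
  qed
  moreover have "good f' M'" using f'(1) unfolding region_state_def by blast
  ultimately show ?thesis unfolding solvable_def by blast
qed

text \<open>No edge leaves \<open>Y\<close>, so the rest of the graph is solved independently and
  any vertex of \<open>Y\<close> can start the region.\<close>

lemma solvable_component:
  assumes Y: "Y \<subseteq> V" "Y \<noteq> {}" and big: "\<And>Z. Z \<subset> Y \<Longrightarrow> Z \<noteq> {} \<Longrightarrow> 3 \<le> card (Cut Z)"
    and cutY: "Cut Y = {}"
    and H: "avoidance (V - Y) (Inside (V - Y)) t h rich \<Delta> m K"
    and sol: "avoidance.solvable (V - Y) (Inside (V - Y)) t h rich m K"
  shows solvable
proof -
  let ?X = "V - Y" and ?E = "Inside (V - Y)"
  interpret H: avoidance ?X ?E t h rich \<Delta> m K by (rule H)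
  from sol obtain f M where gd: "H.good f M"
    and s: "\<And>\<Phi>. H.ok f M \<Phi> \<Longrightarrow> \<exists>\<psi>. H.partial_flow \<Phi> {} \<psi>" unfolding H.solvable_def by blast
  have EE: "?E \<subseteq> E" unfolding inside_def by auto
  have E2: "E - Inside Y = ?E" using cutY ends unfolding cut_def inside_def by auto
  have fE: "f k e = 0" if "e \<notin> ?E" for k e using H.goodD(4)[OF gd] that by blast
  have netX: "Net \<psi> v = net t h ?E \<psi> v" if "v \<in> ?X" for \<psi> v
    by (rule net_restrict[OF finE EE]) (use that E2 in \<open>auto simp: inside_def inc_def\<close>)
  have netf: "Net (f k) v = net t h ?E (f k) v" for k v
    by (rule net_restrict[OF finE EE]) (use fE in auto)
  have stars: "{e \<in> Star v. f k e \<noteq> 0} = {e \<in> star t h ?E v. f k e \<noteq> 0}" for k v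
    using fE EE unfolding star_def by blast
  have gd': "good f M"
  proof (rule goodI)
    show "circuits t h E f" unfolding circuits_def stars netf using H.goodD[OF gd] EE by blast
    show "v \<in> V \<and> S \<subseteq> Star v \<and> card S = 2 \<and> (\<forall>e\<in>S. \<not> circ f e)" if "rich" "(v, S) \<in> M" for v S
      using H.good_pair[OF gd that] EE unfolding star_def by blast
    show "S \<inter> S' = {}" if "rich" "(v, S) \<in> M" "(v, S') \<in> M" "S \<noteq> S'" for v S S'
      by (rule H.good_disjoint[OF gd that])
  qed
  obtain r where r: "r \<in> Y" using Y by blast
  show ?thesis
  proof (rule solvable_by_region[OF Y(1) big])
    have "completes f M {r}" by (rule completes_start[OF _ connects_singleton]) (use r Y in auto)
    moreover have "{t e, h e} \<inter> (Y - {r}) = {}" if "circ f e" for e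
    proof -
      have "e \<in> ?E" using that fE[of e] unfolding circ_def by blast
      then show ?thesis unfolding inside_def by auto
    qed
    moreover have "S \<subseteq> E - Inside Y" if "rich" "(v, S) \<in> M" for v S
    proof -
      have "S \<subseteq> star t h ?E v" using H.good_pair[OF gd that] by blast
      then show ?thesis unfolding E2 star_def by auto
    qed
    ultimately show "region_state Y {r} f M" using r gd' by (intro region_stateI) blast+
    show "\<exists>\<psi>. partial_flow \<Phi> Y \<psi>" if o: "ok f M \<Phi>" for \<Phi>
    proof -
      have "H.ok f M \<Phi>"
      proof (rule H.okI)
        show "N dvd net t h ?E \<Phi> v" if "v \<in> ?X" for v using okD(1)[OF o, of v] netX[OF that] that by simp
        show "\<not> m dvd \<Phi> e" if "e \<in> ?E" "rich \<or> circ f e" for e using okD(2)[OF o _ that(2)] that(1) EE by blast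
        show "\<not> m dvd \<Phi> e - \<Phi> g \<and> \<not> m dvd \<Phi> e + \<Phi> g"
          if "rich" "e \<in> ?E" "g \<in> ?E" "e \<noteq> g" "share t h e g" "circ f e" for e g
          using ok_cls[OF o that(1) _ _ that(4,5,6)] that(2,3) EE by blast
        show "\<not> m dvd (\<Sum>e\<in>S. inc t h e v * \<Phi> e)" if "rich" "(v, S) \<in> M" for v S by (rule okD(3)[OF o that])
      qed
      then obtain \<psi> where \<psi>: "H.partial_flow \<Phi> {} \<psi>" using s by blast
      have "H.Inside {} = {}" unfolding inside_def by auto
      then have "partial_flow \<Phi> Y \<psi>"
        using \<psi> netX Y(1) unfolding partial_flow_def H.partial_flow_def E2 proper_def H.proper_def by auto
      then show ?thesis by blast
    qed
  qed (use cutY in auto)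
qed

end

text \<open>The graph on \<open>V - Y\<close> is obtained by moving the end \<open>v\<close> of \<open>e1\<close> to the end \<open>u'\<close> of \<open>e2\<close>.\<close>

locale two_cut = avoidance V E t h rich \<Delta> m K
  for V :: "'v set" and E :: "'e set" and t h rich \<Delta> m K +
  fixes Y :: "'v set" and e1 e2 :: 'e and u v u' v' :: 'v
  assumes adm: admissible and Y: "Y \<subseteq> V"
    and big: "\<And>Z. Z \<subset> Y \<Longrightarrow> Z \<noteq> {} \<Longrightarrow> 3 \<le> card (Cut Z)"
    and cutY: "Cut Y = {e1, e2}" and ne: "e1 \<noteq> e2"
    and ends1: "{t e1, h e1} = {u, v}" and ends2: "{t e2, h e2} = {u', v'}"
    and uX: "u \<in> V - Y" "u' \<in> V - Y" and vY: "v \<in> Y" "v' \<in> Y"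
begin

abbreviation "X \<equiv> V - Y"

definition contr :: "'v \<Rightarrow> 'v" where "contr w = (if w \<in> Y then u' else w)"
definition t2 :: "'e \<Rightarrow> 'v" where "t2 = contr \<circ> t"
definition h2 :: "'e \<Rightarrow> 'v" where "h2 = contr \<circ> h"
text \<open>Contracting \<open>Y\<close> to \<open>u'\<close> turns \<open>e2\<close> into a loop,
  which is dropped, while \<open>e1\<close> survives as an edge between \<open>u\<close> and
  \<open>u'\<close> that stands for both.\<close>

definition E2 :: "'e set" where "E2 = insert e1 (Inside X)"
text \<open>These signs are 1 for an edge oriented from \<open>V - Y\<close> to \<open>Y\<close>,
  and -1 otherwise.\<close>

definition s1 :: int where "s1 = inc t h e1 u"
definition s2 :: int where "s2 = inc t h e2 u'"

lemma e12E: "e1 \<in> E" "e2 \<in> E" using cutY unfolding cut_def by auto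

lemma e12_notin: "e1 \<notin> Inside X" "e2 \<notin> Inside X" "e1 \<notin> Inside Y" "e2 \<notin> Inside Y"
  using cutY unfolding cut_def inside_def by auto

lemma E2_sub: "E2 \<subseteq> E" unfolding E2_def using e12E by (auto simp: inside_def)

lemma e2E2: "e2 \<notin> E2" unfolding E2_def using e12_notin ne by auto

lemma E_split: "E - Inside Y = insert e2 E2"
proof -
  have "a \<in> Inside X \<or> a = e1 \<or> a = e2" if "a \<in> E" "a \<notin> Inside Y" for a
  proof (cases "a \<in> Cut Y")
    case True then show ?thesis using cutY by auto
  next
    case False then show ?thesis using that ends unfolding cut_def inside_def by auto
  qed
  then show ?thesis unfolding E2_def using e12E e12_notin by (auto simp: inside_def)
qed

lemma in_X: "a \<in> Inside X \<Longrightarrow> t2 a = t a \<and> h2 a = h a"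
  unfolding inside_def t2_def h2_def contr_def by auto

lemma orient1: "t e1 = u \<and> h e1 = v \<and> t2 e1 = u \<and> h2 e1 = u' \<and> s1 = 1
  \<or> t e1 = v \<and> h e1 = u \<and> t2 e1 = u' \<and> h2 e1 = u \<and> s1 = -1"
proof -
  have "u \<noteq> v" using uX vY by auto
  then show ?thesis using ends1 uX vY unfolding t2_def h2_def contr_def s1_def inc_def doubleton_eq_iff by auto
qed

lemma orient2: "t e2 = u' \<and> h e2 = v' \<and> s2 = 1 \<or> t e2 = v' \<and> h e2 = u' \<and> s2 = -1"
proof -
  have "u' \<noteq> v'" using uX vY by auto
  then show ?thesis using ends2 unfolding s2_def inc_def doubleton_eq_iff by auto
qed

lemma ss: "s1 * s1 = 1" "s2 * s2 = 1" "s1 = 1 \<or> s1 = -1" "s2 = 1 \<or> s2 = -1" using orient1 orient2 by auto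

lemma inc1: "w \<in> X \<Longrightarrow> inc t h e1 w = s1 * of_bool (w = u)" "w \<in> Y \<Longrightarrow> inc t h e1 w = - s1 * of_bool (w = v)"
  using orient1 uX vY unfolding inc_def by auto

lemma inc2: "w \<in> X \<Longrightarrow> inc t h e2 w = s2 * of_bool (w = u')" "w \<in> Y \<Longrightarrow> inc t h e2 w = - s2 * of_bool (w = v')"
  using orient2 uX vY unfolding inc_def by auto

lemma inc_H: "inc t2 h2 e1 w = s1 * (of_bool (w = u) - of_bool (w = u'))"
  using orient1 unfolding inc_def by auto

text \<open>Only \<open>u'\<close> notices the change, as there \<open>e1\<close> replaces
  \<open>e2\<close>; the difference is the net flow from \<open>X\<close> to
  \<open>Y\<close>.\<close>

lemma net_X:
  assumes w: "w \<in> X"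
  shows "Net \<chi> w = net t2 h2 E2 \<chi> w + s2 * of_bool (w = u') * (\<chi> e2 + s1 * s2 * \<chi> e1)"
proof -
  have fX: "finite (Inside X)" unfolding inside_def using finE by auto
  have "Net \<chi> w = net t h (insert e2 E2) \<chi> w"
    by (rule net_restrict[OF finE]) (use E_split w in \<open>auto simp: inside_def inc_def\<close>)
  also have "\<dots> = (\<Sum>a\<in>Inside X. inc t h a w * \<chi> a) + inc t h e1 w * \<chi> e1 + inc t h e2 w * \<chi> e2"
    unfolding net_def E2_def using fX e12_notin ne by simp
  also have "(\<Sum>a\<in>Inside X. inc t h a w * \<chi> a) = (\<Sum>a\<in>Inside X. inc t2 h2 a w * \<chi> a)"
    by (rule sum.cong) (use in_X in \<open>auto simp: inc_def\<close>)
  also have "\<dots> = net t2 h2 E2 \<chi> w - inc t2 h2 e1 w * \<chi> e1"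
    unfolding net_def E2_def using fX e12_notin by simp
  finally show ?thesis unfolding inc1(1)[OF w] inc2(1)[OF w] inc_H using ss by (auto simp: algebra_simps)
qed

lemma share_X: "a \<in> Inside X \<Longrightarrow> b \<in> Inside X \<Longrightarrow> share t2 h2 a b = share t h a b"
  using in_X unfolding share_def by simp

lemma share_e1:
  assumes b: "b \<in> Inside X"
  shows "share t2 h2 e1 b \<longleftrightarrow> share t h e1 b \<or> share t h e2 b"
proof -
  have "{t2 e1, h2 e1} = {u, u'}" using orient1 by auto
  moreover have "{t b, h b} \<inter> Y = {}" using b unfolding inside_def by auto
  ultimately show ?thesis unfolding share_def ends1 ends2 using in_X[OF b] vY by auto
qed

lemma not_share12: "rich \<Longrightarrow> \<not> share t h e1 e2"
  using adm Y ne cutY unfolding admissible_def by blast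

lemma u_ne: "rich \<Longrightarrow> u \<noteq> u'" "rich \<Longrightarrow> v \<noteq> v'"
  using not_share12 unfolding share_def ends1 ends2 by auto

text \<open>At \<open>u'\<close> the edge \<open>e1\<close> replaces \<open>e2\<close>, so no degree
  grows. In the rich case \<open>e1\<close> does not become a loop: the edges of the cut have no
  common vertex, so \<open>u\<close> and \<open>u'\<close> differ.\<close>

lemma H: "avoidance X E2 t2 h2 rich \<Delta> m K"
proof
  show "finite X" "finite E2" using finV finite_subset[OF E2_sub finE] by auto
  show "t2 e \<in> X \<and> h2 e \<in> X" if "e \<in> E2" for e
    using that orient1 uX in_X[of e] unfolding E2_def by (auto simp: inside_def)
  show "0 < m" by (rule m0)
  show "K = 3" if "\<not> rich" using not_rich that .
  show "3 \<le> \<Delta> \<and> K = 8 * int \<Delta> - 13 \<and> (\<forall>v\<in>X. card (star t2 h2 E2 v) \<le> \<Delta>) \<and> (\<forall>e\<in>E2. t2 e \<noteq> h2 e)" if r: "rich"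
  proof -
    have "card (star t2 h2 E2 w) \<le> \<Delta>" if w: "w \<in> X" for w
    proof (cases "w = u'")
      case False
      have "star t2 h2 E2 w \<subseteq> Star w"
        using in_X orient1 False E2_sub unfolding star_def E2_def by auto
      then have "card (star t2 h2 E2 w) \<le> card (Star w)" using fin_star by (rule card_mono[rotated])
      also have "\<dots> \<le> \<Delta>" using rich[OF r] w by auto
      finally show ?thesis .
    next
      case True
      have sub: "star t2 h2 E2 w \<subseteq> insert e1 (Star w - {e2})"
        using in_X e12_notin unfolding star_def E2_def by (auto simp: inside_def)
      have e2: "e2 \<in> Star w" using True orient2 e12E unfolding star_def by auto
      have "card (star t2 h2 E2 w) \<le> card (insert e1 (Star w - {e2}))"
        using sub fin_star by (intro card_mono) auto
      also have "\<dots> \<le> Suc (card (Star w - {e2}))" using fin_star by (simp add: card_insert_if)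
      also have "\<dots> = card (Star w)" using e2 fin_star by (rule card_Suc_Diff1[rotated])
      also have "\<dots> \<le> \<Delta>" using rich[OF r] w by auto
      finally show ?thesis .
    qed
    moreover have "t2 e \<noteq> h2 e" if "e \<in> E2" for e
    proof (cases "e = e1")
      case True
      then show ?thesis using orient1 u_ne(1)[OF r] by auto
    next
      case False
      then have "e \<in> Inside X" using that unfolding E2_def by simp
      moreover have "e \<in> E" using that E2_sub by blast
      ultimately show ?thesis using in_X[of e] rich[OF r] by simp
    qed
    ultimately show ?thesis using rich[OF r] by blast
  qed
qed

sublocale H: avoidance X E2 t2 h2 rich \<Delta> m K by (rule H)

text \<open>\<open>Y\<close> has to stay on the side of the vertex \<open>u'\<close> to which it was
  contracted.\<close>

lemma cut_H: 
  assumes "Z \<subseteq> X"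
  shows "H.Cut Z = Cut (if u' \<in> Z then Z \<union> Y else Z)"
proof -
  let ?Z = "if u' \<in> Z then Z \<union> Y else Z"
  have "a \<in> H.Cut Z \<longleftrightarrow> a \<in> Cut ?Z" for a
  proof -
    consider "a \<in> Inside X" | "a = e1" | "a = e2" | "a \<in> Inside Y" | "a \<notin> E" using E_split unfolding E2_def by auto
    then show ?thesis
    proof cases
      case 1
      then have "a \<in> E" "a \<in> E2" "t a \<notin> Y" "h a \<notin> Y" unfolding E2_def inside_def by auto
      then show ?thesis unfolding cut_def using in_X[OF 1] by auto
    next
      case 2
      have "e1 \<in> E2" unfolding E2_def by simp
      then show ?thesis unfolding cut_def 2 using e12E orient1 uX vY assms by auto
    next
      case 3
      then show ?thesis unfolding cut_def using e2E2 orient2 uX vY assms by auto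
    next
      case 4
      then have "a \<notin> E2" unfolding E2_def using e12_notin by (auto simp: inside_def)
      then show ?thesis unfolding cut_def using 4 assms by (auto simp: inside_def)
    next
      case 5
      then show ?thesis using E2_sub unfolding cut_def by auto
    qed
  qed
  then show ?thesis by blast
qed

text \<open>Exchanging the side of \<open>Y\<close> trades \<open>e1\<close> for \<open>e2\<close> in a cut.\<close>

lemma cut_H_swap:
  assumes "Z \<subseteq> X" "e1 \<in> H.Cut Z" "b \<in> Inside X" "H.Cut Z = {e1, b}"
  shows "Cut (if u' \<in> Z then Z else Z \<union> Y) = {e2, b}"
proof -
  let ?Z = "if u' \<in> Z then Z else Z \<union> Y"
  have "a \<in> Cut ?Z \<longleftrightarrow> a = e2 \<or> a = b" for a
  proof -
    consider "a \<in> Inside X" | "a = e1" | "a = e2" | "a \<in> Inside Y" | "a \<notin> E" using E_split unfolding E2_def by auto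
    then show ?thesis
    proof cases
      case 1
      then have "a \<in> E" "a \<in> E2" "t a \<notin> Y" "h a \<notin> Y" "a \<noteq> e1" "a \<noteq> e2"
        using e12_notin unfolding E2_def inside_def by auto
      moreover have "a \<in> H.Cut Z \<longleftrightarrow> a = b" using assms(4) \<open>a \<noteq> e1\<close> by auto
      ultimately show ?thesis unfolding cut_def using in_X[OF 1] by auto
    next
      case 2
      have "e1 \<noteq> b" using assms(3) e12_notin by auto
      moreover have "e1 \<notin> Cut ?Z" using assms(2) unfolding cut_def using orient1 uX vY assms(1) by auto
      ultimately show ?thesis using 2 ne by auto
    next
      case 3
      then show ?thesis unfolding cut_def using e12E orient2 uX vY assms(1) by auto
    next
      case 4
      then have "a \<noteq> b" "a \<noteq> e2" using assms(3) e12_notin by (auto simp: inside_def)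
      then show ?thesis unfolding cut_def using 4 assms(1) by (auto simp: inside_def)
    next
      case 5
      then show ?thesis using e12E assms(3) unfolding cut_def inside_def by auto
    qed
  qed
  then show ?thesis by blast
qed

text \<open>In the smaller graph \<open>e1\<close> inherits its neighbours from \<open>e1\<close> at
  \<open>u\<close> and from \<open>e2\<close> at \<open>u'\<close>. A cut \<open>{e1, b}\<close>
  there yields both \<open>{e1, b}\<close> and \<open>{e2, b}\<close> as cuts of the original graph,
  so \<open>b\<close> is adjacent to neither edge.\<close>

lemma admissible_H: "H.admissible"
  unfolding H.admissible_def
proof (intro conjI allI impI)
  fix Z assume Z: "Z \<subseteq> X"
  then have "(if u' \<in> Z then Z \<union> Y else Z) \<subseteq> V" using Y by auto
  then show "card (H.Cut Z) \<noteq> 1" unfolding cut_H[OF Z] using adm unfolding admissible_def by blast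
next
  fix Z a b assume r: "rich" and Z: "Z \<subseteq> X" and ab: "a \<noteq> b \<and> H.Cut Z = {a, b}"
  have sub: "(if u' \<in> Z then Z \<union> Y else Z) \<subseteq> V" "(if u' \<in> Z then Z else Z \<union> Y) \<subseteq> V" using Y Z by auto
  have no: "\<not> share t h a b" using adm r sub(1) ab unfolding cut_H[OF Z] admissible_def by blast
  have key: "\<not> share t2 h2 e1 b" if "b \<in> Inside X" "H.Cut Z = {e1, b}" for b
  proof -
    have "e1 \<noteq> b" "e2 \<noteq> b" using that e12_notin by auto
    moreover have "Cut (if u' \<in> Z then Z else Z \<union> Y) = {e2, b}" by (rule cut_H_swap[OF Z _ that]) (use that in auto)
    ultimately have "\<not> share t h e1 b" "\<not> share t h e2 b"
      using adm r sub that(2) unfolding cut_H[OF Z] admissible_def by blast+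
    then show ?thesis using share_e1[OF that(1)] by blast
  qed
  have "a \<in> E2" "b \<in> E2" using ab unfolding cut_def by auto
  then consider "a \<in> Inside X" "b \<in> Inside X" | "a = e1" "b \<in> Inside X" | "a \<in> Inside X" "b = e1"
    using ab unfolding E2_def by auto
  then show "\<not> share t2 h2 a b"
  proof cases
    case 1 then show ?thesis using no share_X by blast
  next
    case 2 then show ?thesis using key ab by blast
  next
    case 3
    then have "\<not> share t2 h2 e1 a" using key[of a] ab by (simp add: insert_commute)
    then show ?thesis using 3 share_commute[of t2 h2] by blast
  qed
qed

end

section \<open>Transfer of circuits, pairs and flows across a 2-edge-cut\<close>

context two_cut
begin

text \<open>The value on \<open>e2\<close> is the one forced by conservation across the cut.\<close>

definition ext :: "('e \<Rightarrow> int) \<Rightarrow> 'e \<Rightarrow> int" where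
  "ext \<chi> a = (if a = e2 then - (s1 * s2 * \<chi> e1) else \<chi> a)"

text \<open>A pair at \<open>u'\<close> that contains \<open>e1\<close> in the smaller graph comes
  from a pair with \<open>e2\<close>, since the moved end of \<open>e1\<close> took the place of
  \<open>e2\<close> there.\<close>

definition swap :: "'v \<Rightarrow> 'e set \<Rightarrow> 'e set" where
  "swap w S = (if w = u' \<and> e1 \<in> S then insert e2 (S - {e1}) else S)"

lemma ext_simps: "ext \<chi> e2 = - (s1 * s2 * \<chi> e1)" "a \<noteq> e2 \<Longrightarrow> ext \<chi> a = \<chi> a" "ext \<chi> e1 = \<chi> e1"
  using ne unfolding ext_def by auto

lemma ext_nonzero: "ext \<chi> e2 \<noteq> 0 \<longleftrightarrow> \<chi> e1 \<noteq> 0"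
  using ss unfolding ext_def by auto

lemma net_ext:
  assumes "w \<in> X"
  shows "Net (ext \<chi>) w = net t2 h2 E2 \<chi> w"
proof -
  have "net t2 h2 E2 (ext \<chi>) w = net t2 h2 E2 \<chi> w"
    unfolding net_def by (rule sum.cong) (use e2E2 in \<open>auto simp: ext_def\<close>)
  then show ?thesis using net_X[OF assms, of "ext \<chi>"] by (simp add: ext_simps)
qed

lemma net_Y:
  assumes "w \<in> Y" "\<And>a. a \<in> Inside Y \<Longrightarrow> \<chi> a = 0"
  shows "Net \<chi> w = - s1 * of_bool (w = v) * \<chi> e1 - s2 * of_bool (w = v') * \<chi> e2"
proof -
  have "Net \<chi> w = net t h {e1, e2} \<chi> w"
    by (rule net_restrict[OF finE]) (use e12E E_split assms in \<open>auto simp: E2_def inside_def inc_def\<close>)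
  then show ?thesis unfolding net_def using ne inc1(2)[OF assms(1)] inc2(2)[OF assms(1)] by simp
qed

lemma cut_sum:
  assumes "\<And>v. v \<in> V \<Longrightarrow> N dvd Net \<Phi> v"
  shows "N dvd \<Phi> e2 + s1 * s2 * \<Phi> e1"
proof -
  have fY: "finite Y" using Y finV finite_subset by blast
  have "N dvd (\<Sum>w\<in>Y. Net \<Phi> w)" by (rule dvd_sum) (use assms Y in auto)
  also have "(\<Sum>w\<in>Y. Net \<Phi> w) = (\<Sum>a\<in>{e1, e2}. cross t h a Y * \<Phi> a)"
    unfolding sum_net[OF fY]
    by (rule sum.mono_neutral_right) (use finE e12E cutY in \<open>auto simp: cut_def cross_def\<close>)
  also have "\<dots> = - s1 * \<Phi> e1 - s2 * \<Phi> e2"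
    using ne orient1 orient2 uX vY unfolding cross_def by auto
  finally have "N dvd (- s2) * (- s1 * \<Phi> e1 - s2 * \<Phi> e2)" by (rule dvd_mult)
  moreover have "(- s2) * (- s1 * \<Phi> e1 - s2 * \<Phi> e2) = \<Phi> e2 + s1 * s2 * \<Phi> e1"
    using ss by (auto simp: algebra_simps)
  ultimately show ?thesis by metis
qed

text \<open>The values of \<open>e1\<close> and \<open>e2\<close> agree up to sign, and avoiding
  both \<open>z\<close> and \<open>- z\<close> is insensitive to that sign.\<close>

lemma sign_sep:
  assumes "d dvd y + s1 * s2 * x"
  shows "d dvd x - z \<or> d dvd x + z \<longleftrightarrow> d dvd y - z \<or> d dvd y + z"
proof -
  have tr: "d dvd y - z \<longleftrightarrow> d dvd x - z" "d dvd y + z \<longleftrightarrow> d dvd x + z" if "d dvd y - x" for x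
  proof -
    have "d dvd (y - z) - (x - z)" "d dvd (y + z) - (x + z)" using that by simp_all
    then show "d dvd y - z \<longleftrightarrow> d dvd x - z" "d dvd y + z \<longleftrightarrow> d dvd x + z"
      using dvd_add_right_iff[of d "(y - z) - (x - z)" "x - z"] dvd_add_right_iff[of d "(y + z) - (x + z)" "x + z"]
      by simp_all
  qed
  consider "s1 * s2 = 1" | "s1 * s2 = -1" using ss by auto
  then show ?thesis
  proof cases
    case 1
    then have "d dvd y - (- x)" using assms by simp
    note tr[OF this]
    moreover have "d dvd - x - z \<longleftrightarrow> d dvd x + z" using dvd_minus_iff[of d "x + z"] by simp
    moreover have "d dvd - x + z \<longleftrightarrow> d dvd x - z" using dvd_minus_iff[of d "x - z"] by simp
    ultimately show ?thesis by blast
  next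
    case 2
    then have "d dvd y - x" using assms by simp
    then show ?thesis using tr by blast
  qed
qed

text \<open>A solution of the smaller graph becomes a partial flow that lacks only the inside of
  \<open>Y\<close>. The residues pass to the smaller graph because \<open>\<Phi>\<close> is balanced
  across the cut, so that \<open>e1\<close> can stand for \<open>e2\<close> up to sign.\<close>

lemma reduce:
  assumes gd2: "H.good f2 M2" and sol: "\<And>\<Phi>. H.ok f2 M2 \<Phi> \<Longrightarrow> \<exists>\<psi>. H.partial_flow \<Phi> {} \<psi>"
    and clsE: "\<And>a. circ f2 a \<Longrightarrow> circ f a" "circ f2 e1 \<Longrightarrow> circ f e2"
    and MM: "\<And>w S. (w, S) \<in> M2 \<Longrightarrow> (w, swap w S) \<in> M"
    and okf: "ok f M \<Phi>"
  shows "\<exists>\<psi>. partial_flow \<Phi> Y \<psi>"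
proof -
  have sumN: "N dvd \<Phi> e2 + s1 * s2 * \<Phi> e1" by (rule cut_sum) (rule okD(1)[OF okf])
  then have summ: "m dvd \<Phi> e2 + s1 * s2 * \<Phi> e1" by (rule dvd_mult_left)
  have E2_cases: "a \<in> Inside X \<or> a = e1" if "a \<in> E2" for a using that unfolding E2_def by auto
  have inE: "a \<in> E" if "a \<in> E2" for a using that E2_sub by blast
  have "H.ok f2 M2 \<Phi>"
  proof (rule H.okI)
    fix w assume w: "w \<in> X"
    have "N dvd Net \<Phi> w" using okD(1)[OF okf] w by simp
    moreover have "N dvd s2 * of_bool (w = u') * (\<Phi> e2 + s1 * s2 * \<Phi> e1)" using sumN by (rule dvd_mult)
    ultimately show "N dvd net t2 h2 E2 \<Phi> w" unfolding net_X[OF w] by (simp only: dvd_add_left_iff)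
  next
    fix a assume "a \<in> E2" "rich \<or> circ f2 a"
    then show "\<not> m dvd \<Phi> a" using okD(2)[OF okf] inE clsE by blast
  next
    fix a b assume r: "rich" and ab: "a \<in> E2" "b \<in> E2" "a \<noteq> b" and sh: "share t2 h2 a b" and c: "circ f2 a"
    show "\<not> m dvd \<Phi> a - \<Phi> b \<and> \<not> m dvd \<Phi> a + \<Phi> b"
    proof (cases "share t h a b")
      case True
      then show ?thesis using ok_cls[OF okf r _ _ ab(3)] inE ab clsE(1)[OF c] by blast
    next
      case False
      consider "a = e1" "b \<in> Inside X" | "b = e1" "a \<in> Inside X"
        using E2_cases[OF ab(1)] E2_cases[OF ab(2)] ab(3) sh False share_X by blast
      then show ?thesis
      proof cases
        case 1
        then have "share t h e2 b" using sh False share_e1 by blast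
        moreover have "b \<noteq> e2" using 1 e12_notin by auto
        ultimately have "\<not> m dvd \<Phi> e2 - \<Phi> b \<and> \<not> m dvd \<Phi> e2 + \<Phi> b"
          using ok_cls[OF okf r e12E(2) inE[OF ab(2)]] clsE(2) c 1 by blast
        then show ?thesis using sign_sep[OF summ] 1 by blast
      next
        case 2
        then have s: "share t h a e2" using sh False share_e1[of a] share_commute[of t2 h2] share_commute[of t h] by blast
        have "a \<noteq> e2" using 2 e12_notin by auto
        then have "\<not> m dvd \<Phi> a - \<Phi> e2 \<and> \<not> m dvd \<Phi> a + \<Phi> e2"
          using ok_cls[OF okf r inE[OF ab(1)] e12E(2) _ s] clsE(1)[OF c] by blast
        then have "\<not> m dvd \<Phi> e2 - \<Phi> a \<and> \<not> m dvd \<Phi> e2 + \<Phi> a"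
          by (simp add: dvd_diff_commute add.commute)
        then have "\<not> m dvd \<Phi> e1 - \<Phi> a \<and> \<not> m dvd \<Phi> e1 + \<Phi> a" using sign_sep[OF summ] by blast
        then show ?thesis using 2 by (simp add: dvd_diff_commute add.commute)
      qed
    qed
  next
    fix w S assume r: "rich" and S: "(w, S) \<in> M2"
    note gp = H.good_pair[OF gd2 r S]
    have finS: "finite S" using gp by (metis card.infinite zero_neq_numeral)
    have SE: "S \<subseteq> E2" using gp unfolding star_def by auto
    have n: "\<not> m dvd (\<Sum>a\<in>swap w S. inc t h a w * \<Phi> a)" by (rule okD(3)[OF okf r MM[OF S]])
    have wX: "w \<in> X" using gp by blast
    have incX: "inc t2 h2 a w = inc t h a w" if "a \<in> S - {e1}" for a
      using that SE E2_cases[of a] in_X[of a] unfolding inc_def by auto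
    show "\<not> m dvd (\<Sum>a\<in>S. inc t2 h2 a w * \<Phi> a)"
    proof (cases "e1 \<in> S")
      case False
      then have "(\<Sum>a\<in>S. inc t2 h2 a w * \<Phi> a) = (\<Sum>a\<in>S. inc t h a w * \<Phi> a)"
        by (intro sum.cong) (use incX in auto)
      then show ?thesis using n False unfolding swap_def by simp
    next
      case True
      have rem: "(\<Sum>a\<in>S. inc t2 h2 a w * \<Phi> a) = inc t2 h2 e1 w * \<Phi> e1 + (\<Sum>a\<in>S - {e1}. inc t h a w * \<Phi> a)"
        using sum.remove[OF finS True, of "\<lambda>a. inc t2 h2 a w * \<Phi> a"] sum.cong[OF refl, of "S - {e1}" "\<lambda>a. inc t2 h2 a w * \<Phi> a" "\<lambda>a. inc t h a w * \<Phi> a"] incX by simp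
      show ?thesis
      proof (cases "w = u'")
        case False
        have "w = u" using True gp orient1 False unfolding star_def by auto
        then have "inc t2 h2 e1 w = inc t h e1 w" unfolding inc_H inc1(1)[OF wX] using u_ne(1)[OF r] by simp
        then have "(\<Sum>a\<in>S. inc t2 h2 a w * \<Phi> a) = (\<Sum>a\<in>S. inc t h a w * \<Phi> a)"
          unfolding rem using sum.remove[OF finS True, of "\<lambda>a. inc t h a w * \<Phi> a"] by simp
        then show ?thesis using n False unfolding swap_def by simp
      next
        case w: True
        have i1: "inc t2 h2 e1 w = - s1" unfolding inc_H using u_ne(1)[OF r] w by simp
        have i2: "inc t h e2 w = s2" unfolding inc2(1)[OF wX] using w by simp
        have "e2 \<notin> S" using SE e2E2 by blast
        then have "(\<Sum>a\<in>swap w S. inc t h a w * \<Phi> a) = s2 * \<Phi> e2 + (\<Sum>a\<in>S - {e1}. inc t h a w * \<Phi> a)"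
          unfolding swap_def using True w finS i2 by simp
        also have "\<dots> = (\<Sum>a\<in>S. inc t2 h2 a w * \<Phi> a) + s2 * (\<Phi> e2 + s1 * s2 * \<Phi> e1)"
          unfolding rem i1 using ss by (auto simp: algebra_simps)
        finally have eq: "(\<Sum>a\<in>swap w S. inc t h a w * \<Phi> a) =
          (\<Sum>a\<in>S. inc t2 h2 a w * \<Phi> a) + s2 * (\<Phi> e2 + s1 * s2 * \<Phi> e1)" .
        show ?thesis
        proof
          assume "m dvd (\<Sum>a\<in>S. inc t2 h2 a w * \<Phi> a)"
          then have "m dvd (\<Sum>a\<in>swap w S. inc t h a w * \<Phi> a)"
            unfolding eq by (rule dvd_add[OF _ dvd_mult[OF summ]])
          then show False using n by contradiction
        qed
      qed
    qed
  qed
  then obtain \<psi>0 where "H.partial_flow \<Phi> {} \<psi>0" using sol by blast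
  then have pr0: "H.proper \<Phi> E2 \<psi>0" and cons0: "\<And>w. w \<in> X \<Longrightarrow> N dvd net t2 h2 E2 \<psi>0 w"
    unfolding H.partial_flow_def by (auto simp: inside_def)
  define \<psi> where "\<psi> = ext \<psi>0"
  have \<psi>: "\<psi> a = \<psi>0 a" if "a \<in> E2" for a using that e2E2 unfolding \<psi>_def ext_def by auto
  have e1E2: "e1 \<in> E2" unfolding E2_def by simp
  have e2_sep: "\<not> N dvd \<psi> e2 - \<psi> b \<and> \<not> N dvd \<psi> e2 + \<psi> b"
    if r: "rich" and b: "b \<in> Inside X" "share t h e2 b" for b
  proof -
    have bE: "b \<in> E2" "e1 \<noteq> b" using b e12_notin unfolding E2_def by auto
    have "share t2 h2 e1 b" using b share_e1 by blast
    then have "\<not> N dvd \<psi>0 e1 - \<psi>0 b \<and> \<not> N dvd \<psi>0 e1 + \<psi>0 b" using H.properD(3)[OF pr0 r e1E2 bE] by blast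
    moreover have "N dvd \<psi> e2 + s1 * s2 * \<psi>0 e1" unfolding \<psi>_def ext_simps by simp
    ultimately show ?thesis using sign_sep[of N "\<psi> e2" "\<psi>0 e1" "\<psi>0 b"] \<psi>[OF bE(1)] by auto
  qed
  have "proper \<Phi> (insert e2 E2) \<psi>"
  proof (rule properI)
    fix a assume a: "a \<in> insert e2 E2"
    show "m dvd \<psi> a - \<Phi> a \<and> \<not> N dvd \<psi> a"
    proof (cases "a = e2")
      case False
      then show ?thesis using a H.properD(1,2)[OF pr0, of a] \<psi> by auto
    next
      case True
      have "m dvd - (s1 * s2 * (\<psi>0 e1 - \<Phi> e1)) - (\<Phi> e2 + s1 * s2 * \<Phi> e1)"
        using H.properD(1)[OF pr0 e1E2] summ by (intro dvd_diff) auto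
      also have "- (s1 * s2 * (\<psi>0 e1 - \<Phi> e1)) - (\<Phi> e2 + s1 * s2 * \<Phi> e1) = \<psi> a - \<Phi> a"
        unfolding True \<psi>_def ext_simps by (simp add: algebra_simps)
      finally have "m dvd \<psi> a - \<Phi> a" .
      have "\<not> N dvd \<psi> a" using H.properD(2)[OF pr0 e1E2] ss unfolding True \<psi>_def ext_simps by auto
      then show ?thesis using \<open>m dvd \<psi> a - \<Phi> a\<close> by blast
    qed
  next
    fix a b assume r: "rich" and ab: "a \<in> insert e2 E2" "b \<in> insert e2 E2" "a \<noteq> b" and sh: "share t h a b"
    have no12: "\<not> (a = e1 \<and> b = e2)" "\<not> (a = e2 \<and> b = e1)"
      using not_share12[OF r] sh share_commute[of t h] by auto
    consider "a \<in> E2" "b \<in> E2" | "a = e2" "b \<in> Inside X" | "b = e2" "a \<in> Inside X"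
      using ab no12 E2_cases by blast
    then show "\<not> N dvd \<psi> a - \<psi> b \<and> \<not> N dvd \<psi> a + \<psi> b"
    proof cases
      case 1
      have "share t2 h2 a b"
        using E2_cases[OF 1(1)] E2_cases[OF 1(2)] share_X share_e1 ab(3) sh share_commute[of t h] share_commute[of t2 h2] by metis
      then show ?thesis using H.properD(3)[OF pr0 r 1 ab(3)] \<psi> 1 by simp
    next
      case 2
      then show ?thesis using e2_sep[OF r] sh by blast
    next
      case 3
      then have "share t h e2 a" using sh share_commute[of t h] by blast
      then show ?thesis using e2_sep[OF r 3(2)] 3 by (simp add: dvd_diff_commute add.commute)
    qed
  qed
  moreover have "N dvd Net \<psi> w" if "w \<in> V - Y" for w
    using cons0[OF that] unfolding \<psi>_def net_ext[OF that] .
  ultimately have "partial_flow \<Phi> Y \<psi>" unfolding partial_flow_def E_split by blast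
  then show ?thesis by blast
qed

text \<open>A circuit of the smaller graph through \<open>e1\<close> passes through
  \<open>e1\<close> and \<open>e2\<close> in the original one, where it is open between
  \<open>v\<close> and \<open>v'\<close> unless these coincide. It is closed by a path in
  \<open>Y\<close>, whose vertices then form the starting region. If there is nothing to close, the
  region starts at \<open>v\<close>.\<close>

lemma solvable_two_cut:
  assumes "H.solvable"
  shows solvable
proof -
  from assms obtain f2 M2 where gd2: "H.good f2 M2"
    and sol: "\<And>\<Phi>. H.ok f2 M2 \<Phi> \<Longrightarrow> \<exists>\<psi>. H.partial_flow \<Phi> {} \<psi>" unfolding H.solvable_def by blast
  define f1 where "f1 = (\<lambda>k. ext (f2 k))"
  define M where "M = (\<lambda>(w, S). (w, swap w S)) ` M2"
  have f2E: "f2 k a \<noteq> 0 \<Longrightarrow> a \<in> E2 \<and> t2 a \<noteq> h2 a" for k a by (rule H.goodD(4)[OF gd2])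
  have f1Y: "f1 k a = 0" if "a \<in> Inside Y" for k a
    using that e12_notin f2E[of k a] E_split unfolding f1_def ext_def by auto
  have clsf1: "circ f1 a \<Longrightarrow> a \<in> insert e2 E2" for a
    using f2E unfolding circ_def f1_def ext_def by (metis insertI1 insertI2)
  have cls21: "circ f1 a" if "circ f2 a" for a
    using that f2E[of _ a] e2E2 ext_simps(2)[of a] unfolding circ_def f1_def by metis
  have cls12: "circ f1 e2 \<longleftrightarrow> circ f2 e1" "circ f1 e1 \<longleftrightarrow> circ f2 e1"
    unfolding circ_def f1_def by (simp_all add: ext_nonzero ext_simps(3))
  have MM: "(w, S) \<in> M2 \<Longrightarrow> (w, swap w S) \<in> M" for w S unfolding M_def by force
  have unit1: "unit_valued (f1 k)" for k
    using H.goodD(1)[OF gd2, of k] ss unfolding f1_def unit_valued_def ext_def by auto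
  have disj1: "f1 True a = 0 \<or> f1 False a = 0" for a
    using H.goodD(5)[OF gd2] unfolding f1_def ext_def by auto
  have ne1: "f1 k a \<noteq> 0 \<Longrightarrow> a \<in> E \<and> t a \<noteq> h a" for k a
  proof -
    assume a: "f1 k a \<noteq> 0"
    then have "circ f1 a" unfolding circ_def by (cases k) auto
    then have aE: "a \<in> insert e2 E2" by (rule clsf1)
    show "a \<in> E \<and> t a \<noteq> h a"
    proof (cases "a \<in> Inside X")
      case True
      then have "a \<noteq> e2" using e12_notin by blast
      then have "f2 k a \<noteq> 0" using a unfolding f1_def ext_def by simp
      then show ?thesis using f2E[of k a] in_X[OF True] E2_sub by auto
    next
      case False
      then have "a = e1 \<or> a = e2" using aE unfolding E2_def by auto
      then show ?thesis using e12E orient1 orient2 uX vY by auto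
    qed
  qed
  have netX1: "Net (f1 k) w = 0" if "w \<in> X" for k w
    unfolding f1_def net_ext[OF that] by (rule H.goodD(2)[OF gd2])
  have netY1: "Net (f1 k) w = (of_bool (w = v') - of_bool (w = v)) * s1 * f2 k e1" if "w \<in> Y" for k w
  proof -
    have "Net (f1 k) w = - s1 * of_bool (w = v) * f1 k e1 - s2 * of_bool (w = v') * f1 k e2"
      by (rule net_Y[OF that]) (rule f1Y)
    moreover have "f1 k e1 = f2 k e1" "f1 k e2 = - (s1 * s2 * f2 k e1)" unfolding f1_def by (simp_all add: ext_simps)
    ultimately show ?thesis using ss by (auto simp: algebra_simps)
  qed
  have net_out: "Net \<chi> w = 0" if "w \<notin> V" for \<chi> w
    unfolding net_def by (rule sum.neutral) (use that ends in \<open>auto simp: inc_def\<close>)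
  have cardX1: "card {a\<in>Star w. f1 k a \<noteq> 0} \<le> 2" if w: "w \<in> X" for k w
  proof -
    \<comment> \<open>In the smaller graph \<open>e1\<close> also does the duty of
      \<open>e2\<close>. The map is injective: \<open>e1\<close> and \<open>e2\<close> meet at
      \<open>w\<close> only if \<open>u = u'\<close>, and then \<open>e1\<close> would be a loop
      there and lie on no circuit.\<close>
    let ?g = "\<lambda>a. if a = e2 then e1 else a"
    have g: "?g a \<in> {a\<in>star t2 h2 E2 w. f2 k a \<noteq> 0}" if a: "a \<in> {a\<in>Star w. f1 k a \<noteq> 0}" for a
    proof (cases "a = e2")
      case True
      then have "w = u'" using a orient2 w vY unfolding star_def by auto
      then show ?thesis using True a orient1 ext_nonzero unfolding f1_def star_def E2_def by auto
    next
      case False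
      then have "f2 k a \<noteq> 0" using a unfolding f1_def ext_def by auto
      moreover from this have "a \<in> E2" using f2E by blast
      moreover have "t2 a = w \<or> h2 a = w"
      proof (cases "a = e1")
        case True
        then show ?thesis using a orient1 w vY unfolding star_def by auto
      next
        case False
        then show ?thesis using \<open>a \<in> E2\<close> in_X[of a] a unfolding E2_def star_def by auto
      qed
      ultimately show ?thesis using False unfolding star_def by auto
    qed
    have "inj_on ?g {a\<in>Star w. f1 k a \<noteq> 0}"
    proof (rule inj_onI)
      fix a b assume a: "a \<in> {a\<in>Star w. f1 k a \<noteq> 0}" and b: "b \<in> {a\<in>Star w. f1 k a \<noteq> 0}" and eq: "?g a = ?g b"
      have no: False if "e1 \<in> {a\<in>Star w. f1 k a \<noteq> 0}" "e2 \<in> {a\<in>Star w. f1 k a \<noteq> 0}"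
      proof -
        have "w = u" "w = u'" using that orient1 orient2 w vY unfolding star_def by auto
        moreover have "f2 k e1 \<noteq> 0" using that(1) unfolding f1_def by (simp add: ext_simps(3))
        then have "t2 e1 \<noteq> h2 e1" using f2E by blast
        ultimately show False using orient1 by auto
      qed
      show "a = b"
        using a b eq no by (cases "a = e2"; cases "b = e2") auto
    qed
    then have "card {a\<in>Star w. f1 k a \<noteq> 0} \<le> card {a\<in>star t2 h2 E2 w. f2 k a \<noteq> 0}"
    proof (rule card_inj_on_le)
      show "?g ` {a\<in>Star w. f1 k a \<noteq> 0} \<subseteq> {a\<in>star t2 h2 E2 w. f2 k a \<noteq> 0}" using g by blast
      show "finite {a\<in>star t2 h2 E2 w. f2 k a \<noteq> 0}" using H.fin_star by simp
    qed
    then show ?thesis using H.goodD(3)[OF gd2, of w k] by simp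
  qed
  have starY: "a \<in> {e1, e2}" if "w \<in> Y" "a \<in> Star w" "f1 k a \<noteq> 0" for w a k
  proof -
    have "a \<notin> Inside X" using that unfolding star_def inside_def by auto
    moreover have "circ f1 a" using that unfolding circ_def by (cases k) auto
    ultimately show ?thesis using clsf1[of a] unfolding E2_def by auto
  qed
  have star_out: "Star w = {}" if "w \<notin> V" for w using that ends unfolding star_def by auto
  have Mgood: "w \<in> V \<and> S \<subseteq> Star w \<and> card S = 2 \<and> (\<forall>a\<in>S. \<not> circ f1 a) \<and> S \<subseteq> insert e2 E2"
    if r: "rich" and "(w, S) \<in> M" for w S
  proof -
    from that(2) obtain S0 where S0: "(w, S0) \<in> M2" "S = swap w S0" unfolding M_def by auto
    note gp = H.good_pair[OF gd2 r S0(1)]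
    have wX: "w \<in> X" using gp by blast
    have S0E: "S0 \<subseteq> E2" using gp unfolding star_def by auto
    have fin0: "finite S0" using gp by (metis card.infinite zero_neq_numeral)
    have ncl: "\<not> circ f1 a" if "a \<in> S0" for a
    proof -
      have "\<not> circ f2 a" "a \<noteq> e2" using gp that S0E e2E2 by auto
      then show ?thesis unfolding circ_def f1_def by (simp add: ext_simps)
    qed
    have stX: "a \<in> Star w" if "a \<in> S0" "a \<noteq> e1" for a
    proof -
      have "a \<in> Inside X" using that S0E unfolding E2_def by auto
      then show ?thesis using gp that in_X[of a] E2_sub S0E unfolding star_def by auto
    qed
    show ?thesis
    proof (cases "w = u' \<and> e1 \<in> S0")
      case True
      have S: "S = insert e2 (S0 - {e1})" using True S0(2) unfolding swap_def by simp
      have "e2 \<notin> S0" using S0E e2E2 by blast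
      then have "card S = Suc (card (S0 - {e1}))" unfolding S using fin0 by simp
      also have "\<dots> = 2" using True fin0 gp card_Suc_Diff1[of S0 e1] by simp
      finally have "card S = 2" .
      moreover have "e2 \<in> Star w" using True orient2 e12E unfolding star_def by auto
      moreover have "\<not> circ f1 e2" unfolding cls12 using gp True by blast
      ultimately show ?thesis using S stX ncl wX S0E by auto
    next
      case False
      have S: "S = S0" using False S0(2) unfolding swap_def by auto
      have "e1 \<in> Star w" if "e1 \<in> S0"
      proof -
        have "w = u" using that False gp orient1 unfolding star_def by auto
        then show ?thesis using orient1 e12E unfolding star_def by auto
      qed
      then show ?thesis using S stX ncl wX S0E gp by blast
    qed
  qed
  have Mdisj: "S \<inter> S' = {}" if r: "rich" and "(w, S) \<in> M" "(w, S') \<in> M" "S \<noteq> S'" for w S S'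
  proof -
    from that obtain S0 S0' where S0: "(w, S0) \<in> M2" "S = swap w S0" "(w, S0') \<in> M2" "S' = swap w S0'"
      unfolding M_def by auto
    then have "S0 \<noteq> S0'" using that by auto
    then have "S0 \<inter> S0' = {}" using H.good_disjoint[OF gd2 r S0(1,3)] by blast
    moreover have "S0 \<subseteq> E2" "S0' \<subseteq> E2"
      using H.good_pair[OF gd2 r S0(1)] H.good_pair[OF gd2 r S0(3)] unfolding star_def by auto
    ultimately show ?thesis using e2E2 unfolding S0 swap_def by auto
  qed
  have bcond: "{t a, h a} \<inter> U \<noteq> {}" if "v \<in> U" "a \<in> Cut Y" "a \<noteq> e2" for a U
    using that cutY orient1 by auto
  have xcond: "z = v'" if "z \<in> {t e2, h e2}" "z \<in> Y" for z
    using that orient2 uX by auto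
  show ?thesis
  proof (cases "v = v' \<or> \<not> circ f2 e1")
    case True
    show ?thesis
    proof (rule solvable_by_region[OF Y big, of e2 "{v}" v' f1 M])
      have "f2 k e1 = 0" if "v \<noteq> v'" for k using True that unfolding circ_def by (cases k) auto
      then have netv: "Net (f1 k) w = 0" for k w
        using netX1[of w k] netY1[of w k] net_out[of w] by (cases "w \<in> V"; cases "w \<in> Y") auto
      have cardv: "card {a\<in>Star w. f1 k a \<noteq> 0} \<le> 2" for k w
      proof -
        consider "w \<in> X" | "w \<in> Y" | "w \<notin> V" by blast
        then show ?thesis
        proof cases
          case 1 then show ?thesis by (rule cardX1)
        next
          case 2
          then have "{a\<in>Star w. f1 k a \<noteq> 0} \<subseteq> {e1, e2}" using starY by blast
          then have "card {a\<in>Star w. f1 k a \<noteq> 0} \<le> card {e1, e2}" by (rule card_mono[rotated]) simp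
          then show ?thesis using ne by simp
        next
          case 3 then show ?thesis using star_out by simp
        qed
      qed
      have "good f1 M"
      proof (rule goodI)
        show "w \<in> V \<and> S \<subseteq> Star w \<and> card S = 2 \<and> (\<forall>a\<in>S. \<not> circ f1 a)" if "rich" "(w, S) \<in> M" for w S
          using Mgood[OF that] by blast
        show "S \<inter> S' = {}" if "rich" "(w, S) \<in> M" "(w, S') \<in> M" "S \<noteq> S'" for w S S' by (rule Mdisj[OF that])
        show "circuits t h E f1" unfolding circuits_def using unit1 netv cardv disj1 ne1 by blast
      qed
      moreover have "completes f1 M {v}" by (rule completes_start[OF _ connects_singleton]) (use vY Y in auto)
      moreover have "{t a, h a} \<inter> (Y - {v}) = {}" if c: "circ f1 a" for a
      proof -
        have "a \<in> Inside X \<or> a = e1 \<or> a = e2" using clsf1[OF c] unfolding E2_def by auto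
        moreover have "v = v'" if "a = e2" using True c cls12 that by auto
        ultimately show ?thesis using orient1 orient2 uX by (auto simp: inside_def)
      qed
      moreover have "S \<subseteq> E - Inside Y" if "rich" "(w, S) \<in> M" for w S using Mgood[OF that] E_split by blast
      ultimately show "region_state Y {v} f1 M" using vY by (intro region_stateI) blast+
      show "\<exists>\<psi>. partial_flow \<Phi> Y \<psi>" if "ok f1 M \<Phi>" for \<Phi>
        by (rule reduce[OF gd2 sol _ _ MM that]) (use cls21 cls12 in auto)
    qed (use bcond xcond in auto)
  next
    case False
    then have vv: "v \<noteq> v'" and c: "circ f2 e1" by auto
    obtain k0 where k0: "f2 k0 e1 \<noteq> 0" using c unfolding circ_def by blast
    have k0': "f2 k e1 = 0" if "k \<noteq> k0" for k using H.goodD(5)[OF gd2, of e1] k0 that by (cases k; cases k0) auto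
    have fY: "finite Y" using Y finV finite_subset by blast
    \<comment> \<open>As \<open>v'\<close> is outside \<open>Z\<close>, the edge \<open>e2\<close>
      does not meet \<open>Z\<close>, so at most \<open>e1\<close> is lost from a cut of size at
      least 3. One unit of flow needs just one remaining edge.\<close>
    have c1: "1 \<le> card (Between Z (Y - Z))" if Z: "Z \<subseteq> Y" "v \<in> Z" "v' \<notin> Z" for Z
    proof -
      have "3 \<le> card (Cut Z)" by (rule big) (use Z vY in auto)
      moreover have "Cut Z \<subseteq> insert e1 (Between Z (Y - Z))"
      proof
        fix a assume a: "a \<in> Cut Z"
        show "a \<in> insert e1 (Between Z (Y - Z))"
        proof (cases "a \<in> Cut Y")
          case True
          then show ?thesis using a cutY orient2 Z uX unfolding cut_def by auto
        next
          case False
          then show ?thesis using a Z unfolding cut_def between_def by auto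
        qed
      qed
      moreover have fb: "finite (Between Z (Y - Z))" using finE unfolding between_def by auto
      ultimately have "3 \<le> card (insert e1 (Between Z (Y - Z)))" by (meson card_mono finite_insert order_trans)
      then show ?thesis using fb by (simp add: card_insert_if split: if_splits)
    qed
    have "\<exists>f P. P \<subseteq> Y \<and> v \<in> P \<and> v' \<in> P \<and> unit_valued f \<and>
      (\<forall>w. Net f w = of_bool (w = v) - of_bool (w = v')) \<and>
      (\<forall>w. card {e\<in>Star w. f e \<noteq> 0} \<le> (if w = v \<or> w = v' then 1 else 2)) \<and>
      (\<forall>e. f e \<noteq> 0 \<longrightarrow> e \<in> Inside P \<and> t e \<noteq> h e) \<and>
      (\<forall>w\<in>P. \<exists>e\<in>Star w. f e \<noteq> 0) \<and> connects t h E {e. f e \<noteq> 0} P"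
      by (rule region_path[OF fY finE vY vv c1])
    then obtain f0 P where P: "P \<subseteq> Y" "v \<in> P" "v' \<in> P" and u0: "unit_valued f0"
      and n0: "\<forall>w. Net f0 w = of_bool (w = v) - of_bool (w = v')"
      and card0: "\<forall>w. card {e\<in>Star w. f0 e \<noteq> 0} \<le> (if w = v \<or> w = v' then 1 else 2)"
      and in0: "\<forall>e. f0 e \<noteq> 0 \<longrightarrow> e \<in> Inside P \<and> t e \<noteq> h e"
      and touch0: "\<forall>w\<in>P. \<exists>e\<in>Star w. f0 e \<noteq> 0" and conn0: "connects t h E {e. f0 e \<noteq> 0} P"
      by (elim exE conjE) (rule that; assumption)
    have PY: "Inside P \<subseteq> Inside Y" using P unfolding inside_def by auto
    \<comment> \<open>The open circuit has net value \<open>- cc\<close> at \<open>v\<close> and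
      \<open>cc\<close> at \<open>v'\<close>, whereas \<open>f0\<close> has 1 and -1 there.\<close>
    define cc where "cc = s1 * f2 k0 e1"
    have ccu: "cc = 1 \<or> cc = -1"
      using H.goodD(1)[OF gd2, of k0] k0 ss unfolding unit_valued_def cc_def by auto
    define f where "f = (\<lambda>k a. if k = k0 then f1 k a + cc * f0 a else f1 k a)"
    have f_out: "f k a = f1 k a" if "f0 a = 0" for k a using that unfolding f_def by simp
    have f_in: "f k a = (if k = k0 then cc * f0 a else 0)" if "a \<in> Inside P" for k a
      using that f1Y PY unfolding f_def by auto
    have dich: "f0 a = 0 \<or> f1 k a = 0" for k a using in0 PY f1Y by blast
    have fnz: "f k a \<noteq> 0 \<longleftrightarrow> f1 k a \<noteq> 0 \<or> (k = k0 \<and> f0 a \<noteq> 0)" for k a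
      using dich[of a k] ccu unfolding f_def by auto
    have clsf: "circ f a \<longleftrightarrow> circ f1 a \<or> f0 a \<noteq> 0" for a
      unfolding circ_def fnz by (cases k0) auto
    show ?thesis
    proof (rule solvable_by_region[OF Y big, of e2 P v' f M])
      have unitf: "unit_valued (f k)" for k unfolding unit_valued_def
      proof
        fix a
        have "f k a = f1 k a \<or> f k a = cc * f0 a" using dich[of a k] unfolding f_def by auto
        then show "f k a \<in> {-1, 0, 1}" using unit1[of k] u0 ccu unfolding unit_valued_def by auto
      qed
      have netf: "Net (f k) w = 0" for k w
      proof -
        have "Net (f k) w = Net (f1 k) w + (if k = k0 then cc * Net f0 w else 0)"
          unfolding f_def by (simp add: net_add net_scale)
        moreover have "w \<notin> Y \<Longrightarrow> w \<noteq> v \<and> w \<noteq> v'" using vY by auto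
        ultimately show ?thesis
          using netX1[of w k] netY1[of w k] net_out[of w "f k"] n0 vY k0'[of k] unfolding cc_def
          by (cases "w \<in> V"; cases "w \<in> Y"; cases "k = k0") (auto simp: algebra_simps)
      qed
      have cardf: "card {a\<in>Star w. f k a \<noteq> 0} \<le> 2" for k w
      proof -
        consider "w \<in> X" | "w \<in> Y" | "w \<notin> V" by blast
        then show ?thesis
        proof cases
          case 1
          then have "f0 a = 0" if "a \<in> Star w" for a
            using that in0 P unfolding star_def inside_def by auto
          then have "{a\<in>Star w. f k a \<noteq> 0} = {a\<in>Star w. f1 k a \<noteq> 0}" using f_out by auto
          then show ?thesis using cardX1[OF 1] by simp
        next
          case 2
          \<comment> \<open>At \<open>v\<close> and at \<open>v'\<close> at most one cut edge meets
            at most one path edge; elsewhere in \<open>Y\<close> there are at most two path edges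
            and no cut edge.\<close>
          define Q where "Q = {a\<in>{e1, e2}. a \<in> Star w}"
          define T where "T = {a\<in>Star w. f0 a \<noteq> 0}"
          have sub: "{a\<in>Star w. f k a \<noteq> 0} \<subseteq> Q \<union> T"
            using starY[OF 2] fnz unfolding Q_def T_def by blast
          have fin: "finite Q" "finite T" using fin_star unfolding Q_def T_def by auto
          have "Q \<subseteq> (if w = v then {e1} else {}) \<union> (if w = v' then {e2} else {})"
            using 2 orient1 orient2 uX unfolding star_def Q_def by auto
          then have "card Q \<le> card ((if w = v then {e1} else {}) \<union> (if w = v' then {e2} else {}))"
            by (rule card_mono[rotated]) simp
          also have "\<dots> \<le> (if w = v \<or> w = v' then 1 else 0)" using vv by auto
          finally have "card Q \<le> (if w = v \<or> w = v' then 1 else 0)" .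
          moreover have "card T \<le> (if w = v \<or> w = v' then 1 else 2)"
            using card0[rule_format, of w] unfolding T_def .
          ultimately have "card Q + card T \<le> 2" by (cases "w = v \<or> w = v'") simp_all
          moreover have "card {a\<in>Star w. f k a \<noteq> 0} \<le> card (Q \<union> T)"
            by (rule card_mono[OF _ sub]) (use fin in auto)
          ultimately show ?thesis using card_Un_le[of Q T] by linarith
        next
          case 3 then show ?thesis using star_out by simp
        qed
      qed
      have nef: "a \<in> E \<and> t a \<noteq> h a" if "f k a \<noteq> 0" for k a
        using that ne1[of k a] in0 unfolding fnz inside_def by blast
      have disjf: "f True a = 0 \<or> f False a = 0" for a
        using disj1[of a] dich[of a] unfolding f_def by auto
      have Mf: "w \<in> V \<and> S \<subseteq> Star w \<and> card S = 2 \<and> (\<forall>a\<in>S. \<not> circ f a)" if "rich" "(w, S) \<in> M" for w S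
      proof -
        have "f0 a = 0" if "a \<in> S" for a
          using Mgood[OF \<open>rich\<close> \<open>(w, S) \<in> M\<close>] that in0 PY E_split by blast
        then show ?thesis using Mgood[OF that] clsf by blast
      qed
      have "good f M"
      proof (rule goodI)
        show "w \<in> V \<and> S \<subseteq> Star w \<and> card S = 2 \<and> (\<forall>a\<in>S. \<not> circ f a)" if "rich" "(w, S) \<in> M" for w S
          by (rule Mf[OF that])
        show "S \<inter> S' = {}" if "rich" "(w, S) \<in> M" "(w, S') \<in> M" "S \<noteq> S'" for w S S' by (rule Mdisj[OF that])
        show "circuits t h E f" unfolding circuits_def using unitf netf cardf disjf nef by blast
      qed
      moreover have "{a\<in>Inside P. circ f a} = {a. f0 a \<noteq> 0}"
      proof -
        have "\<not> circ f1 a" if "a \<in> Inside P" for a using that f1Y PY unfolding circ_def by blast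
        then show ?thesis using clsf in0 by blast
      qed
      then have "completes f M P" using conn0 P(1) Y completes_start[of P f M] by (metis order_trans)
      moreover have "{t a, h a} \<inter> (Y - P) = {}" if c: "circ f a" for a
      proof (cases "f0 a = 0")
        case True
        then have "circ f1 a" using c clsf by blast
        then have "a \<in> Inside X \<or> a = e1 \<or> a = e2" using clsf1 unfolding E2_def by auto
        then show ?thesis using orient1 orient2 uX P by (auto simp: inside_def)
      next
        case False
        then show ?thesis using in0 unfolding inside_def by auto
      qed
      moreover have "S \<subseteq> E - Inside Y" if "rich" "(w, S) \<in> M" for w S using Mgood[OF that] E_split by blast
      moreover have "Star w \<inter> Inside P \<noteq> {}" if "w \<in> P" for w using touch0 in0 that by blast
      ultimately show "region_state Y P f M" using P by (intro region_stateI) blast+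
      show "\<exists>\<psi>. partial_flow \<Phi> Y \<psi>" if "ok f M \<Phi>" for \<Phi>
        by (rule reduce[OF gd2 sol _ _ MM that]) (use cls21 cls12 clsf in auto)
    qed (use bcond P xcond in auto)
  qed
qed

end

text \<open>Induction on the number of vertices. \<open>V\<close> is a nonempty set with at most two
  edges leaving it; a smallest such set \<open>Y\<close> has only proper subsets with larger
  boundary. As there are no bridges, its own boundary has size 0 or 2.\<close>

theorem solvable_admissible:
  assumes "avoidance V E t h rich \<Delta> m K" "avoidance.admissible V E t h rich"
  shows "avoidance.solvable V E t h rich m K"
  using assms
proof (induction "card V" arbitrary: V E t h rule: less_induct)
  case less
  interpret avoidance V E t h rich \<Delta> m K by (rule less.prems(1))
  show ?case
  proof (cases "V = {}")
    case True
    then have "E = {}" using ends by auto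
    have "good (\<lambda>k e. 0) {}" by (rule goodI) (auto simp: circuits_def unit_valued_def net_def)
    moreover have "partial_flow \<Phi> {} \<Phi>" for \<Phi>
      unfolding partial_flow_def proper_def using \<open>E = {}\<close> True by simp
    ultimately show ?thesis unfolding solvable_def by blast
  next
    case False
    define P where "P = (\<lambda>Y. Y \<subseteq> V \<and> Y \<noteq> {} \<and> card (Cut Y) \<le> 2)"
    have "Cut V = {}" using ends unfolding cut_def by auto
    then have "P V" unfolding P_def using False by simp
    then obtain Y where "P Y" and Ymin: "\<And>Z. P Z \<Longrightarrow> card Y \<le> card Z"
      using ex_has_least_nat[of P V card] by blast
    then have Y: "Y \<subseteq> V" "Y \<noteq> {}" "card (Cut Y) \<le> 2" unfolding P_def by auto
    have finY: "finite Y" using Y finV finite_subset by blast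
    have big: "3 \<le> card (Cut Z)" if "Z \<subset> Y" "Z \<noteq> {}" for Z
    proof (rule ccontr)
      assume "\<not> ?thesis"
      then have "P Z" unfolding P_def using that Y by auto
      then show False using Ymin[of Z] psubset_card_mono[OF finY that(1)] by linarith
    qed
    have small: "card (V - Y) < card V" using Y finV by (intro psubset_card_mono) auto
    have finC: "finite (Cut Z)" for Z using finE unfolding cut_def by auto
    have "card (Cut Y) \<noteq> 1" using less.prems(2) Y unfolding admissible_def by blast
    then consider "Cut Y = {}" | "card (Cut Y) = 2" using Y(3) finC[of Y] by (metis One_nat_def card_0_eq le_Suc_eq le_zero_eq numeral_2_eq_2)
    then show ?thesis
    proof cases
      case 1
      let ?E = "Inside (V - Y)"
      have av: "avoidance (V - Y) ?E t h rich \<Delta> m K"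
      proof
        show "finite (V - Y)" "finite ?E" using finV finE unfolding inside_def by auto
        show "t e \<in> V - Y \<and> h e \<in> V - Y" if "e \<in> ?E" for e using that unfolding inside_def by auto
        show "0 < m" by (rule m0)
        show "K = 3" if "\<not> rich" by (rule not_rich[OF that])
        show "3 \<le> \<Delta> \<and> K = 8 * int \<Delta> - 13 \<and> (\<forall>v\<in>V - Y. card (star t h ?E v) \<le> \<Delta>) \<and> (\<forall>e\<in>?E. t e \<noteq> h e)" if r: "rich"
        proof -
          have "card (star t h ?E v) \<le> \<Delta>" if "v \<in> V - Y" for v
          proof -
            have "card (star t h ?E v) \<le> card (Star v)"
              by (rule card_mono[OF fin_star]) (auto simp: star_def inside_def)
            then show ?thesis using rich[OF r] that by (meson DiffD1 order_trans)
          qed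
          then show ?thesis using rich[OF r] unfolding inside_def by simp
        qed
      qed
      interpret H: avoidance "V - Y" ?E t h rich \<Delta> m K by (rule av)
      have "H.Cut Z = Cut Z" if "Z \<subseteq> V - Y" for Z
        using 1 that ends unfolding cut_def inside_def by blast
      then have "H.admissible" using less.prems(2) unfolding admissible_def H.admissible_def
        by (metis Diff_subset order_trans)
      then have "H.solvable" by (rule less.hyps[OF small av])
      from this show ?thesis by (rule solvable_component[OF Y(1,2) _ 1 av, rotated]) (rule big)
    next
      case 2
      then obtain e1 e2 where e: "Cut Y = {e1, e2}" "e1 \<noteq> e2" by (auto simp: card_2_iff)
      have *: "\<exists>u v. u \<in> V - Y \<and> v \<in> Y \<and> {t a, h a} = {u, v}" if "a \<in> Cut Y" for a
      proof (cases "t a \<in> Y")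
        case True
        then show ?thesis using that ends[of a] unfolding cut_def by (intro exI[of _ "h a"] exI[of _ "t a"]) auto
      next
        case False
        then show ?thesis using that ends[of a] unfolding cut_def by (intro exI[of _ "t a"] exI[of _ "h a"]) auto
      qed
      obtain u v where uv: "u \<in> V - Y" "v \<in> Y" "{t e1, h e1} = {u, v}" using *[of e1] e by auto
      obtain u' v' where uv': "u' \<in> V - Y" "v' \<in> Y" "{t e2, h e2} = {u', v'}" using *[of e2] e by auto
      interpret T: two_cut V E t h rich \<Delta> m K Y e1 e2 u v u' v'
        by unfold_locales (use less.prems(2) Y big e uv uv' in auto)
      have "T.H.solvable" by (rule less.hyps[OF small T.H T.admissible_H])
      then show ?thesis by (rule T.solvable_two_cut)
    qed
  qed
qed

section \<open>Six-flows of expanded graphs and integer flows\<close>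

text \<open>The representatives in \<open>[0, N)\<close> have net values divisible by
  \<open>N\<close>, and lowering a suitable set \<open>S\<close> of edges by \<open>N\<close>
  cancels these. The cut condition of \<open>gale\<close> holds because every edge carries less than
  \<open>N\<close>.\<close>

lemma integer_lift:
  fixes t h :: "'e \<Rightarrow> 'v" and N :: int
  assumes fin: "finite V" "finite E" and ends: "\<And>e. e \<in> E \<Longrightarrow> t e \<in> V \<and> h e \<in> V" and N: "N > 0"
    and x: "\<And>v. v \<in> V \<Longrightarrow> N dvd net t h E x v"
  shows "\<exists>y. (\<forall>e\<in>E. N dvd y e - x e \<and> \<bar>y e\<bar> < N) \<and> (\<forall>v\<in>V. net t h E y v = 0)"
proof -
  define r where "r = (\<lambda>e. x e mod N)"
  \<comment> \<open>An edge with residue 0 must not be lowered, since it would reach absolute value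
    \<open>N\<close>.\<close>
  define F where "F = {e\<in>E. r e \<noteq> 0}"
  have r: "0 \<le> r e" "r e < N" "N dvd r e - x e" for e
  proof -
    have "(x e mod N) mod N = x e mod N" by simp
    then show "N dvd r e - x e" unfolding r_def by (simp only: mod_eq_dvd_iff)
  qed (use N in \<open>simp_all add: r_def\<close>)
  have Nr: "N dvd net t h E r v" if "v \<in> V" for v
  proof -
    have "N dvd net t h E (\<lambda>e. r e - x e) v" unfolding net_def by (rule dvd_sum) (use r(3) in auto)
    then show ?thesis using x[OF that] unfolding net_diff by (metis diff_add_cancel dvd_add)
  qed
  define b where "b = (\<lambda>v. net t h E r v div N)"
  have b: "net t h E r v = N * b v" if "v \<in> V" for v using Nr[OF that] unfolding b_def by simp
  have bZ: "N * (\<Sum>v\<in>Z. b v) = (\<Sum>e\<in>E. cross t h e Z * r e)" if "Z \<subseteq> V" for Z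
  proof -
    have "finite Z" using that fin(1) finite_subset by blast
    then have "(\<Sum>v\<in>Z. net t h E r v) = (\<Sum>e\<in>E. cross t h e Z * r e)" by (rule sum_net)
    moreover have "(\<Sum>v\<in>Z. net t h E r v) = (\<Sum>v\<in>Z. N * b v)" by (rule sum.cong) (use b that in auto)
    ultimately show ?thesis by (simp add: sum_distrib_left)
  qed
  have "\<exists>S\<subseteq>F. \<forall>v\<in>V. (\<Sum>e\<in>S. inc t h e v) = b v"
  proof (rule gale[OF fin(1)])
    show "finite F" unfolding F_def using fin by auto
    show "t e \<in> V \<and> h e \<in> V" if "e \<in> F" for e using that ends unfolding F_def by auto
    have "(\<Sum>e\<in>E. cross t h e V * r e) = 0" by (rule sum.neutral) (use ends in \<open>auto simp: cross_def\<close>)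
    then show "(\<Sum>v\<in>V. b v) = 0" using bZ[of V] N by simp
  next
    fix Z assume Z: "Z \<subseteq> V"
    let ?O = "{e\<in>F. t e \<in> Z \<and> h e \<notin> Z}"
    have "N * (\<Sum>v\<in>Z. b v) \<le> (\<Sum>e\<in>E. if e \<in> ?O then N else 0)"
      unfolding bZ[OF Z]
    proof (rule sum_mono)
      fix e assume "e \<in> E"
      then show "cross t h e Z * r e \<le> (if e \<in> ?O then N else 0)"
        using r(1,2)[of e] unfolding cross_def F_def by auto
    qed
    also have "\<dots> = N * int (card ?O)"
    proof -
      have "(\<Sum>e\<in>E. if e \<in> ?O then N else 0) = (\<Sum>e\<in>E \<inter> ?O. N)"
        by (rule sum.inter_restrict[OF fin(2), symmetric])
      also have "E \<inter> ?O = ?O" unfolding F_def by auto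
      finally show ?thesis by (simp add: mult.commute)
    qed
    finally show "(\<Sum>v\<in>Z. b v) \<le> int (card ?O)" using N by simp
  qed
  then obtain S where S: "S \<subseteq> F" "\<And>v. v \<in> V \<Longrightarrow> (\<Sum>e\<in>S. inc t h e v) = b v" by blast
  have SE: "S \<subseteq> E" using S(1) unfolding F_def by auto
  define y where "y = (\<lambda>e. r e - N * of_bool (e \<in> S))"
  have "net t h E y v = 0" if "v \<in> V" for v
    unfolding y_def net_diff net_scale net_of_bool[OF fin(2) SE] S(2)[OF that] b[OF that] by simp
  moreover have "N dvd y e - x e" for e
  proof -
    have "y e - x e = (r e - x e) - N * of_bool (e \<in> S)" unfolding y_def by simp
    then show ?thesis using dvd_diff[OF r(3)[of e], of "N * of_bool (e \<in> S)"] by (simp only: dvd_triv_left)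
  qed
  moreover have "\<bar>y e\<bar> < N" for e
  proof (cases "e \<in> S")
    case True
    then have "r e \<noteq> 0" using S(1) unfolding F_def by auto
    then show ?thesis using True r(1,2)[of e] unfolding y_def by auto
  next
    case False
    then show ?thesis using r(1,2)[of e] unfolding y_def by auto
  qed
  ultimately show ?thesis by blast
qed

section \<open>Splitting pairs off their vertices, and 6-flows\<close>

locale split_pairs =
  fixes V :: "'v set" and E :: "'e set" and t h :: "'e \<Rightarrow> 'v" and P :: "('v \<times> 'e set) set"
  assumes finV: "finite V" and finE: "finite E"
    and ends: "\<And>e. e \<in> E \<Longrightarrow> t e \<in> V \<and> h e \<in> V" and noloop: "\<And>e. e \<in> E \<Longrightarrow> t e \<noteq> h e"
    and cut1: "\<And>X. X \<subseteq> V \<Longrightarrow> card (cut t h E X) \<noteq> 1"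
    and cut2: "\<And>X e g. X \<subseteq> V \<Longrightarrow> e \<noteq> g \<Longrightarrow> cut t h E X = {e, g} \<Longrightarrow> \<not> share t h e g"
    and P: "\<And>v S. (v, S) \<in> P \<Longrightarrow> v \<in> V \<and> S \<subseteq> star t h E v \<and> card S = 2"
    and disj: "\<And>v S S'. (v, S) \<in> P \<Longrightarrow> (v, S') \<in> P \<Longrightarrow> S \<noteq> S' \<Longrightarrow> S \<inter> S' = {}"
begin

definition new_end :: "'v \<Rightarrow> 'e \<Rightarrow> 'v + 'v \<times> 'e set" where
  "new_end w e = (if \<exists>S. (w, S) \<in> P \<and> e \<in> S then Inr (w, THE S. (w, S) \<in> P \<and> e \<in> S) else Inl w)"

text \<open>The two edges of a pair \<open>(v, S)\<close> leave \<open>v\<close> for a new vertex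
  \<open>Inr (v, S)\<close>, and a new edge of the same name runs from \<open>Inl v\<close> to
  it.\<close>

definition t' :: "'e + 'v \<times> 'e set \<Rightarrow> 'v + 'v \<times> 'e set" where
  "t' a = (case a of Inl e \<Rightarrow> new_end (t e) e | Inr p \<Rightarrow> Inl (fst p))"

definition h' :: "'e + 'v \<times> 'e set \<Rightarrow> 'v + 'v \<times> 'e set" where
  "h' a = (case a of Inl e \<Rightarrow> new_end (h e) e | Inr p \<Rightarrow> Inr p)"

definition V' where "V' = Inl ` V \<union> Inr ` P"
definition E' where "E' = Inl ` E \<union> Inr ` P"

lemma new_end_pair: "(w, S) \<in> P \<Longrightarrow> e \<in> S \<Longrightarrow> new_end w e = Inr (w, S)"
proof -
  assume a: "(w, S) \<in> P" "e \<in> S"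
  then have "(THE S. (w, S) \<in> P \<and> e \<in> S) = S" using disj by (intro the_equality) blast+
  then show ?thesis using a unfolding new_end_def by auto
qed

lemma new_end_cases: "(new_end w e = Inl w \<and> (\<forall>S. (w, S) \<in> P \<longrightarrow> e \<notin> S)) \<or> (\<exists>S. (w, S) \<in> P \<and> e \<in> S \<and> new_end w e = Inr (w, S))"
proof (cases "\<exists>S. (w, S) \<in> P \<and> e \<in> S")
  case True
  then show ?thesis using new_end_pair by blast
next
  case False
  then show ?thesis unfolding new_end_def by auto
qed

lemma new_end_eq_pair: "(v, S) \<in> P \<Longrightarrow> new_end w e = Inr (v, S) \<longleftrightarrow> w = v \<and> e \<in> S"
  using new_end_cases[of w e] new_end_pair by auto

lemma finP: "finite P"
proof (rule finite_subset)
  show "P \<subseteq> V \<times> Pow E" using P unfolding star_def by auto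
  show "finite (V \<times> Pow E)" using finV finE by simp
qed

lemma simps': "t' (Inl e) = new_end (t e) e" "h' (Inl e) = new_end (h e) e" "t' (Inr p) = Inl (fst p)" "h' (Inr p) = Inr p"
  unfolding t'_def h'_def by simp_all

lemma new_end_V': "w \<in> V \<Longrightarrow> new_end w e \<in> V'"
  using new_end_cases[of w e] unfolding V'_def by auto

lemma avoid': "avoidance V' E' t' h' False 0 2 3"
proof
  show "finite V'" "finite E'" unfolding V'_def E'_def using finV finE finP by auto
  show "t' a \<in> V' \<and> h' a \<in> V'" if "a \<in> E'" for a
  proof (cases a)
    case (Inl e)
    then show ?thesis using that new_end_V' ends[of e] unfolding E'_def by (auto simp: simps')
  next
    case (Inr p)
    then show ?thesis using that P[of "fst p" "snd p"] unfolding E'_def V'_def by (auto simp: simps')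
  qed
qed auto

sublocale A: avoidance V' E' t' h' False 0 2 3 by (rule avoid')

text \<open>A bridge of the expanded graph is a bridge of the original graph or comes from a pair that is
  a 2-edge-cut.\<close>

lemma admissible': "A.admissible"
  unfolding A.admissible_def
proof (intro conjI allI impI)
  fix Z assume Z: "Z \<subseteq> V'"
  show "card (A.Cut Z) \<noteq> 1"
  proof
    assume "card (A.Cut Z) = 1"
    then obtain a where a: "A.Cut Z = {a}" by (auto simp: card_1_singleton_iff)
    define X where "X = {v\<in>V. Inl v \<in> Z}"
    have XV: "X \<subseteq> V" unfolding X_def by auto
    have aE: "a \<in> E'" using a unfolding cut_def by auto
    have crossI: "(t' b \<in> Z) = (h' b \<in> Z)" if "b \<in> E'" "b \<noteq> a" for b
      using a that unfolding cut_def by auto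
    have inP: "Inr (v, S) \<in> Z \<longleftrightarrow> v \<in> X" if "(v, S) \<in> P" "Inr (v, S) \<noteq> a" for v S
      using crossI[of "Inr (v, S)"] that P[OF that(1)] unfolding E'_def X_def by (auto simp: simps')
    show False
    proof (cases a)
      case (Inl e)
      have new_endX: "new_end w g \<in> Z \<longleftrightarrow> w \<in> X" if "w \<in> V" for w g
        using new_end_cases[of w g] inP[of w] that Inl unfolding X_def by auto
      have "g \<in> cut t h E X \<longleftrightarrow> Inl g \<in> A.Cut Z" for g
        unfolding cut_def E'_def using new_endX ends[of g] by (auto simp: simps')
      then have "cut t h E X = {e}" using a Inl by auto
      then show False using cut1[OF XV] by simp
    next
      case (Inr p)
      obtain v S where p: "p = (v, S)" by (cases p)
      have vS: "(v, S) \<in> P" using aE Inr p unfolding E'_def by auto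
      have flip: "Inr (v, S) \<in> Z \<longleftrightarrow> v \<notin> X"
      proof -
        have "Inr (v, S) \<in> A.Cut Z" using a Inr p by simp
        then show ?thesis using P[OF vS] unfolding cut_def X_def by (auto simp: simps')
      qed
      have new_endX: "new_end w g \<in> Z \<longleftrightarrow> (w \<in> X) \<noteq> (w = v \<and> g \<in> S)" if w: "w \<in> V" for w g
      proof (cases "w = v \<and> g \<in> S")
        case True
        then show ?thesis using new_end_pair[OF vS] flip by simp
      next
        case False
        from new_end_cases[of w g] show ?thesis
        proof
          assume "new_end w g = Inl w \<and> (\<forall>S. (w, S) \<in> P \<longrightarrow> g \<notin> S)"
          then show ?thesis using False w unfolding X_def by auto
        next
          assume "\<exists>S. (w, S) \<in> P \<and> g \<in> S \<and> new_end w g = Inr (w, S)"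
          then obtain S' where S': "(w, S') \<in> P" "g \<in> S'" "new_end w g = Inr (w, S')" by blast
          then have "Inr (w, S') \<noteq> a" using False Inr p by auto
          then show ?thesis using inP[OF S'(1)] S' False by auto
        qed
      qed
      have "g \<in> cut t h E X \<longleftrightarrow> g \<in> S" for g
      proof (cases "g \<in> E")
        case True
        have "Inl g \<in> E'" "Inl g \<noteq> a" using True Inr unfolding E'_def by auto
        then have "(new_end (t g) g \<in> Z) = (new_end (h g) g \<in> Z)" using crossI[of "Inl g"] by (simp add: simps')
        moreover have "g \<in> S \<Longrightarrow> t g = v \<or> h g = v" using P[OF vS] unfolding star_def by auto
        ultimately show ?thesis
          using new_endX ends[OF True] noloop[OF True] True unfolding cut_def by auto
      next
        case False
        then show ?thesis using P[OF vS] unfolding cut_def star_def by auto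
      qed
      then have cS: "cut t h E X = S" by blast
      obtain e g where eg: "S = {e, g}" "e \<noteq> g" using P[OF vS] by (auto simp: card_2_iff)
      then have "share t h e g" using P[OF vS] unfolding star_def share_def by auto
      then show False using cut2[OF XV eg(2)] cS eg by simp
    qed
  qed
qed simp

text \<open>\<open>\<Phi>\<close> is odd exactly on the circuits of the expanded graph, and the
  remaining freedom modulo 3 avoids 0 on all other edges. At the new vertex of a pair, conservation
  identifies the signed sum of the pair with the value of the new edge.\<close>

lemma six_flow:
  "\<exists>\<phi>. (\<forall>v\<in>V. net t h E \<phi> v = 0) \<and> (\<forall>e\<in>E. \<not> 6 dvd \<phi> e) \<and>
     (\<forall>(v, S)\<in>P. \<not> 6 dvd (\<Sum>e\<in>S. inc t h e v * \<phi> e))"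
proof -
  have "A.solvable" by (rule solvable_admissible[OF avoid' admissible'])
  then obtain f M where gd: "A.good f M" and
    sol: "\<And>\<Phi>. A.ok f M \<Phi> \<Longrightarrow> \<exists>\<psi>. A.partial_flow \<Phi> {} \<psi>" unfolding A.solvable_def by blast
  define \<Phi> where "\<Phi> = (\<lambda>a. f True a + f False a)"
  have "A.ok f M \<Phi>"
  proof (rule A.okI)
    show "2 * 3 dvd A.Net \<Phi> v" for v unfolding \<Phi>_def net_add using A.goodD(2)[OF gd] by simp
    show "\<not> 2 dvd \<Phi> a" if "False \<or> circ f a" for a
    proof -
      have "f True a \<in> {-1, 0, 1}" "f False a \<in> {-1, 0, 1}" using A.goodD(1)[OF gd] unfolding unit_valued_def by auto
      then show ?thesis using that A.goodD(5)[OF gd, of a] unfolding \<Phi>_def circ_def by auto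
    qed
  qed auto
  then obtain \<psi> where "A.partial_flow \<Phi> {} \<psi>" using sol by blast
  then have \<psi>: "\<And>a. a \<in> E' \<Longrightarrow> \<not> 6 dvd \<psi> a" "\<And>v. v \<in> V' \<Longrightarrow> 6 dvd A.Net \<psi> v"
    unfolding A.partial_flow_def A.proper_def by (auto simp: inside_def)
  \<comment> \<open>An integer flow is required: conservation modulo 6 alone would not provide
    conservation modulo \<open>30 * K\<close>, which the residue flow of the rich case must
    satisfy.\<close>
  have "\<exists>y. (\<forall>a\<in>E'. 6 dvd y a - \<psi> a \<and> \<bar>y a\<bar> < 6) \<and> (\<forall>v\<in>V'. A.Net y v = 0)"
    by (rule integer_lift[OF A.finV A.finE A.ends]) (use \<psi>(2) in auto)
  then obtain y where y: "\<And>a. a \<in> E' \<Longrightarrow> 6 dvd y a - \<psi> a" "\<And>v. v \<in> V' \<Longrightarrow> A.Net y v = 0" by blast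
  have ynz: "\<not> 6 dvd y a" if "a \<in> E'" for a
    using \<psi>(1)[OF that] y(1)[OF that] by (metis dvd_diff minus_diff_eq diff_diff_eq2 add_diff_cancel_left')
  define \<phi> where "\<phi> = (\<lambda>e. y (Inl e))"
  have sumE': "(\<Sum>a\<in>E'. F a) = (\<Sum>e\<in>E. F (Inl e)) + (\<Sum>p\<in>P. F (Inr p))" for F :: "_ \<Rightarrow> int"
  proof -
    have "(\<Sum>a\<in>E'. F a) = (\<Sum>a\<in>Inl ` E. F a) + (\<Sum>a\<in>Inr ` P. F a)"
      unfolding E'_def by (rule sum.union_disjoint) (use finE finP in auto)
    then show ?thesis by (simp add: sum.reindex)
  qed
  have "net t h E \<phi> v = 0" if v: "v \<in> V" for v
  proof -
    \<comment> \<open>Merging \<open>v\<close> with the vertices split off from it undoes the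
      expansion at \<open>v\<close>.\<close>
    define Z where "Z = insert (Inl v) (Inr ` {p\<in>P. fst p = v})"
    have finZ: "finite Z" unfolding Z_def using finP by auto
    have "(\<Sum>z\<in>Z. A.Net y z) = 0" by (rule sum.neutral) (use y(2) v in \<open>auto simp: Z_def V'_def\<close>)
    then have "0 = (\<Sum>a\<in>E'. cross t' h' a Z * y a)" using sum_net[OF finZ, of t' h' E' y] by simp
    also have "\<dots> = (\<Sum>e\<in>E. cross t' h' (Inl e) Z * y (Inl e)) + (\<Sum>p\<in>P. cross t' h' (Inr p) Z * y (Inr p))"
      by (rule sumE')
    also have "(\<Sum>p\<in>P. cross t' h' (Inr p) Z * y (Inr p)) = 0"
      by (rule sum.neutral) (auto simp: cross_def simps' Z_def)
    also have "(\<Sum>e\<in>E. cross t' h' (Inl e) Z * y (Inl e)) = net t h E \<phi> v"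
      unfolding net_def
    proof (rule sum.cong)
      fix e assume "e \<in> E"
      have "new_end w e \<in> Z \<longleftrightarrow> w = v" for w using new_end_cases[of w e] unfolding Z_def by auto
      then show "cross t' h' (Inl e) Z * y (Inl e) = inc t h e v * \<phi> e"
        unfolding cross_def inc_def \<phi>_def by (simp add: simps')
    qed simp
    finally show ?thesis by simp
  qed
  moreover have "\<not> 6 dvd \<phi> e" if "e \<in> E" for e unfolding \<phi>_def by (rule ynz) (use that in \<open>auto simp: E'_def\<close>)
  moreover have "\<not> 6 dvd (\<Sum>e\<in>S. inc t h e v * \<phi> e)" if vS: "(v, S) \<in> P" for v S
  proof -
    have SE: "S \<subseteq> E" using P[OF vS] unfolding star_def by auto
    have "0 = A.Net y (Inr (v, S))" using y(2)[of "Inr (v, S)"] vS unfolding V'_def by simp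
    also have "\<dots> = (\<Sum>e\<in>E. inc t' h' (Inl e) (Inr (v, S)) * y (Inl e)) + (\<Sum>p\<in>P. inc t' h' (Inr p) (Inr (v, S)) * y (Inr p))"
      unfolding net_def by (rule sumE')
    also have "(\<Sum>p\<in>P. inc t' h' (Inr p) (Inr (v, S)) * y (Inr p)) = (\<Sum>p\<in>P. if p = (v, S) then - y (Inr p) else 0)"
      by (rule sum.cong) (auto simp: inc_def simps')
    also have "\<dots> = - y (Inr (v, S))" using vS finP by simp
    also have "(\<Sum>e\<in>E. inc t' h' (Inl e) (Inr (v, S)) * y (Inl e)) = (\<Sum>e\<in>E. if e \<in> S then inc t h e v * \<phi> e else 0)"
      by (rule sum.cong) (auto simp: inc_def simps' new_end_eq_pair[OF vS] \<phi>_def)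
    also have "\<dots> = (\<Sum>e\<in>S. inc t h e v * \<phi> e)"
      using finE SE by (simp add: sum.inter_restrict[symmetric] Int_absorb1)
    finally have "(\<Sum>e\<in>S. inc t h e v * \<phi> e) = y (Inr (v, S))" by simp
    then show ?thesis using ynz[of "Inr (v, S)"] vS unfolding E'_def by simp
  qed
  ultimately show ?thesis by (intro exI[of _ \<phi>]) (auto split: prod.splits)
qed

end

text \<open>The final modulus is \<open>30 * K\<close>, that is \<open>240 * \<Delta> - 390\<close>.
  As in the Chinese remainder theorem, \<open>\<Phi>\<close> combines circuit values with the
  6-flow: \<open>6 * c\<close> is \<open>c\<close> modulo 5 and 0 modulo 6,
  \<open>5 * \<phi>\<close> is 0 modulo 5 and \<open>- \<phi>\<close> modulo 6.\<close>

lemma rich_integer_flow: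
  fixes V :: "'v set" and E :: "'e set" and t h :: "'e \<Rightarrow> 'v"
  assumes finV: "finite V" and finE: "finite E"
    and ends: "\<And>e. e \<in> E \<Longrightarrow> t e \<in> V \<and> h e \<in> V" and noloop: "\<And>e. e \<in> E \<Longrightarrow> t e \<noteq> h e"
    and cut1: "\<And>X. X \<subseteq> V \<Longrightarrow> card (cut t h E X) \<noteq> 1"
    and cut2: "\<And>X e g. X \<subseteq> V \<Longrightarrow> e \<noteq> g \<Longrightarrow> cut t h E X = {e, g} \<Longrightarrow> \<not> share t h e g"
    and deg: "\<Delta> \<ge> 3" "\<And>v. v \<in> V \<Longrightarrow> card (star t h E v) \<le> \<Delta>"
  shows "\<exists>\<phi>. (\<forall>v\<in>V. net t h E \<phi> v = 0) \<and> (\<forall>e\<in>E. \<phi> e \<noteq> 0 \<and> \<bar>\<phi> e\<bar> < 240 * int \<Delta> - 390) \<and>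
    (\<forall>e\<in>E. \<forall>g\<in>E. e \<noteq> g \<and> share t h e g \<longrightarrow> \<bar>\<phi> e\<bar> \<noteq> \<bar>\<phi> g\<bar>)"
proof -
  define K where "K = 8 * int \<Delta> - 13"
  have av: "avoidance V E t h True \<Delta> 30 K"
    by unfold_locales (use finV finE ends noloop deg K_def in auto)
  interpret avoidance V E t h True \<Delta> 30 K by (rule av)
  have "admissible" unfolding admissible_def using cut1 cut2 by blast
  then have "solvable" by (rule solvable_admissible[OF av])
  then obtain f M where gd: "good f M" and sol: "\<And>\<Phi>. ok f M \<Phi> \<Longrightarrow> \<exists>\<psi>. partial_flow \<Phi> {} \<psi>"
    unfolding solvable_def by blast
  define C where "C = (\<lambda>k v. {e\<in>Star v. f k e \<noteq> 0})"
  have finC: "finite (C k v)" for k v unfolding C_def using fin_star by auto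
  have sumC: "(\<Sum>e\<in>C k v. inc t h e v * f k e) = 0" for k v
  proof -
    have "(\<Sum>e\<in>C k v. inc t h e v * f k e) = Net (f k) v"
      unfolding net_def by (rule sum.mono_neutral_left) (use finE in \<open>auto simp: C_def star_def inc_def\<close>)
    then show ?thesis using goodD(2)[OF gd] by simp
  qed
  have incne: "inc t h e v = 1 \<or> inc t h e v = -1" if "e \<in> Star v" for e v
    using that noloop[of e] unfolding star_def inc_def by auto
  \<comment> \<open>By conservation a family of circuits cannot have a single edge at a
    vertex.\<close>
  have card2: "card (C k v) = 2" if "C k v \<noteq> {}" for k v
  proof -
    have "card (C k v) \<le> 2" unfolding C_def by (rule goodD(3)[OF gd])
    moreover have "card (C k v) \<noteq> 1"
    proof
      assume "card (C k v) = 1"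
      then obtain e where e: "C k v = {e}" by (auto simp: card_1_singleton_iff)
      then have "e \<in> Star v" "f k e \<noteq> 0" unfolding C_def by auto
      then show False using sumC[where k=k and v=v] incne[of e v] unfolding e by auto
    qed
    moreover have "card (C k v) \<noteq> 0" using that finC by simp
    ultimately show ?thesis by linarith
  qed
  \<comment> \<open>Besides the recorded pairs of \<open>M\<close>, the two edges of each circuit at
    each of its vertices are split off.\<close>
  define P where "P = M \<union> {(v, C k v) | v k. v \<in> V \<and> C k v \<noteq> {}}"
  have Mp: "v \<in> V \<and> S \<subseteq> Star v \<and> card S = 2 \<and> (\<forall>e\<in>S. \<not> circ f e)" if "(v, S) \<in> M" for v S
    by (rule good_pair[OF gd TrueI that])
  interpret S: split_pairs V E t h P
  proof
    show "v \<in> V \<and> S \<subseteq> Star v \<and> card S = 2" if "(v, S) \<in> P" for v S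
    proof (cases "(v, S) \<in> M")
      case True
      then show ?thesis using Mp by blast
    next
      case False
      with that obtain k where "v \<in> V" "C k v \<noteq> {}" "S = C k v" unfolding P_def by auto
      then show ?thesis using card2[of k v] unfolding C_def by auto
    qed
    show "S \<inter> S' = {}" if s: "(v, S) \<in> P" "(v, S') \<in> P" "S \<noteq> S'" for v S S'
    proof -
      have MC: "S \<inter> C k v = {}" if "(v, S) \<in> M" for S k
        using Mp[OF that] unfolding C_def circ_def by (cases k) auto
      have CC: "C k v \<inter> C k' v = {}" if "C k v \<noteq> C k' v" for k k'
        using that goodD(5)[OF gd] unfolding C_def by (cases k; cases k') auto
      have "(v, S) \<in> M \<or> (\<exists>k. S = C k v)" "(v, S') \<in> M \<or> (\<exists>k. S' = C k v)"
        using s unfolding P_def by auto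
      then show ?thesis
        using good_disjoint[OF gd TrueI _ _ s(3)] MC CC s(3) by (elim disjE exE) (simp_all add: Int_commute)
    qed
  qed (use finV finE ends noloop cut1 cut2 in blast)+
  obtain \<phi> where \<phi>: "\<And>v. v \<in> V \<Longrightarrow> Net \<phi> v = 0" "\<And>e. e \<in> E \<Longrightarrow> \<not> 6 dvd \<phi> e"
    "\<And>v S. (v, S) \<in> P \<Longrightarrow> \<not> 6 dvd (\<Sum>e\<in>S. inc t h e v * \<phi> e)" using S.six_flow by blast
  \<comment> \<open>The possible values 0, 1, -1, 2, -2 are distinct modulo 5, so up to sign they
    tell the two families from each other and from all other edges.\<close>
  define c where "c = (\<lambda>e. f True e + 2 * f False e)"
  define \<Phi> where "\<Phi> = (\<lambda>e. 6 * c e + 5 * \<phi> e)"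
  have fv: "f k e = -1 \<or> f k e = 0 \<or> f k e = 1" for k e
    using goodD(1)[OF gd, of k] unfolding unit_valued_def by auto
  have cv: "c e = 0 \<longleftrightarrow> \<not> circ f e" "\<bar>c e\<bar> \<le> 2" for e
    using fv[of True e] fv[of False e] goodD(5)[OF gd, of e] unfolding c_def circ_def by auto
  have same: "\<exists>k. f k e = s * f k g \<and> f k e \<noteq> 0"
    if "circ f e" "c e = s * c g" "s = 1 \<or> s = -1" for e g s
  proof -
    have "(f True e = s * f True g \<and> f True e \<noteq> 0) \<or> (f False e = s * f False g \<and> f False e \<noteq> 0)"
    proof -
      have "(a = s * b \<and> a \<noteq> 0) \<or> (a' = s * b' \<and> a' \<noteq> 0)"
        if "a = -1 \<or> a = 0 \<or> a = 1" "a' = -1 \<or> a' = 0 \<or> a' = 1" "b = -1 \<or> b = 0 \<or> b = 1"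
          "b' = -1 \<or> b' = 0 \<or> b' = 1" "a = 0 \<or> a' = 0" "b = 0 \<or> b' = 0" "a \<noteq> 0 \<or> a' \<noteq> 0" "a + 2 * a' = s * (b + 2 * b')"
        for a a' b b' :: int
        using \<open>s = 1 \<or> s = -1\<close>
      proof
        assume "s = 1"
        show ?thesis using that unfolding \<open>s = 1\<close> mult_1 by presburger
      next
        assume "s = -1"
        show ?thesis using that unfolding \<open>s = -1\<close> by presburger
      qed
      from this[OF fv[of True e] fv[of False e] fv[of True g] fv[of False g] goodD(5)[OF gd, of e] goodD(5)[OF gd, of g]]
      show ?thesis using that(1,2) unfolding c_def circ_def by blast
    qed
    then show ?thesis by blast
  qed
  \<comment> \<open>Agreement up to sign modulo 5 makes the edges consecutive on a circuit at
    \<open>v\<close>. Conservation of \<open>f k\<close> there turns agreement modulo 6 into a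
    vanishing signed sum of the pair \<open>C k v\<close>, contrary to the choice of
    \<open>\<phi>\<close>.\<close>
  have sep: "\<not> 30 dvd \<Phi> e - s * \<Phi> g"
    if eg: "e \<in> E" "g \<in> E" "e \<noteq> g" "share t h e g" "circ f e" and s: "s = 1 \<or> s = -1" for e g s
  proof
    assume d: "30 dvd \<Phi> e - s * \<Phi> g"
    have eq: "\<Phi> e - s * \<Phi> g = 6 * (c e - s * c g) + 5 * (\<phi> e - s * \<phi> g)" unfolding \<Phi>_def by (simp add: algebra_simps)
    have "5 dvd \<Phi> e - s * \<Phi> g" by (rule dvd_trans[OF _ d]) simp
    then have "5 dvd c e - s * c g" unfolding eq by presburger
    moreover have "\<bar>c e - s * c g\<bar> \<le> 4" using cv(2)[of e] cv(2)[of g] s by auto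
    ultimately have ce: "c e = s * c g" by presburger
    obtain k where k: "f k e = s * f k g" "f k e \<noteq> 0" using same[OF eg(5) ce s] by blast
    obtain v where v: "e \<in> Star v" "g \<in> Star v" using eg unfolding share_def star_def by auto
    have vV: "v \<in> V" using v ends[OF eg(1)] unfolding star_def by auto
    have "e \<in> C k v" "g \<in> C k v" using v k s unfolding C_def by auto
    moreover from this have "card (C k v) = 2" using card2[of k v] by blast
    ultimately have Ceg: "C k v = {e, g}"
      using finC[of k v] eg(3) by (intro card_seteq[symmetric]) auto
    have "inc t h e v * f k e + inc t h g v * f k g = 0" using sumC[where k=k and v=v] eg(3) unfolding Ceg by simp
    then have "(s * inc t h e v + inc t h g v) * f k g = 0" using k(1) by (simp add: algebra_simps)
    then have "inc t h g v = - (s * inc t h e v)" using k by auto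
    then have "(\<Sum>a\<in>C k v. inc t h a v * \<phi> a) = inc t h e v * (\<phi> e - s * \<phi> g)"
      unfolding Ceg using eg(3) by (simp add: algebra_simps)
    moreover have "6 dvd \<phi> e - s * \<phi> g"
    proof -
      have "6 dvd \<Phi> e - s * \<Phi> g" by (rule dvd_trans[OF _ d]) simp
      then show ?thesis unfolding eq by presburger
    qed
    ultimately have "6 dvd (\<Sum>a\<in>C k v. inc t h a v * \<phi> a)" by simp
    moreover have "(v, C k v) \<in> P" unfolding P_def using vV Ceg by auto
    ultimately show False using \<phi>(3) by blast
  qed
  have "ok f M \<Phi>"
  proof (rule okI)
    show "30 * K dvd Net \<Phi> v" if "v \<in> V" for v
      unfolding \<Phi>_def c_def net_add net_scale using \<phi>(1)[OF that] goodD(2)[OF gd] by simp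
    show "\<not> 30 dvd \<Phi> e" if "e \<in> E" for e
    proof
      assume "30 dvd \<Phi> e"
      then have "6 dvd \<phi> e" unfolding \<Phi>_def by presburger
      then show False using \<phi>(2)[OF that] by simp
    qed
    show "\<not> 30 dvd \<Phi> e - \<Phi> g \<and> \<not> 30 dvd \<Phi> e + \<Phi> g"
      if "e \<in> E" "g \<in> E" "e \<noteq> g" "share t h e g" "circ f e" for e g
      using sep[OF that, of 1] sep[OF that, of "-1"] by simp
    show "\<not> 30 dvd (\<Sum>e\<in>S. inc t h e v * \<Phi> e)" if "(v, S) \<in> M" for v S
    proof
      have "(\<Sum>e\<in>S. inc t h e v * \<Phi> e) = 5 * (\<Sum>e\<in>S. inc t h e v * \<phi> e)"
        unfolding sum_distrib_left by (rule sum.cong) (use Mp[OF that] cv in \<open>auto simp: \<Phi>_def\<close>)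
      moreover assume "30 dvd (\<Sum>e\<in>S. inc t h e v * \<Phi> e)"
      ultimately have "6 dvd (\<Sum>e\<in>S. inc t h e v * \<phi> e)" by presburger
      then show False using \<phi>(3)[of v S] that unfolding P_def by blast
    qed
  qed
  then obtain \<psi> where "partial_flow \<Phi> {} \<psi>" using sol by blast
  then have pr: "proper \<Phi> E \<psi>" and cons: "\<And>v. v \<in> V \<Longrightarrow> 30 * K dvd Net \<psi> v"
    unfolding partial_flow_def by (auto simp: inside_def)
  have "\<exists>y. (\<forall>e\<in>E. 30 * K dvd y e - \<psi> e \<and> \<bar>y e\<bar> < 30 * K) \<and> (\<forall>v\<in>V. Net y v = 0)"
    by (rule integer_lift[OF finV finE ends]) (use cons deg K_def in auto)
  then obtain y where y: "\<And>e. e \<in> E \<Longrightarrow> 30 * K dvd y e - \<psi> e" "\<And>e. e \<in> E \<Longrightarrow> \<bar>y e\<bar> < 30 * K"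
    "\<And>v. v \<in> V \<Longrightarrow> Net y v = 0" by blast
  have "y e \<noteq> 0" if "e \<in> E" for e
    using y(1)[OF that] properD(2)[OF pr that] by auto
  moreover have "\<bar>y e\<bar> < 240 * int \<Delta> - 390" if "e \<in> E" for e using y(2)[OF that] unfolding K_def by simp
  moreover have "\<bar>y e\<bar> \<noteq> \<bar>y g\<bar>" if "e \<in> E" "g \<in> E" "e \<noteq> g" "share t h e g" for e g
  proof
    assume "\<bar>y e\<bar> = \<bar>y g\<bar>"
    then consider "y e = y g" | "y e = - y g" by linarith
    then show False
    proof cases
      case 1
      from dvd_diff[OF y(1)[OF that(2)] y(1)[OF that(1)]] show False
        using properD(3)[OF pr TrueI that] 1 by simp
    next
      case 2
      have "(y g - \<psi> g) + (y e - \<psi> e) = - (\<psi> e + \<psi> g)" using 2 by simp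
      with dvd_add[OF y(1)[OF that(2)] y(1)[OF that(1)]] have "30 * K dvd - (\<psi> e + \<psi> g)" by (simp only:)
      then show False using properD(3)[OF pr TrueI that] by (simp only: dvd_minus_iff)
    qed
  qed
  ultimately show ?thesis using y(3) by (intro exI[of _ y]) blast
qed

section \<open>Rich flows of admissible multigraphs\<close>

lemma joined_refl: "v \<in> vertices G \<Longrightarrow> (v, v) \<in> joined G"
  unfolding joined_def by simp

lemma joined_trans: "(u, v) \<in> joined G \<Longrightarrow> (v, w) \<in> joined G \<Longrightarrow> (u, w) \<in> joined G"
  unfolding joined_def by auto

lemma joined_delete: "joined (delete_edge G e) \<subseteq> joined G"
proof -
  have "{(x, y). \<exists>a\<in>edges G - {e}. ends G a = {x, y}} \<subseteq> {(x, y). \<exists>a\<in>edges G. ends G a = {x, y}}" by auto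
  from rtrancl_mono[OF this] show ?thesis unfolding joined_def delete_edge_def by auto
qed

text \<open>Each component of the graph is a union of components left after the deletion, which
  gives a surjection from the latter onto the former. It identifies the components of the two ends
  of \<open>e\<close>, so it is not injective and the number grows.\<close>

lemma bridge_if_cut:
  assumes G: "is_multigraph G" and X: "X \<subseteq> vertices G" and b: "boundary G X = {e}"
  shows "bridge G e"
proof -
  let ?R = "joined G" and ?R' = "joined (delete_edge G e)" and ?V = "vertices G"
  have eE: "e \<in> edges G" using b unfolding boundary_def by auto
  have "card (ends G e) = 2" using G eE unfolding is_multigraph_def by auto
  then obtain u v where uv: "ends G e = {u, v}" "u \<in> X" "v \<in> ?V - X" "u \<in> ?V"
  proof -
    obtain p q where pq: "ends G e = {p, q}" "p \<noteq> q" using \<open>card (ends G e) = 2\<close> by (auto simp: card_2_iff)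
    have "ends G e \<inter> X \<noteq> {}" "ends G e \<inter> (?V - X) \<noteq> {}" using b unfolding boundary_def by auto
    then have "(p \<in> X \<and> q \<in> ?V - X) \<or> (q \<in> X \<and> p \<in> ?V - X)" using pq by auto
    then show ?thesis using that[of p q] that[of q p] pq X by auto
  qed
  have fin: "finite ?V" using G unfolding is_multigraph_def by auto
  have stay: "y \<in> X" if "(u, y) \<in> {(x, y). \<exists>a\<in>edges G - {e}. ends G a = {x, y}}\<^sup>*" for y
    using that
  proof (induction)
    case base
    then show ?case by (rule uv(2))
  next
    case (step y z)
    then obtain a where a: "a \<in> edges G" "a \<noteq> e" "ends G a = {y, z}" by auto
    then have "a \<notin> boundary G X" using b by simp
    moreover have "z \<in> ?V" using G a unfolding is_multigraph_def by auto
    ultimately show ?case using a step.IH unfolding boundary_def by auto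
  qed
  have nR': "(u, v) \<notin> ?R'" using stay[of v] uv(3) unfolding joined_def delete_edge_def by auto
  have uvR: "(u, v) \<in> ?R" "(v, u) \<in> ?R"
    unfolding joined_def using uv eE by (auto intro!: r_into_rtrancl bexI[of _ e] simp: insert_commute)
  let ?C = "components G" and ?C' = "components (delete_edge G e)"
  have V': "vertices (delete_edge G e) = ?V" unfolding delete_edge_def by simp
  have finC': "finite ?C'" unfolding components_def V' quotient_def using fin by auto
  have img: "?R `` (?R' `` {x}) = ?R `` {x}" if "x \<in> ?V" for x
  proof
    show "?R `` (?R' `` {x}) \<subseteq> ?R `` {x}" using joined_delete[of G e] joined_trans[of _ _ G] by blast
    have "(x, x) \<in> ?R'" using joined_refl[of x "delete_edge G e"] that V' by simp
    then show "?R `` {x} \<subseteq> ?R `` (?R' `` {x})" by blast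
  qed
  have CC: "?C = (\<lambda>c. ?R `` c) ` ?C'"
  proof -
    have "?C = (\<lambda>x. ?R `` {x}) ` ?V" unfolding components_def quotient_def by auto
    moreover have "?C' = (\<lambda>x. ?R' `` {x}) ` ?V" unfolding components_def quotient_def V' by auto
    ultimately show ?thesis using img by (simp add: image_image)
  qed
  have "card ?C < card ?C'"
  proof (rule ccontr)
    assume "\<not> ?thesis"
    then have "card ((\<lambda>c. ?R `` c) ` ?C') = card ?C'" using card_image_le[OF finC'] CC by (metis le_antisym not_less)
    then have inj: "inj_on (\<lambda>c. ?R `` c) ?C'" by (rule eq_card_imp_inj_on[OF finC'])
    have "?R `` {u} = ?R `` {v}" using uvR joined_trans[of _ _ G] by blast
    then have "?R `` (?R' `` {u}) = ?R `` (?R' `` {v})" using img uv by auto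
    moreover have "?R' `` {u} \<in> ?C'" "?R' `` {v} \<in> ?C'" unfolding components_def quotient_def V' using uv by auto
    ultimately have "?R' `` {u} = ?R' `` {v}" using inj_onD[OF inj] by blast
    moreover have "(v, v) \<in> ?R'" using joined_refl[of v "delete_edge G e"] uv V' by simp
    ultimately show False using nR' by blast
  qed
  then show ?thesis unfolding bridge_def using eE by simp
qed

theorem theorem1:
  fixes G :: "('v, 'e) multigraph"
  assumes "is_multigraph G"
    and "rich_flow_admissible G"
  shows "admits_rich_flow (264 * int (max_degree G) - 445) G"
proof -
  let ?V = "vertices G" and ?E = "edges G"
  have finV: "finite ?V" and finE: "finite ?E" using assms(1) unfolding is_multigraph_def by auto
  have "\<forall>e\<in>?E. \<exists>p. ends G e = {fst p, snd p} \<and> fst p \<noteq> snd p"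
    using assms(1) unfolding is_multigraph_def by (auto simp: card_2_iff)
  then obtain p where p: "\<And>e. e \<in> ?E \<Longrightarrow> ends G e = {fst (p e), snd (p e)} \<and> fst (p e) \<noteq> snd (p e)"
    by (metis (no_types, lifting))
  define t where "t = (\<lambda>e. fst (p e))"
  define h where "h = (\<lambda>e. snd (p e))"
  have th: "ends G e = {t e, h e}" "t e \<noteq> h e" if "e \<in> ?E" for e using p[OF that] unfolding t_def h_def by auto
  have thV: "t e \<in> ?V \<and> h e \<in> ?V" if "e \<in> ?E" for e
    using th(1)[OF that] assms(1) that unfolding is_multigraph_def by auto
  have cutb: "cut t h ?E X = boundary G X" if "X \<subseteq> ?V" for X
    using th thV unfolding cut_def boundary_def by auto
  have adj: "adjacent_edges G e g \<longleftrightarrow> e \<in> ?E \<and> g \<in> ?E \<and> e \<noteq> g \<and> share t h e g" for e g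
    unfolding adjacent_edges_def share_def using th by auto
  have bl: "bridgeless G" and two: "\<And>e g. e \<noteq> g \<Longrightarrow> edge_cut G {e, g} \<Longrightarrow> \<not> adjacent_edges G e g"
    using assms(2) unfolding rich_flow_admissible_def by auto
  have cut1: "card (cut t h ?E X) \<noteq> 1" if "X \<subseteq> ?V" for X
  proof
    assume "card (cut t h ?E X) = 1"
    with cutb[OF that] obtain e where "boundary G X = {e}" by (auto simp: card_1_singleton_iff)
    then show False using bridge_if_cut[OF assms(1) that] bl unfolding bridgeless_def by blast
  qed
  have cut2: "\<not> share t h e g" if "X \<subseteq> ?V" "e \<noteq> g" "cut t h ?E X = {e, g}" for X e g
  proof -
    have "edge_cut G {e, g}" unfolding edge_cut_def using that cutb by auto
    moreover have "e \<in> ?E" "g \<in> ?E" using that(3) unfolding cut_def by auto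
    ultimately show ?thesis using two that(2) adj by blast
  qed
  have star: "star t h ?E v = {e \<in> ?E. v \<in> ends G e}" for v using th unfolding star_def by auto
  have deg: "card (star t h ?E v) = degree G v" for v unfolding star degree_def ..
  have degle: "degree G v \<le> max_degree G" if "v \<in> ?V" for v
    unfolding max_degree_def using finV that by (intro Max_ge) auto
  let ?D = "\<lparr>verts = ?V, arcs = ?E, tail = t, head = h\<rparr>"
  have orient: "orientation G ?D" unfolding orientation_def using th by auto
  show ?thesis
  proof (cases "?E = {}")
    case True
    \<comment> \<open>Without edges the bound is \<open>-445\<close>, but it constrains values on
      edges only.\<close>
    have "rich_flow (264 * int (max_degree G) - 445) G ?D (\<lambda>_. 0)"
      unfolding rich_flow_def k_flow_def int_flow_def nowhere_zero_def adjacent_edges_def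
      using orient True by (auto simp: in_arcs_def out_arcs_def)
    then show ?thesis unfolding admits_rich_flow_def by blast
  next
    case False
    then obtain e where e: "e \<in> ?E" by blast
    let ?v = "t e"
    have v: "?v \<in> ?V" using thV[OF e] by simp
    have cs: "cut t h ?E {?v} = star t h ?E ?v" unfolding cut_def star_def using th(2) by fastforce
    \<comment> \<open>The edges at a vertex form a cut: degree 1 would give a bridge, degree 2 a
      2-edge-cut whose edges have a common vertex.\<close>
    have "card (star t h ?E ?v) \<ge> 3"
    proof (rule ccontr)
      assume "\<not> ?thesis"
      moreover have "card (star t h ?E ?v) \<noteq> 0" using e finE unfolding star_def by auto
      moreover have "card (star t h ?E ?v) \<noteq> 1" using cut1[of "{?v}"] v unfolding cs by simp
      ultimately have "card (star t h ?E ?v) = 2" by linarith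
      then obtain a b where ab: "star t h ?E ?v = {a, b}" "a \<noteq> b" by (auto simp: card_2_iff)
      then have "a \<in> star t h ?E ?v" "b \<in> star t h ?E ?v" by simp_all
      then have "share t h a b" unfolding star_def share_def by auto
      then show False using cut2[of "{?v}" a b] ab v unfolding cs by simp
    qed
    then have D3: "max_degree G \<ge> 3" using degle[OF v] deg by simp
    have "\<exists>\<phi>. (\<forall>v\<in>?V. net t h ?E \<phi> v = 0) \<and> (\<forall>e\<in>?E. \<phi> e \<noteq> 0 \<and> \<bar>\<phi> e\<bar> < 240 * int (max_degree G) - 390) \<and>
      (\<forall>e\<in>?E. \<forall>g\<in>?E. e \<noteq> g \<and> share t h e g \<longrightarrow> \<bar>\<phi> e\<bar> \<noteq> \<bar>\<phi> g\<bar>)"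
      by (rule rich_integer_flow[OF finV finE thV th(2) cut1 cut2 D3]) (use deg degle in auto)
    then obtain \<phi> where \<phi>: "\<And>v. v \<in> ?V \<Longrightarrow> net t h ?E \<phi> v = 0"
      "\<And>e. e \<in> ?E \<Longrightarrow> \<phi> e \<noteq> 0 \<and> \<bar>\<phi> e\<bar> < 240 * int (max_degree G) - 390"
      "\<And>e g. e \<in> ?E \<Longrightarrow> g \<in> ?E \<Longrightarrow> e \<noteq> g \<Longrightarrow> share t h e g \<Longrightarrow> \<bar>\<phi> e\<bar> \<noteq> \<bar>\<phi> g\<bar>" by blast
    have "(\<Sum>e\<in>in_arcs ?D v. \<phi> e) = (\<Sum>e\<in>out_arcs ?D v. \<phi> e)" if "v \<in> ?V" for v
    proof -
      have "net t h ?E \<phi> v = (\<Sum>e\<in>?E. (if t e = v then \<phi> e else 0) - (if h e = v then \<phi> e else 0))"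
        unfolding net_def by (rule sum.cong) (auto simp: inc_def)
      also have "\<dots> = (\<Sum>e\<in>out_arcs ?D v. \<phi> e) - (\<Sum>e\<in>in_arcs ?D v. \<phi> e)"
        using finE by (simp add: sum_subtractf sum.inter_filter in_arcs_def out_arcs_def)
      finally show ?thesis using \<phi>(1)[OF that] by simp
    qed
    \<comment> \<open>The bounds differ by \<open>24 * int (max_degree G) - 55\<close>, which is
      positive for maximum degree at least 3.\<close>
    moreover have "\<bar>\<phi> e\<bar> < 264 * int (max_degree G) - 445" if "e \<in> ?E" for e
      using \<phi>(2)[OF that] D3 by linarith
    ultimately have "rich_flow (264 * int (max_degree G) - 445) G ?D \<phi>"
      unfolding rich_flow_def k_flow_def int_flow_def nowhere_zero_def adj using orient \<phi>(2,3) by blast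
    then show ?thesis unfolding admits_rich_flow_def by blast
  qed
qed

end
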